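(* For each hyperbolic surface $M$ with $\chi(M)<0$, there is a sequence of closed geodesics $\gamma_n$ on $M$ and lines $l_n$, $m_n$ in the universal cover $\widetilde{M}=\mathbb{H}^2$ of $M$ above $\gamma_n$, such that the length of the orthogonal projection of $m_n$ to $l_n$, divided by the length of $\gamma_n$, converges to $1$ as $n\to\infty$.
   Context: A hyperbolic surface is a surface $M=\mathbb{H}^2/\pi_1(M)$ with $\pi_1(M)$ a discrete torsion-free group of isometries of $\mathbb{H}^2$. A line above a closed geodesic $\gamma$ is a complete geodesic line in $\mathbb{H}^2$ that is a component of the pre-image of $\gamma$. The orthogonal projection of a geodesic line onto another is its image under nearest-point projection. $\chi(M)$ is the Euler characteristic of $M$. *)

theory Defs
  imports "HOL-Analysis.Analysis" "HOL-Algebra.Bij" "HOL-Homology.Homology"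
begin

section \<open>The hyperbolic plane (upper half-plane model, curvature -1)\<close>

definition hplane :: "complex set" where
  "hplane = {z. Im z > 0}"

definition hdist :: "complex \<Rightarrow> complex \<Rightarrow> real" where
  "hdist z w = arcosh (1 + (cmod (z - w))\<^sup>2 / (2 * Im z * Im w))"

text \<open>All isometries, orientation-reversing ones included; so quotients may be non-orientable.\<close>

definition hisometries :: "(complex \<Rightarrow> complex) set" where
  "hisometries = {f \<in> Bij hplane. \<forall>z\<in>hplane. \<forall>w\<in>hplane. hdist (f z) (f w) = hdist z w}"

definition hgeodesic :: "(real \<Rightarrow> complex) \<Rightarrow> bool" where
  "hgeodesic c \<longleftrightarrow> range c \<subseteq> hplane \<and> (\<forall>s t. hdist (c s) (c t) = \<bar>s - t\<bar>)"

definition hline :: "complex set \<Rightarrow> bool" where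
  "hline l \<longleftrightarrow> (\<exists>c. hgeodesic c \<and> l = range c)"

definition orth_proj :: "complex set \<Rightarrow> complex \<Rightarrow> complex" where
  "orth_proj l z = arg_min_on (hdist z) l"

text \<open>Length of a subset of a line: Lebesgue measure with respect to arc length. Two unit-speed
  parametrizations of a line differ by an isometry of the reals, so the choice is immaterial.\<close>

definition length_on_line :: "complex set \<Rightarrow> complex set \<Rightarrow> ennreal" where
  "length_on_line l S = emeasure lborel ((SOME c. hgeodesic c \<and> range c = l) -` S)"

section \<open>Hyperbolic surfaces\<close>

text \<open>The identity is isolated in the compact-open topology on the isometry group. The metric
  \<^const>\<open>hdist\<close> induces the Euclidean topology on the half-plane, so \<^const>\<open>compact\<close> is
  unambiguous here.\<close>

definition hdiscrete :: "(complex \<Rightarrow> complex) set \<Rightarrow> bool" where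
  "hdiscrete \<Gamma> \<longleftrightarrow> (\<exists>K e. compact K \<and> K \<subseteq> hplane \<and> 0 < e \<and>
     (\<forall>g\<in>\<Gamma>. (\<forall>z\<in>K. hdist (g z) z < e) \<longrightarrow> g = \<one>\<^bsub>BijGroup hplane\<^esub>))"

definition torsion_free_subgroup :: "('a, 'b) monoid_scheme \<Rightarrow> 'a set \<Rightarrow> bool" where
  "torsion_free_subgroup G H \<longleftrightarrow> subgroup H G \<and>
     (\<forall>g\<in>H. \<forall>n::nat. 0 < n \<longrightarrow> g [^]\<^bsub>G\<^esub> n = \<one>\<^bsub>G\<^esub> \<longrightarrow> g = \<one>\<^bsub>G\<^esub>)"

text \<open>A hyperbolic surface is represented by its group of deck transformations \<open>\<Gamma>\<close>;
  its points are the \<open>\<Gamma>\<close>-orbits.\<close>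

definition surface_group :: "(complex \<Rightarrow> complex) set \<Rightarrow> bool" where
  "surface_group \<Gamma> \<longleftrightarrow>
     \<Gamma> \<subseteq> hisometries \<and> torsion_free_subgroup (BijGroup hplane) \<Gamma> \<and> hdiscrete \<Gamma>"

definition covering_proj :: "(complex \<Rightarrow> complex) set \<Rightarrow> complex \<Rightarrow> complex set" where
  "covering_proj \<Gamma> z = (\<lambda>g. g z) ` \<Gamma>"

definition surface_points :: "(complex \<Rightarrow> complex) set \<Rightarrow> complex set set" where
  "surface_points \<Gamma> = covering_proj \<Gamma> ` hplane"

definition surface_dist :: "(complex \<Rightarrow> complex) set \<Rightarrow> complex set \<Rightarrow> complex set \<Rightarrow> real" where
  "surface_dist \<Gamma> P Q = Inf {hdist z w | z w. z \<in> P \<and> w \<in> Q}"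

definition surface_topology :: "(complex \<Rightarrow> complex) set \<Rightarrow> complex set topology" where
  "surface_topology \<Gamma> = topology (\<lambda>U. U \<subseteq> surface_points \<Gamma> \<and>
     openin (top_of_set hplane) {z \<in> hplane. covering_proj \<Gamma> z \<in> U})"

lemma openin_surface_topology:
  "openin (surface_topology \<Gamma>) U \<longleftrightarrow> U \<subseteq> surface_points \<Gamma> \<and>
     openin (top_of_set hplane) {z \<in> hplane. covering_proj \<Gamma> z \<in> U}"
proof -
  have "istopology (\<lambda>U. U \<subseteq> surface_points \<Gamma> \<and>
     openin (top_of_set hplane) {z \<in> hplane. covering_proj \<Gamma> z \<in> U})" (is "istopology ?L")
    unfolding istopology_def
  proof (intro conjI allI impI)
    fix S T assume "?L S" "?L T"
    moreover have "{z \<in> hplane. covering_proj \<Gamma> z \<in> S \<inter> T} =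
        {z \<in> hplane. covering_proj \<Gamma> z \<in> S} \<inter> {z \<in> hplane. covering_proj \<Gamma> z \<in> T}"
      by auto
    ultimately show "S \<inter> T \<subseteq> surface_points \<Gamma>"
      "openin (top_of_set hplane) {z \<in> hplane. covering_proj \<Gamma> z \<in> S \<inter> T}"
      by auto
  next
    fix \<K> assume *: "\<forall>K\<in>\<K>. ?L K"
    then show "\<Union>\<K> \<subseteq> surface_points \<Gamma>" by blast
    have "{z \<in> hplane. covering_proj \<Gamma> z \<in> \<Union>\<K>} =
        (\<Union>K\<in>\<K>. {z \<in> hplane. covering_proj \<Gamma> z \<in> K})"
      by auto
    with * show "openin (top_of_set hplane) {z \<in> hplane. covering_proj \<Gamma> z \<in> \<Union>\<K>}"
      by (simp only:) (rule openin_Union, auto)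
  qed
  then show ?thesis
    by (simp add: surface_topology_def)
qed

lemma topspace_surface_topology: "topspace (surface_topology \<Gamma>) = surface_points \<Gamma>"
proof -
  have "{z \<in> hplane. covering_proj \<Gamma> z \<in> surface_points \<Gamma>} = hplane"
    by (auto simp: surface_points_def)
  then have "openin (surface_topology \<Gamma>) (surface_points \<Gamma>)"
    by (simp add: openin_surface_topology)
  then show ?thesis
    by (metis openin_subset openin_surface_topology openin_topspace subset_antisym)
qed

lemma quotient_map_covering_proj:
  "quotient_map (top_of_set hplane) (surface_topology \<Gamma>) (covering_proj \<Gamma>)"
  unfolding quotient_map_def topspace_surface_topology
  by (simp add: openin_surface_topology surface_points_def)

section \<open>Euler characteristic\<close>

definition int_independent :: "('a, 'b) monoid_scheme \<Rightarrow> 'a set \<Rightarrow> bool" where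
  "int_independent G S \<longleftrightarrow> finite S \<and> S \<subseteq> carrier G \<and>
     (\<forall>k :: 'a \<Rightarrow> int. finprod G (\<lambda>s. s [^]\<^bsub>G\<^esub> k s) S = \<one>\<^bsub>G\<^esub> \<longrightarrow> (\<forall>s\<in>S. k s = 0))"

definition abelian_rank :: "('a, 'b) monoid_scheme \<Rightarrow> ereal" where
  "abelian_rank G = (SUP S\<in>{S. int_independent G S}. ereal (real (card S)))"

definition betti_number :: "nat \<Rightarrow> 'a topology \<Rightarrow> ereal" where
  "betti_number p X = abelian_rank (homology_group (int p) X)"

text \<open>Alternating sum of Betti numbers; the homology of a surface vanishes above degree 2.
  For a connected surface only the first Betti number can be infinite, and then the value is
  \<open>-\<infinity>\<close>.\<close>

definition surface_euler_char :: "'a topology \<Rightarrow> ereal" where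
  "surface_euler_char X = betti_number 0 X - betti_number 1 X + betti_number 2 X"

section \<open>Closed geodesics and the lines above them\<close>

text \<open>A closed geodesic of length \<open>L\<close>: a locally distance-preserving map from the circle of
  length \<open>L\<close> to the surface, written as an \<open>L\<close>-periodic map on the reals. As usual, a
  closed geodesic may be multiply traversed, and \<open>L\<close> then counts multiplicity.\<close>

definition closed_geodesic ::
  "(complex \<Rightarrow> complex) set \<Rightarrow> (real \<Rightarrow> complex set) \<Rightarrow> real \<Rightarrow> bool" where
  "closed_geodesic \<Gamma> \<gamma> L \<longleftrightarrow> 0 < L \<and> range \<gamma> \<subseteq> surface_points \<Gamma> \<and>
     (\<forall>t. \<gamma> (t + L) = \<gamma> t) \<and>
     (\<forall>t. \<exists>e>0. \<forall>s\<in>{t - e<..<t + e}. \<forall>s'\<in>{t - e<..<t + e}.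
        surface_dist \<Gamma> (\<gamma> s) (\<gamma> s') = \<bar>s - s'\<bar>)"

text \<open>The preimage of a closed geodesic is a union of countably many complete geodesic lines, its
  components in the sense intended here; they cross when \<open>\<gamma>\<close> is not simple, so they need not be
  connected components. A complete line contained in the preimage meets some member of this
  countable family in an uncountable set and hence is equal to it.\<close>

definition line_above ::
  "(complex \<Rightarrow> complex) set \<Rightarrow> (real \<Rightarrow> complex set) \<Rightarrow> complex set \<Rightarrow> bool" where
  "line_above \<Gamma> \<gamma> l \<longleftrightarrow> hline l \<and> l \<subseteq> {z \<in> hplane. covering_proj \<Gamma> z \<in> range \<gamma>}"

end

(* Let a be a hyperbolic element of the group and b an element that does not preserve the axis of a.
   The axis l of g = a^n b runs along the axis of a for almost its whole period, so l and a(l)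
   fellow-travel for about the translation length of g. Quantitatively: in coordinates where
   g = diag(k, 1/k), let a have the matrix (A B; C D). The projection of a(l) to l has length
   ln |AD / BC|, the translation length of g is 2 ln k, and Fricke's trace identity shows that
   BC (k - 1/k)^2 = 2 - tr [a, g] = 2 - tr [a, b] does not depend on n.
   If there are no such a and b, the group is elementary; then the identity of the surface is
   homotopic to a map that factors through a circle, so the first Betti number is at most 1 and the
   Euler characteristic is nonnegative. *)

theory Submission
  imports Defs "HOL-Real_Asymp.Real_Asymp"
begin

text \<open>The logarithm comes from endpoints. With l the imaginary axis, a(l) ends at B/D and A/C,
  and the foot of the perpendicular from z to l is i |z|, so the projection fills the interval from
  ln |B/D| to ln |A/C|. As AD = 1 + BC, constancy of BC (k - 1/k)^2 makes its length 2 ln k + O(1);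
  a bounded defect is harmless because the translation length tends to infinity. That constant must
  be nonzero, which means that a and b have no common fixed point at infinity. Discreteness forbids
  exactly one common fixed point, so it is enough that b moves one end of the axis of a.
  Orientation-reversing elements have no matrix of determinant 1. They are controlled through their
  squares, which are hyperbolic because a free action contains no reflection. In the elementary case
  the homotopy to the circle is built equivariantly in the half-plane, so that annuli, Moebius
  bands, cusps and the plane itself need no separate topological description.\<close>

section \<open>Betti numbers\<close>

text \<open>Any two elements satisfy the relation a^(f b) b^(- f a) = 1, since \<open>f\<close>
  kills the left side and is injective. Independence then forces f a = f b = 0, hence a = b.\<close>

lemma abelian_rank_le_one:
  assumes G: "comm_group G" and f: "f \<in> hom G integer_group" and inj: "inj_on f (carrier G)"
  shows "abelian_rank G \<le> 1"
proof -
  interpret G: comm_group G by fact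
  interpret f: group_hom G integer_group f
    using f by (simp add: group_hom_def group_hom_axioms_def)
  have "card S \<le> 1" if S: "int_independent G S" for S
  proof (rule ccontr)
    assume "\<not> card S \<le> 1"
    then obtain a b where ab: "a \<in> S" "b \<in> S" "a \<noteq> b"
      by (metis card_le_Suc0_iff_eq S int_independent_def One_nat_def)
    have SG: "S \<subseteq> carrier G" and fin: "finite S"
      using S by (auto simp: int_independent_def)
    define k where "k s = (if s = a then f b else if s = b then - f a else 0)" for s
    have "finprod G (\<lambda>s. s [^]\<^bsub>G\<^esub> k s) S = finprod G (\<lambda>s. s [^]\<^bsub>G\<^esub> k s) {a, b}"
      using SG ab fin by (intro G.finprod_mono_neutral_cong) (auto simp: k_def)
    also have "\<dots> = a [^]\<^bsub>G\<^esub> f b \<otimes>\<^bsub>G\<^esub> b [^]\<^bsub>G\<^esub> (- f a)"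
      using SG ab by (subst G.finprod_insert) (auto simp: k_def subset_iff)
    also have "\<dots> = \<one>\<^bsub>G\<^esub>"
    proof -
      have "a \<in> carrier G" "b \<in> carrier G" using SG ab by auto
      moreover from this have "f (a [^]\<^bsub>G\<^esub> f b \<otimes>\<^bsub>G\<^esub> b [^]\<^bsub>G\<^esub> (- f a)) = f \<one>\<^bsub>G\<^esub>"
        by (simp add: f.hom_int_pow)
      ultimately show ?thesis
        using inj by (meson G.int_pow_closed G.m_closed G.one_closed inj_onD)
    qed
    finally have "\<forall>s\<in>S. k s = 0"
      using S by (auto simp: int_independent_def)
    with ab have "f a = 0" "f b = 0" by (auto simp: k_def split: if_splits)
    then have "f a = f b" by simp
    with inj ab SG show False by (auto dest: inj_onD)
  qed
  then show ?thesis
    unfolding abelian_rank_def by (intro SUP_least) (auto simp: one_ereal_def)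
qed

lemma abelian_rank_nonneg:
  assumes "group G"
  shows "0 \<le> abelian_rank G"
proof -
  have "int_independent G {}"
    by (simp add: int_independent_def)
  then show ?thesis
    unfolding abelian_rank_def by (intro SUP_upper2[of "{}"]) auto
qed

lemma abelian_rank_ge_one:
  assumes G: "comm_group G" and iso: "G \<cong> integer_group"
  shows "1 \<le> abelian_rank G"
proof -
  interpret G: comm_group G by fact
  from iso obtain f where f: "f \<in> iso G integer_group"
    by (auto simp: is_iso_def)
  interpret f: group_hom G integer_group f
    using f by (simp add: group_hom_def group_hom_axioms_def iso_imp_homomorphism)
  have "f ` carrier G = UNIV"
    using f by (auto simp: iso_def bij_betw_def)
  then obtain g where g: "g \<in> carrier G" "f g = 1"
    by (metis UNIV_I imageE)
  have "int_independent G {g}"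
    unfolding int_independent_def
  proof (intro conjI allI impI ballI)
    fix k :: "'a \<Rightarrow> int" and s assume *: "finprod G (\<lambda>s. s [^]\<^bsub>G\<^esub> k s) {g} = \<one>\<^bsub>G\<^esub>" and s: "s \<in> {g}"
    then have "g [^]\<^bsub>G\<^esub> k g = \<one>\<^bsub>G\<^esub>"
      using g by simp
    then have "f (g [^]\<^bsub>G\<^esub> k g) = 0" by simp
    then show "k s = 0" using g s by (simp add: f.hom_int_pow)
  qed (use g in auto)
  then show ?thesis
    unfolding abelian_rank_def by (intro SUP_upper2[of "{g}"]) (auto simp: one_ereal_def)
qed

text \<open>The orthogonal unit vectors 1 and i identify the unit circle with
  \<open>nsphere 1\<close>; reduced and unreduced homology agree in degree 1.\<close>

lemma homology_group_circle: "homology_group 1 (top_of_set (sphere (0::complex) 1)) \<cong> integer_group"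
proof -
  have "orthogonal 1 \<i>" by (simp add: orthogonal_def inner_complex_def)
  then have orth: "pairwise orthogonal {1, \<i>}"
    by (auto simp: pairwise_def orthogonal_commute)
  then have ind: "independent {1, \<i>}"
    by (rule pairwise_orthogonal_independent) auto
  have "(1::complex) \<noteq> \<i>" by (simp add: complex_eq_iff)
  then have card: "card {1, \<i>} = 2" by simp
  have span: "span {1, \<i>} = UNIV"
  proof -
    have "z \<in> span {1, \<i>}" for z :: complex
    proof -
      have "Re z *\<^sub>R 1 + Im z *\<^sub>R \<i> \<in> span {1, \<i>}"
        by (intro span_add[OF span_mul[OF span_base] span_mul[OF span_base]]) simp_all
      moreover have "Re z *\<^sub>R 1 + Im z *\<^sub>R \<i> = z"
        by (simp add: complex_eq_iff)
      ultimately show ?thesis by simp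
    qed
    then show ?thesis by auto
  qed
  obtain f g where "homeomorphic_maps (nsphere (2 - 1)) (top_of_set (sphere 0 1 \<inter> span {1, \<i>})) f g"
    by (rule homeomorphic_maps_nsphere_euclidean_sphere[OF ind orth card]) auto
  then have "nsphere 1 homeomorphic_space top_of_set (sphere (0::complex) 1)"
    using span by (auto simp: homeomorphic_space_def)
  then have "homology_group 1 (nsphere 1) \<cong> homology_group 1 (top_of_set (sphere (0::complex) 1))"
    by (rule homeomorphic_space_imp_isomorphic_homology_groups)
  moreover have "homology_group 1 (nsphere 1) \<cong> integer_group"
    using reduced_homology_group_nsphere(1)[of 1] by (simp add: un_reduced_homology_group)
  ultimately show ?thesis
    by (meson group.iso_sym group_relative_homology_group iso_trans)
qed

text \<open>On first homology \<open>r\<close> induces a left inverse of the map induced by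
  \<open>q\<close>, so the first homology group of X embeds into that of the circle, which is
  infinite cyclic.\<close>

lemma betti_number_1_le_one_if_dominated_by_circle:
  assumes q: "continuous_map X (top_of_set (sphere (0::complex) 1)) q"
    and r: "continuous_map (top_of_set (sphere (0::complex) 1)) X r"
    and h: "homotopic_with (\<lambda>_. True) X X (r \<circ> q) id"
  shows "betti_number 1 X \<le> 1"
proof -
  let ?C = "top_of_set (sphere (0::complex) 1)"
  obtain i where i: "i \<in> iso (homology_group 1 ?C) integer_group"
    using homology_group_circle by (auto simp: is_iso_def)
  have eq: "hom_induced 1 ?C {} X {} r (hom_induced 1 X {} ?C {} q x) = x"
    if "x \<in> carrier (homology_group 1 X)" for x
  proof -
    have "hom_induced 1 X {} X {} (r \<circ> q) = hom_induced 1 X {} X {} id"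
      by (rule homology_homotopy_empty[OF h])
    then have "hom_induced 1 ?C {} X {} r \<circ> hom_induced 1 X {} ?C {} q = hom_induced 1 X {} X {} id"
      using hom_induced_compose_empty[OF q r, of 1] by simp
    from fun_cong[OF this, of x] show ?thesis
      using hom_induced_id[OF that] by simp
  qed
  have "i \<circ> hom_induced 1 X {} ?C {} q \<in> hom (homology_group 1 X) integer_group"
    using i by (intro hom_compose) (auto simp: iso_def hom_induced_empty_hom hom_induced_hom)
  moreover have "inj_on (i \<circ> hom_induced 1 X {} ?C {} q) (carrier (homology_group 1 X))"
  proof (rule comp_inj_on)
    show "inj_on (hom_induced 1 X {} ?C {} q) (carrier (homology_group 1 X))"
      by (rule inj_on_inverseI[where g = "hom_induced 1 ?C {} X {} r"]) (rule eq)
    show "inj_on i (hom_induced 1 X {} ?C {} q ` carrier (homology_group 1 X))"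
    proof (rule inj_on_subset)
      show "inj_on i (carrier (homology_group 1 ?C))"
        using i by (auto simp: iso_def bij_betw_def)
      show "hom_induced 1 X {} ?C {} q ` carrier (homology_group 1 X) \<subseteq> carrier (homology_group 1 ?C)"
        using hom_induced_empty_hom[of 1 X ?C q] by (auto simp: hom_def)
    qed
  qed
  ultimately show ?thesis
    unfolding betti_number_def
    by (intro abelian_rank_le_one) (auto simp: abelian_homology_group)
qed

text \<open>One-sided bounds suffice: b_0 is at least 1 by path-connectedness, b_1 is at most 1 by
  the domination, and b_2 is at least 0.\<close>

lemma surface_euler_char_nonneg_if_dominated_by_circle:
  assumes "path_connected_space X" "topspace X \<noteq> {}"
    and "continuous_map X (top_of_set (sphere (0::complex) 1)) q"
    and "continuous_map (top_of_set (sphere (0::complex) 1)) X r"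
    and "homotopic_with (\<lambda>_. True) X X (r \<circ> q) id"
  shows "0 \<le> surface_euler_char X"
proof -
  have 1: "betti_number 1 X \<le> 1"
    using assms by (intro betti_number_1_le_one_if_dominated_by_circle)
  have 0: "1 \<le> betti_number 0 X"
    unfolding betti_number_def
    using isomorphic_integer_zeroth_homology_group[OF assms(1,2)]
    by (intro abelian_rank_ge_one) (auto simp: abelian_homology_group)
  have 2: "0 \<le> betti_number 2 X"
    unfolding betti_number_def by (rule abelian_rank_nonneg) simp
  have 3: "0 \<le> betti_number 1 X"
    unfolding betti_number_def by (rule abelian_rank_nonneg) simp
  \<comment> \<open>\<open>betti_number 1 X\<close> lies between 0 and 1, so it is finite and the
    extended difference behaves as expected even for an infinite minuend.\<close>
  have "0 \<le> betti_number 0 X - betti_number 1 X"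
    using 0 1 3 by (cases "betti_number 0 X"; cases "betti_number 1 X") auto
  then show ?thesis
    unfolding surface_euler_char_def using 2 by (rule add_nonneg_nonneg)
qed

section \<open>The hyperbolic metric\<close>

lemma hplane_iff: "z \<in> hplane \<longleftrightarrow> 0 < Im z"
  by (simp add: hplane_def)

lemma i_in_hplane [simp]: "\<i> \<in> hplane"
  by (simp add: hplane_iff)

lemma cosh_hdist:
  assumes "z \<in> hplane" "w \<in> hplane"
  shows "cosh (hdist z w) = 1 + (cmod (z - w))\<^sup>2 / (2 * Im z * Im w)"
  unfolding hdist_def using assms by (intro cosh_arcosh_real) (simp add: hplane_iff)

lemma hdist_nonneg: "z \<in> hplane \<Longrightarrow> w \<in> hplane \<Longrightarrow> 0 \<le> hdist z w"
  unfolding hdist_def by (intro arcosh_nonneg_real) (simp add: hplane_iff)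

lemma hdist_le_iff:
  assumes "z \<in> hplane" "w \<in> hplane" "z' \<in> hplane" "w' \<in> hplane"
  shows "hdist z w \<le> hdist z' w' \<longleftrightarrow>
    (cmod (z - w))\<^sup>2 / (Im z * Im w) \<le> (cmod (z' - w'))\<^sup>2 / (Im z' * Im w')"
proof -
  have "hdist z w \<le> hdist z' w' \<longleftrightarrow> cosh (hdist z w) \<le> cosh (hdist z' w')"
    using assms by (simp add: cosh_real_nonneg_le_iff hdist_nonneg)
  moreover have "x / (2 * y) \<le> x' / (2 * y') \<longleftrightarrow> x / y \<le> x' / y'" for x y x' y' :: real
  proof -
    have "x / (2 * y) = (x / y) / 2" "x' / (2 * y') = (x' / y') / 2" by simp_all
    then show ?thesis by linarith
  qed
  ultimately show ?thesis
    using assms by (simp add: cosh_hdist mult.assoc)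
qed

lemma hdist_eq_iff:
  assumes "z \<in> hplane" "w \<in> hplane" "z' \<in> hplane" "w' \<in> hplane"
  shows "hdist z w = hdist z' w' \<longleftrightarrow>
    (cmod (z - w))\<^sup>2 / (Im z * Im w) = (cmod (z' - w'))\<^sup>2 / (Im z' * Im w')"
  using hdist_le_iff[OF assms] hdist_le_iff[OF assms(3,4,1,2)] by linarith

lemma hdist_commute: "hdist z w = hdist w z"
  by (simp add: hdist_def norm_minus_commute mult.commute mult.left_commute)

lemma hdist_refl [simp]: "hdist z z = 0"
  by (simp add: hdist_def)

lemma hdist_eq_0_iff:
  assumes "z \<in> hplane" "w \<in> hplane"
  shows "hdist z w = 0 \<longleftrightarrow> z = w"
  using hdist_eq_iff[OF assms assms(1,1)] assms by (auto simp: hplane_iff)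

lemma sinh_half_hdist:
  assumes "z \<in> hplane" "w \<in> hplane"
  shows "sinh (hdist z w / 2) = cmod (z - w) / (2 * sqrt (Im z * Im w))"
proof (rule power2_eq_imp_eq)
  have "cosh (2 * (hdist z w / 2)) = 2 * sinh (hdist z w / 2) ^ 2 + 1"
    by (simp only: cosh_double cosh_square_eq)
  then have "sinh (hdist z w / 2) ^ 2 = (cmod (z - w))\<^sup>2 / (4 * (Im z * Im w))"
    using cosh_hdist[OF assms] by simp
  then show "sinh (hdist z w / 2) ^ 2 = (cmod (z - w) / (2 * sqrt (Im z * Im w))) ^ 2"
    using assms by (simp add: hplane_iff power_divide power_mult_distrib)
qed (use assms in \<open>auto simp: hdist_nonneg hplane_iff\<close>)

lemma cosh_half_hdist:
  assumes "z \<in> hplane" "w \<in> hplane"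
  shows "cosh (hdist z w / 2) = cmod (z - cnj w) / (2 * sqrt (Im z * Im w))"
proof (rule power2_eq_imp_eq)
  have pos: "0 < Im z * Im w" using assms by (simp add: hplane_iff)
  have "cosh (hdist z w / 2) ^ 2 = (cmod (z - w) / (2 * sqrt (Im z * Im w)))\<^sup>2 + 1"
    by (simp add: cosh_square_eq sinh_half_hdist[OF assms])
  also have "\<dots> = ((cmod (z - w))\<^sup>2 + 4 * (Im z * Im w)) / (4 * (Im z * Im w))"
    using pos by (simp add: power_divide power_mult_distrib add_divide_distrib zero_less_mult_iff, force)
  also have "(cmod (z - w))\<^sup>2 + 4 * (Im z * Im w) = (cmod (z - cnj w))\<^sup>2"
    unfolding cmod_power2 by (simp add: power2_eq_square algebra_simps)
  finally show "cosh (hdist z w / 2) ^ 2 = (cmod (z - cnj w) / (2 * sqrt (Im z * Im w))) ^ 2"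
    using pos by (simp add: power_divide power_mult_distrib)
qed (use assms in \<open>auto simp: hplane_iff\<close>)

text \<open>With half-angle formulas the triangle inequality becomes Ptolemy's inequality for the four
  points \<open>x\<close>, \<open>z\<close>, \<open>y\<close> and \<open>cnj y\<close>.\<close>

lemma hdist_triangle:
  assumes x: "x \<in> hplane" and y: "y \<in> hplane" and z: "z \<in> hplane"
  shows "hdist x z \<le> hdist x y + hdist y z"
proof -
  have pos: "0 < Im x" "0 < Im y" "0 < Im z" using assms by (auto simp: hplane_iff)
  have "(x - z) * (y - cnj y) = (x - y) * (z - cnj y) - (x - cnj y) * (z - y)"
    by (simp add: algebra_simps)
  then have "cmod (x - z) * cmod (y - cnj y) \<le> cmod (x - y) * cmod (z - cnj y) + cmod (x - cnj y) * cmod (z - y)"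
    by (metis norm_mult norm_triangle_ineq4)
  moreover have "cmod (y - cnj y) = 2 * Im y"
    using pos by (simp add: complex_diff_cnj norm_mult)
  moreover have "cmod (z - cnj y) = cmod (y - cnj z)"
    by (metis complex_cnj_cnj complex_cnj_diff complex_mod_cnj norm_minus_commute)
  ultimately have *: "cmod (x - z) * (2 * Im y) \<le> cmod (x - y) * cmod (y - cnj z) + cmod (x - cnj y) * cmod (y - z)"
    by (simp add: norm_minus_commute)
  have "sinh (hdist x z / 2) = cmod (x - z) * (2 * Im y) / (4 * Im y * (sqrt (Im x) * sqrt (Im z)))"
    using pos by (simp add: sinh_half_hdist x z real_sqrt_mult)
  also have "\<dots> \<le> (cmod (x - y) * cmod (y - cnj z) + cmod (x - cnj y) * cmod (y - z)) / (4 * Im y * (sqrt (Im x) * sqrt (Im z)))"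
    using * pos by (intro divide_right_mono) auto
  also have "\<dots> = sinh (hdist x y / 2 + hdist y z / 2)"
  proof -
    have *: "a / (2 * (p * q)) * (b / (2 * (q * r))) = a * b / (4 * y * (p * r))"
      if "q * q = y" for a b p q r y :: real
      using that by (auto simp: algebra_simps)
    show ?thesis
      unfolding sinh_add sinh_half_hdist[OF x y] sinh_half_hdist[OF y z] cosh_half_hdist[OF x y]
        cosh_half_hdist[OF y z] real_sqrt_mult add_divide_distrib
      using pos by (subst (1 2) *) simp_all
  qed
  finally show ?thesis by simp
qed

section \<open>Topology of the hyperbolic metric: continuity, compact balls, finite nets\<close>

lemma continuous_on_hdist: "z \<in> hplane \<Longrightarrow> continuous_on hplane (hdist z)"
  unfolding hdist_def
  by (rule continuous_on_compose2[OF continuous_on_arcosh[of "{1..}"]])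
     (auto intro!: continuous_intros simp: hplane_iff)

lemma open_hplane: "open hplane"
  by (simp add: hplane_def open_halfspace_Im_gt)

text \<open>Clearing denominators in the bound on cosh gives the inequality that defines
  \<open>B\<close>, and this makes sense in the whole plane. Its left side is quadratic and its
  right side linear in w, hence boundedness; for Im w \<le> 0 it would force w = z.\<close>

lemma hball_bounded:
  assumes z: "z \<in> hplane"
  shows "\<exists>B. compact B \<and> B \<subseteq> hplane \<and> {w \<in> hplane. hdist z w \<le> R} \<subseteq> B"
proof -
  define C where "C = 2 * Im z * (cosh R - 1)"
  define B where "B = {w. (cmod (z - w))\<^sup>2 \<le> C * Im w}"
  have C: "C \<ge> 0" using z by (simp add: C_def hplane_iff cosh_real_ge_1)
  have "closed B"
    unfolding B_def by (intro closed_Collect_le continuous_intros)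
  moreover have "bounded B"
  proof -
    \<comment> \<open>Beyond this radius d - C is at least 1, so d (d - C) \<ge> d > C |z|, whereas
      membership in \<open>B\<close> gives d (d - C) \<le> C |z|.\<close>
    have "dist z w \<le> C + 1 + cmod z * C" if "w \<in> B" for w
    proof (rule ccontr)
      let ?d = "cmod (z - w)"
      assume "\<not> dist z w \<le> C + 1 + cmod z * C"
      then have d: "?d > C + 1 + cmod z * C" by (simp add: dist_norm)
      have "Im w \<le> cmod z + ?d"
        by (metis abs_Im_le_cmod abs_le_D1 add.commute norm_triangle_sub order_trans norm_minus_commute)
      then have "?d * ?d \<le> C * (cmod z + ?d)"
        using that C unfolding B_def power2_eq_square by (smt (verit) mem_Collect_eq mult_left_mono)
      then have "?d * (?d - C) \<le> C * cmod z" by (simp add: algebra_simps)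
      moreover have "?d * (?d - C) \<ge> ?d * 1"
      proof (intro mult_left_mono)
        have "0 \<le> cmod z * C" using C by simp
        with d show "1 \<le> ?d - C" by linarith
      qed simp
      ultimately show False using d C by (simp add: mult.commute)
    qed
    then show ?thesis unfolding bounded_def by blast
  qed
  ultimately have "compact B" by (simp add: compact_eq_bounded_closed)
  moreover have "B \<subseteq> hplane"
  proof
    fix w assume w: "w \<in> B"
    then have "0 \<le> C * Im w" unfolding B_def by (smt (verit) mem_Collect_eq zero_le_power2)
    moreover have False if "Im w \<le> 0"
    proof -
      have "C * Im w \<le> 0" using that C by (simp add: mult_nonneg_nonpos)
      then have "cmod (z - w) = 0"
        using w unfolding B_def by (smt (verit) mem_Collect_eq power2_eq_square zero_le_power2 zero_eq_power2)
      then show False using that z by (simp add: hplane_iff)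
    qed
    ultimately show "w \<in> hplane" by (force simp: hplane_iff)
  qed
  moreover have "{w \<in> hplane. hdist z w \<le> R} \<subseteq> B"
  proof clarify
    fix w assume w: "w \<in> hplane" "hdist z w \<le> R"
    then have "cosh (hdist z w) \<le> cosh R"
      using hdist_nonneg[OF z w(1)] by (simp add: cosh_real_nonneg_le_iff)
    then show "w \<in> B"
      using w z by (simp add: cosh_hdist B_def C_def hplane_iff field_simps)
  qed
  ultimately show ?thesis by blast
qed

lemma compact_hdist_net:
  assumes K: "compact K" "K \<subseteq> hplane" and e: "0 < e"
  obtains F where "finite F" "F \<subseteq> K" "\<And>z. z \<in> K \<Longrightarrow> \<exists>x\<in>F. hdist x z < e"
proof -
  have "open {w \<in> hplane. hdist x w < e}" if "x \<in> K" for x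
  proof -
    have "{w \<in> hplane. hdist x w < e} = hplane \<inter> hdist x -` {..<e}" by auto
    then show ?thesis
      using continuous_open_preimage[OF continuous_on_hdist open_hplane open_lessThan] that K by auto
  qed
  moreover have "K \<subseteq> (\<Union>x\<in>K. {w \<in> hplane. hdist x w < e})"
    using K e by auto
  ultimately obtain F where "F \<subseteq> K" "finite F" "K \<subseteq> (\<Union>x\<in>F. {w \<in> hplane. hdist x w < e})"
    using compactE_image[OF K(1), of K "\<lambda>x. {w \<in> hplane. hdist x w < e}"] by blast
  then show thesis by (intro that[of F]) auto
qed

section \<open>Moebius transformations\<close>

definition mat2 :: "real \<Rightarrow> real \<Rightarrow> real \<Rightarrow> real \<Rightarrow> real^2^2" where
  "mat2 a b c d = vector [vector [a, b], vector [c, d]]"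

lemma mat2_nth [simp]:
  "mat2 a b c d $ 1 $ 1 = a" "mat2 a b c d $ 1 $ 2 = b"
  "mat2 a b c d $ 2 $ 1 = c" "mat2 a b c d $ 2 $ 2 = d"
  by (simp_all add: mat2_def)

lemma mat2_eq_iff: "A = B \<longleftrightarrow> A$1$1 = B$1$1 \<and> A$1$2 = B$1$2 \<and> A$2$1 = B$2$1 \<and> A$2$2 = B$2$2"
  for A B :: "real^2^2"
  by (auto simp: vec_eq_iff forall_2)

lemma mat2_mult_nth:
  fixes A B :: "real^2^2"
  shows "(A ** B) $ i $ j = A$i$1 * B$1$j + A$i$2 * B$2$j"
  by (simp add: matrix_matrix_mult_def sum_2)

lemma mat2_cases:
  fixes A :: "real^2^2"
  obtains a b c d where "A = mat2 a b c d"
  by (rule that[of "A$1$1" "A$1$2" "A$2$1" "A$2$2"]) (simp add: mat2_eq_iff)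

lemma det_mat2 [simp]: "det (mat2 a b c d) = a * d - b * c"
  by (simp add: det_2)

lemma trace_2: "trace A = A$1$1 + A$2$2" for A :: "real^2^2"
  by (simp add: trace_def sum_2)

definition adj2 :: "real^2^2 \<Rightarrow> real^2^2" where
  "adj2 A = mat2 (A$2$2) (- A$1$2) (- A$2$1) (A$1$1)"

lemma adj2:
  assumes "det A = 1"
  shows "A ** adj2 A = mat 1" "adj2 A ** A = mat 1" "det (adj2 A) = 1"
  using assms by (auto simp: adj2_def mat2_eq_iff mat2_mult_nth mat_def det_2 algebra_simps)

lemma trace_conj:
  assumes "det T = 1"
  shows "trace (adj2 T ** A ** T) = trace A"
  by (metis adj2(1)[OF assms] matrix_mul_assoc matrix_mul_rid trace_mul_sym matrix_mul_lid)

definition mob :: "real^2^2 \<Rightarrow> complex \<Rightarrow> complex" where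
  "mob A z = (of_real (A$1$1) * z + of_real (A$1$2)) / (of_real (A$2$1) * z + of_real (A$2$2))"

lemma mob_denom_nonzero:
  fixes A :: "real^2^2"
  assumes "det A = 1" "z \<in> hplane"
  shows "of_real (A$2$1) * z + of_real (A$2$2) \<noteq> 0"
proof
  assume "of_real (A$2$1) * z + of_real (A$2$2) = 0"
  then have *: "Im (of_real (A$2$1) * z + of_real (A$2$2)) = 0" "Re (of_real (A$2$1) * z + of_real (A$2$2)) = 0"
    by simp_all
  then have "A$2$1 = 0" using assms(2) by (simp add: hplane_iff)
  with * assms(1) show False by (simp add: det_2)
qed

lemma mob_mult:
  assumes "det A = 1" "det B = 1" "z \<in> hplane"
  shows "mob (A ** B) z = mob A (mob B z)"
proof -
  have *: "of_real (B$2$1) * z + of_real (B$2$2) \<noteq> 0"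
    using assms by (intro mob_denom_nonzero)
  define m where "m = of_real (B$1$1) * z + of_real (B$1$2)"
  define n where "n = of_real (B$2$1) * z + of_real (B$2$2)"
  have n: "n \<noteq> 0" using * by (simp add: n_def)
  have lin: "of_real x * (m / n) + of_real y = (of_real x * m + of_real y * n) / n" for x y :: real
    using n by (simp add: add_divide_distrib)
  have "mob B z = m / n" by (simp add: mob_def m_def n_def)
  then have "mob A (mob B z) = (of_real (A$1$1) * m + of_real (A$1$2) * n) / (of_real (A$2$1) * m + of_real (A$2$2) * n)"
    unfolding mob_def[of A] by (simp only: lin) (use n in simp)
  also have "\<dots> = mob (A ** B) z"
    by (simp add: mob_def mat2_mult_nth algebra_simps m_def n_def)
  finally show ?thesis ..
qed

lemma mob_id [simp]: "mob (mat 1) z = z"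
  by (simp add: mob_def mat_def)

lemma mob_diff:
  assumes "det A = 1" "z \<in> hplane" "w \<in> hplane"
  shows "mob A z - mob A w = (z - w) /
    ((of_real (A$2$1) * z + of_real (A$2$2)) * (of_real (A$2$1) * w + of_real (A$2$2)))"
proof -
  have "of_real (A$1$1) * of_real (A$2$2) - of_real (A$1$2) * of_real (A$2$1) = (1::complex)"
    using assms(1) unfolding det_2 by (metis of_real_1 of_real_diff of_real_mult)
  moreover have distrib: "(a * z + b) * (c * w + d) - (a * w + b) * (c * z + d) = (a * d - b * c) * (z - w)"
    for a b c d z w :: complex
    by (simp add: algebra_simps)
  ultimately have "(of_real (A$1$1) * z + of_real (A$1$2)) * (of_real (A$2$1) * w + of_real (A$2$2))
      - (of_real (A$1$1) * w + of_real (A$1$2)) * (of_real (A$2$1) * z + of_real (A$2$2)) = z - w"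
    by (simp only: distrib mult_1_left)
  then show ?thesis
    unfolding mob_def diff_frac_eq[OF mob_denom_nonzero[OF assms(1,2)] mob_denom_nonzero[OF assms(1,3)]]
    by simp
qed

lemma Im_mob:
  assumes "det A = 1" "z \<in> hplane"
  shows "Im (mob A z) = Im z / (cmod (of_real (A$2$1) * z + of_real (A$2$2)))\<^sup>2"
proof -
  have *: "of_real (A$1$1) * of_real (A$2$2) - of_real (A$1$2) * of_real (A$2$1) = (1::complex)"
    using assms(1) unfolding det_2 by (metis of_real_1 of_real_diff of_real_mult)
  define n where "n = of_real (A$2$1) * z + of_real (A$2$2)"
  have "mob A z = ((of_real (A$1$1) * z + of_real (A$1$2)) * cnj n) / of_real ((cmod n)\<^sup>2)"
    unfolding mob_def n_def[symmetric] by (rule complex_div_cnj)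
  then have "Im (mob A z) = Im ((of_real (A$1$1) * z + of_real (A$1$2)) * cnj n) / (cmod n)\<^sup>2"
    by (simp only: Im_divide_of_real)
  also have "Im ((of_real (A$1$1) * z + of_real (A$1$2)) * cnj n) = (A$1$1 * A$2$2 - A$1$2 * A$2$1) * Im z"
    by (simp add: n_def algebra_simps)
  finally show ?thesis using assms(1) by (simp add: det_2 n_def)
qed

lemma mob_in_hplane: "det A = 1 \<Longrightarrow> z \<in> hplane \<Longrightarrow> mob A z \<in> hplane"
  using Im_mob[of A z] mob_denom_nonzero[of A z] by (simp add: hplane_iff)

lemma hdist_mob:
  assumes "det A = 1" "z \<in> hplane" "w \<in> hplane"
  shows "hdist (mob A z) (mob A w) = hdist z w"
proof -
  have *: "cmod (of_real (A$2$1) * z + of_real (A$2$2)) \<noteq> 0" "cmod (of_real (A$2$1) * w + of_real (A$2$2)) \<noteq> 0"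
    using mob_denom_nonzero assms by auto
  have "(cmod (mob A z - mob A w))\<^sup>2 / (Im (mob A z) * Im (mob A w)) = (cmod (z - w))\<^sup>2 / (Im z * Im w)"
    using * by (simp add: mob_diff Im_mob assms norm_divide norm_mult power_divide power_mult_distrib)
  then show ?thesis
    by (subst hdist_eq_iff) (auto simp: assms mob_in_hplane)
qed

lemma mob_adj2:
  assumes "det A = 1" "z \<in> hplane"
  shows "mob A (mob (adj2 A) z) = z" "mob (adj2 A) (mob A z) = z"
  using assms by (metis adj2 mob_mult mob_id)+

lemma continuous_on_mob: "det A = 1 \<Longrightarrow> continuous_on hplane (mob A)"
  unfolding mob_def by (intro continuous_intros) (simp add: mob_denom_nonzero)

lemma mob_uminus [simp]: "mob (- A) = mob A"
proof
  fix z
  have "mob (- A) z = (- (of_real (A$1$1) * z + of_real (A$1$2))) / (- (of_real (A$2$1) * z + of_real (A$2$2)))"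
    by (simp add: mob_def)
  then show "mob (- A) z = mob A z"
    by (simp only: minus_divide_divide mob_def)
qed

text \<open>Reflection in the imaginary axis, the fixed representative of the orientation-reversing
  isometries.\<close>

definition mirror :: "complex \<Rightarrow> complex" where
  "mirror z = - cnj z"

lemma mirror_simps [simp]:
  "Re (mirror z) = - Re z" "Im (mirror z) = Im z" "mirror (mirror z) = z"
  "mirror z \<in> hplane \<longleftrightarrow> z \<in> hplane" "cmod (mirror z) = cmod z"
  by (auto simp: mirror_def hplane_iff)

section \<open>Isometries of the hyperbolic plane\<close>

lemma mob_transitive:
  assumes "z \<in> hplane"
  obtains A where "det A = 1" "mob A \<i> = z"
proof -
  have y: "0 < Im z" using assms by (simp add: hplane_iff)
  define s where "s = sqrt (Im z)"
  have s: "s \<noteq> 0" "s * s = Im z" using y by (auto simp: s_def)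
  have "mob (mat2 s (Re z / s) 0 (1 / s)) \<i> = of_real (s * s) * \<i> + of_real (Re z)"
    using s(1) by (simp add: mob_def field_simps)
  also have "\<dots> = z" by (simp add: s(2) complex_eq_iff)
  finally show thesis using s(1) by (intro that[of "mat2 s (Re z / s) 0 (1 / s)"]) auto
qed

text \<open>In the Cayley coordinate (z - i)/(z + i) the matrix acts as rotation about 0 by twice
  its angle; the equation is this with denominators cleared.\<close>

lemma mob_rotation:
  fixes \<theta> :: real
  defines "A \<equiv> mat2 (cos \<theta>) (sin \<theta>) (- sin \<theta>) (cos \<theta>)"
  assumes z: "z \<in> hplane"
  shows "(mob A z - \<i>) * (z + \<i>) = cis (2 * \<theta>) * (z - \<i>) * (mob A z + \<i>)"
proof -
  define n where "n = - of_real (sin \<theta>) * z + of_real (cos \<theta>)"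
  have det: "det A = 1" by (simp add: A_def power2_eq_square[symmetric])
  have n: "n \<noteq> 0" using mob_denom_nonzero[OF det z] by (simp add: n_def A_def)
  have *: "mob A z * n = of_real (cos \<theta>) * z + of_real (sin \<theta>)"
    using n by (simp add: mob_def A_def n_def)
  have c: "cis \<theta> = of_real (cos \<theta>) + \<i> * of_real (sin \<theta>)" "cis (-\<theta>) = of_real (cos \<theta>) - \<i> * of_real (sin \<theta>)"
    by (simp_all add: complex_eq_iff)
  have "(mob A z - \<i>) * n = cis \<theta> * (z - \<i>)"
    unfolding left_diff_distrib * unfolding n_def c by (simp add: algebra_simps)
  moreover have "(mob A z + \<i>) * n = cis (-\<theta>) * (z + \<i>)"
    unfolding distrib_right * unfolding n_def c by (simp add: algebra_simps)
  moreover have "cis (2 * \<theta>) * cis (-\<theta>) = cis \<theta>" by (simp add: cis_mult)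
  moreover have "(X * b) * n = (d * a * Y) * n"
    if "X * n = c * a" "Y * n = c' * b" "d * c' = c" for X Y a b c c' d :: complex
  proof -
    have "(X * b) * n = (X * n) * b" "(d * a * Y) * n = d * a * (Y * n)" by (simp_all add: mult_ac)
    then show ?thesis unfolding that(1,2) that(3)[symmetric] by (simp only: mult_ac)
  qed
  ultimately have "((mob A z - \<i>) * (z + \<i>)) * n = (cis (2 * \<theta>) * (z - \<i>) * (mob A z + \<i>)) * n"
    by blast
  then show ?thesis using n by simp
qed

lemma mob_fixing_i:
  assumes w: "w \<in> hplane" and eq: "hdist \<i> w = hdist \<i> (2 * \<i>)"
  obtains A where "det A = 1" "mob A \<i> = \<i>" "mob A (2 * \<i>) = w"
proof -
  have y: "0 < Im w" using w by (simp add: hplane_iff)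
  have i2: "2 * \<i> \<in> hplane" "\<i> * 2 \<in> hplane" by (simp_all add: hplane_iff)
  have "(cmod (\<i> - w))\<^sup>2 = Im w / 2"
    using eq y by (subst (asm) hdist_eq_iff) (auto simp: w i2 field_simps)
  then have 1: "(cmod (w - \<i>))\<^sup>2 = Im w / 2" by (simp add: norm_minus_commute)
  have "(cmod (w + \<i>))\<^sup>2 = (cmod (w - \<i>))\<^sup>2 + 4 * Im w"
    unfolding cmod_power2 by (simp add: power2_eq_square algebra_simps)
  with 1 have "(cmod (w + \<i>))\<^sup>2 = (3 * cmod (w - \<i>))\<^sup>2"
    by (simp add: power_mult_distrib)
  then have 2: "cmod (w + \<i>) = 3 * cmod (w - \<i>)"
    by (rule power2_eq_imp_eq) auto
  have nz: "w + \<i> \<noteq> 0" using y by (auto simp: complex_eq_iff)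
  \<comment> \<open>The Cayley coordinate (z - i)/(z + i) of 2i is 1/3, so \<open>u\<close> is the
    quotient of the coordinates of w and 2i. It has modulus 1 because both points are equally far
    from i. The matrix \<open>A\<close> below uses half its argument since
    \<open>mob_rotation\<close> doubles angles.\<close>
  define u where "u = 3 * (w - \<i>) / (w + \<i>)"
  define \<phi> where "\<phi> = Arg u"
  have "cmod u = 3 * cmod (w - \<i>) / cmod (w + \<i>)"
    unfolding u_def norm_divide norm_mult by simp
  then have "cmod u = (if w = \<i> then 0 else 1)"
    using 2 nz by simp
  moreover have "w \<noteq> \<i>" using 2 nz by auto
  ultimately have "cis \<phi> = u" unfolding \<phi>_def by (subst cis_Arg) (auto simp: sgn_eq)
  then have \<phi>: "3 * (w - \<i>) = cis \<phi> * (w + \<i>)" using nz by (simp add: u_def)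
  define A where "A = mat2 (cos (\<phi>/2)) (sin (\<phi>/2)) (- sin (\<phi>/2)) (cos (\<phi>/2))"
  have det: "det A = 1" by (simp add: A_def power2_eq_square[symmetric])
  define v where "v = mob A (2 * \<i>)"
  have "(v - \<i>) * 3 = cis \<phi> * (v + \<i>)"
  proof -
    have "(v - \<i>) * (2 * \<i> + \<i>) = cis \<phi> * (2 * \<i> - \<i>) * (v + \<i>)"
      using mob_rotation[OF i2(1), of "\<phi>/2"] by (simp add: v_def A_def)
    then have "\<i> * ((v - \<i>) * 3) = \<i> * (cis \<phi> * (v + \<i>))" by (simp add: algebra_simps)
    then show ?thesis by simp
  qed
  then have "(v - \<i>) * 3 * (w + \<i>) = (v + \<i>) * (3 * (w - \<i>))"
    unfolding \<phi> by (simp add: mult_ac)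
  then have "v = w" by (simp add: algebra_simps)
  moreover have "mob A \<i> = \<i>"
    using mob_rotation[OF i_in_hplane, of "\<phi>/2"] by (simp add: A_def)
  ultimately show thesis using det by (intro that[of A]) (auto simp: v_def)
qed

text \<open>The difference of the two cleared distance equations is (3 - 2y) y' = (3 - 2y') y, which
  gives y = y'; then either equation leaves x^2 = x'^2.\<close>

lemma hdist_two_points:
  assumes "z \<in> hplane" "z' \<in> hplane"
    and 1: "hdist \<i> z = hdist \<i> z'" and 2: "hdist (2 * \<i>) z = hdist (2 * \<i>) z'"
  shows "z' = z \<or> z' = mirror z"
proof -
  have i2: "2 * \<i> \<in> hplane" "\<i> * 2 \<in> hplane" by (simp_all add: hplane_iff)
  obtain x y x' y' where z: "z = Complex x y" "z' = Complex x' y'" by (metis complex.exhaust)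
  have pos: "0 < y" "0 < y'" using assms z by (auto simp: hplane_iff)
  have "(x\<^sup>2 + (1 - y)\<^sup>2) / y = (x'\<^sup>2 + (1 - y')\<^sup>2) / y'"
    using 1 by (subst (asm) hdist_eq_iff) (auto simp: hplane_iff pos z cmod_power2)
  then have a: "(x\<^sup>2 + (1 - y)\<^sup>2) * y' = (x'\<^sup>2 + (1 - y')\<^sup>2) * y"
    using pos by (simp add: frac_eq_eq)
  have "(x\<^sup>2 + (2 - y)\<^sup>2) / (2 * y) = (x'\<^sup>2 + (2 - y')\<^sup>2) / (2 * y')"
    using 2 by (subst (asm) hdist_eq_iff) (auto simp: hplane_iff pos z cmod_power2)
  then have b: "(x\<^sup>2 + (2 - y)\<^sup>2) * y' = (x'\<^sup>2 + (2 - y')\<^sup>2) * y"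
    using pos by (simp add: frac_eq_eq)
  have "3 * y' = 3 * y"
    using a b by (simp add: power2_eq_square algebra_simps)
  then have y: "y' = y" by simp
  with a pos have "x\<^sup>2 = x'\<^sup>2" by simp
  then have "x' = x \<or> x' = - x" by (metis power2_eq_iff)
  with y z show ?thesis by (auto simp: mirror_def complex_eq_iff)
qed

lemma hdist_mirror_eq_iff:
  assumes "z \<in> hplane" "w \<in> hplane"
  shows "hdist w z = hdist (mirror w) z \<longleftrightarrow> Re z * Re w = 0"
proof -
  have "Im w * Im z \<noteq> 0" using assms by (simp add: hplane_iff)
  then have "hdist w z = hdist (mirror w) z \<longleftrightarrow> (cmod (w - z))\<^sup>2 = (cmod (mirror w - z))\<^sup>2"
    by (subst hdist_eq_iff) (auto simp: assms)
  also have "\<dots> \<longleftrightarrow> Re z * Re w = 0"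
    unfolding cmod_power2 by (simp add: power2_eq_square algebra_simps)
  finally show ?thesis .
qed

text \<open>Each point is fixed or mirrored. The choice made at the single point 1 + i off the axis
  is binding everywhere: a point treated the other way would be equidistant from a point and its
  mirror image, hence lie on the axis, where both choices agree.\<close>

lemma isometry_fixing_two_points:
  assumes maps: "\<And>z. z \<in> hplane \<Longrightarrow> f z \<in> hplane"
    and isom: "\<And>z w. z \<in> hplane \<Longrightarrow> w \<in> hplane \<Longrightarrow> hdist (f z) (f w) = hdist z w"
    and fix_pts: "f \<i> = \<i>" "f (2 * \<i>) = 2 * \<i>"
  shows "(\<forall>z\<in>hplane. f z = z) \<or> (\<forall>z\<in>hplane. f z = mirror z)"
proof -
  have i2: "2 * \<i> \<in> hplane" "\<i> * 2 \<in> hplane" by (simp_all add: hplane_iff)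
  have alt: "f z = z \<or> f z = mirror z" if "z \<in> hplane" for z
    using isom[OF i_in_hplane that] isom[OF i2(1) that] fix_pts
    by (intro hdist_two_points) (auto simp: that maps)
  define w where "w = 1 + \<i>"
  have w: "w \<in> hplane" "mirror w \<in> hplane" "Re w = 1" by (auto simp: w_def hplane_iff)
  from alt[OF w(1)] show ?thesis
  proof
    assume fw: "f w = w"
    have "f z = z" if z: "z \<in> hplane" for z
    proof (cases "f z = z")
      case False
      then have fz: "f z = mirror z" using alt[OF z] by blast
      have "hdist z w = hdist (mirror z) w"
        using isom[OF z w(1)] fw fz by simp
      then have "Re z = 0" using hdist_mirror_eq_iff[OF w(1) z] w by simp
      with fz show ?thesis by (simp add: complex_eq_iff)
    qed
    then show ?thesis by blast
  next
    assume fw: "f w = mirror w"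
    have "f z = mirror z" if z: "z \<in> hplane" for z
    proof (cases "f z = mirror z")
      case False
      then have fz: "f z = z" using alt[OF z] by blast
      have "hdist w z = hdist (mirror w) z"
        using isom[OF w(1) z] fw fz by simp
      then have "Re z = 0" using hdist_mirror_eq_iff[OF z w(1)] w by simp
      with fz show ?thesis by (simp add: complex_eq_iff)
    qed
    then show ?thesis by blast
  qed
qed

text \<open>A Moebius transformation first matches \<open>f\<close> at i, then, after a rotation
  about i, also at 2i. Removing it leaves an isometry that fixes both points.\<close>

lemma isometry_cases:
  assumes maps: "\<And>z. z \<in> hplane \<Longrightarrow> f z \<in> hplane"
    and isom: "\<And>z w. z \<in> hplane \<Longrightarrow> w \<in> hplane \<Longrightarrow> hdist (f z) (f w) = hdist z w"
  obtains (mob) A where "det A = 1" "\<And>z. z \<in> hplane \<Longrightarrow> f z = mob A z"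
  | (mirror) A where "det A = 1" "\<And>z. z \<in> hplane \<Longrightarrow> f z = mob A (mirror z)"
proof -
  have i2: "2 * \<i> \<in> hplane" "\<i> * 2 \<in> hplane" by (simp_all add: hplane_iff)
  obtain A1 where A1: "det A1 = 1" "mob A1 \<i> = f \<i>"
    using mob_transitive[OF maps[OF i_in_hplane]] by metis
  define w where "w = mob (adj2 A1) (f (2 * \<i>))"
  have w: "w \<in> hplane" unfolding w_def by (intro mob_in_hplane adj2 A1 maps[of "2 * \<i>"] i2)
  have w': "mob A1 w = f (2 * \<i>)" by (simp add: w_def mob_adj2(1)[OF A1(1) maps[OF i2(1)]])
  have "hdist \<i> w = hdist (mob A1 \<i>) (mob A1 w)" by (simp only: hdist_mob[OF A1(1) i_in_hplane w])
  also have "\<dots> = hdist \<i> (2 * \<i>)" unfolding A1 w' by (simp add: isom i2)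
  finally obtain A2 where A2: "det A2 = 1" "mob A2 \<i> = \<i>" "mob A2 (2 * \<i>) = w"
    using mob_fixing_i[OF w] by metis
  define A where "A = A1 ** A2"
  have A: "det A = 1" "mob A \<i> = f \<i>" "mob A (2 * \<i>) = f (2 * \<i>)"
    by (simp_all add: A_def det_mul A1(1) A2(1) mob_mult A2(2,3) i2 w' A1(2))
  let ?\<phi> = "\<lambda>z. mob (adj2 A) (f z)"
  have "(\<forall>z\<in>hplane. ?\<phi> z = z) \<or> (\<forall>z\<in>hplane. ?\<phi> z = mirror z)"
  proof (rule isometry_fixing_two_points)
    show "mob (adj2 A) (f \<i>) = \<i>" "mob (adj2 A) (f (2 * \<i>)) = 2 * \<i>"
      using A mob_adj2(2)[OF A(1)] i2 by (metis i_in_hplane)+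
  qed (simp_all add: mob_in_hplane hdist_mob adj2 A maps isom)
  moreover have "f z = mob A (?\<phi> z)" if "z \<in> hplane" for z
    by (simp add: mob_adj2(1)[OF A(1) maps[OF that]])
  ultimately show thesis
    using that A(1) by metis
qed

section \<open>Groups of deck transformations\<close>

text \<open>Discreteness and torsion-freeness in the form in which they are used: finitely many
  elements of bounded displacement at each point, and a free action. Nothing refers to a base point
  or to coordinates, so the axioms pass to conjugate groups.\<close>

locale deck_group =
  fixes \<Gamma> :: "(complex \<Rightarrow> complex) set"
  assumes maps: "g \<in> \<Gamma> \<Longrightarrow> z \<in> hplane \<Longrightarrow> g z \<in> hplane"
    and isom: "g \<in> \<Gamma> \<Longrightarrow> z \<in> hplane \<Longrightarrow> w \<in> hplane \<Longrightarrow> hdist (g z) (g w) = hdist z w"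
    and ext: "g \<in> \<Gamma> \<Longrightarrow> g \<in> extensional hplane"
    and id_in: "(\<lambda>z\<in>hplane. z) \<in> \<Gamma>"
    and comp_in: "g \<in> \<Gamma> \<Longrightarrow> h \<in> \<Gamma> \<Longrightarrow> compose hplane g h \<in> \<Gamma>"
    and inv_ex: "g \<in> \<Gamma> \<Longrightarrow> \<exists>h\<in>\<Gamma>. \<forall>z\<in>hplane. h (g z) = z \<and> g (h z) = z"
    and finite_displacement: "z \<in> hplane \<Longrightarrow> finite {g \<in> \<Gamma>. hdist z (g z) \<le> R}"
    and free: "g \<in> \<Gamma> \<Longrightarrow> z \<in> hplane \<Longrightarrow> g z = z \<Longrightarrow> g = (\<lambda>z\<in>hplane. z)"

text \<open>Elements moving z by at most R send the finite net \<open>F\<close> of K into one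
  compact set B, and are encoded by approximating the images of \<open>F\<close> in a finite net
  \<open>H\<close> of B. If g and h have the same code, then h^-1 g moves every point of K by less
  than e/4 + e/8 + e/8 + e/4 < e and is the identity. So there are at most as many elements as
  codes.\<close>

lemma hdiscrete_finite_displacement:
  assumes disc: "hdiscrete \<Gamma>" and isos: "\<Gamma> \<subseteq> hisometries" and sub: "subgroup \<Gamma> (BijGroup hplane)"
    and z: "z \<in> hplane"
  shows "finite {g \<in> \<Gamma>. hdist z (g z) \<le> R}"
proof -
  interpret G: group "BijGroup hplane" by (rule group_BijGroup)
  let ?S = "{g \<in> \<Gamma>. hdist z (g z) \<le> R}"
  have Bij: "g \<in> Bij hplane" if "g \<in> \<Gamma>" for g
    using isos that by (auto simp: hisometries_def)
  have maps: "g w \<in> hplane" if "g \<in> \<Gamma>" "w \<in> hplane" for g w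
    using Bij that by (auto simp: Bij_def bij_betw_def)
  have isom: "hdist (g v) (g w) = hdist v w" if "g \<in> \<Gamma>" "v \<in> hplane" "w \<in> hplane" for g v w
    using isos that by (auto simp: hisometries_def)
  obtain K e where K: "compact K" "K \<subseteq> hplane" and e: "0 < e"
    and sep: "\<And>g. g \<in> \<Gamma> \<Longrightarrow> (\<And>w. w \<in> K \<Longrightarrow> hdist (g w) w < e) \<Longrightarrow> g = \<one>\<^bsub>BijGroup hplane\<^esub>"
    using disc unfolding hdiscrete_def by metis
  obtain F where F: "finite F" "F \<subseteq> K" "\<And>w. w \<in> K \<Longrightarrow> \<exists>x\<in>F. hdist x w < e / 4"
    using compact_hdist_net[OF K, of "e / 4"] e by auto
  \<comment> \<open>The largest distance from z to a net point, plus R: this bounds the distance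
    from z to every g x. The inserted 0 covers an empty net.\<close>
  define R' where "R' = Max (insert 0 (hdist z ` F)) + R"
  obtain B where B: "compact B" "B \<subseteq> hplane" "{w \<in> hplane. hdist z w \<le> R'} \<subseteq> B"
    using hball_bounded[OF z] by metis
  obtain H where H: "finite H" "H \<subseteq> B" "\<And>w. w \<in> B \<Longrightarrow> \<exists>y\<in>H. hdist y w < e / 8"
    using compact_hdist_net[OF B(1,2), of "e / 8"] e by auto
  have inB: "g x \<in> B" if "g \<in> ?S" "x \<in> F" for g x
  proof -
    have x: "x \<in> hplane" using that F K by auto
    have "hdist z (g x) \<le> hdist z (g z) + hdist (g z) (g x)"
      using that x z maps[of g] by (intro hdist_triangle) auto
    also have "\<dots> \<le> R + hdist z x"
      using that x z isom[of g z x] by auto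
    also have "hdist z x \<le> Max (insert 0 (hdist z ` F))"
      using F that by (intro Max_ge) auto
    finally have "hdist z (g x) \<le> R'" by (simp add: R'_def)
    then show ?thesis using B(3) maps[of g x] that x by auto
  qed
  define code where "code g = (\<lambda>x\<in>F. SOME y. y \<in> H \<and> hdist y (g x) < e / 8)" for g :: "complex \<Rightarrow> complex"
  have code: "code g x \<in> H" "hdist (code g x) (g x) < e / 8" if "g \<in> ?S" "x \<in> F" for g x
    using someI_ex[of "\<lambda>y. y \<in> H \<and> hdist y (g x) < e / 8"] H(3)[OF inB[OF that]] that
    by (auto simp: code_def)
  have "inj_on code ?S"
  proof (rule inj_onI)
    fix g h assume g: "g \<in> ?S" and h: "h \<in> ?S" and eq: "code g = code h"
    have gh: "g \<in> \<Gamma>" "h \<in> \<Gamma>" using g h by auto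
    define k where "k = inv\<^bsub>BijGroup hplane\<^esub> h \<otimes>\<^bsub>BijGroup hplane\<^esub> g"
    have carr: "g \<in> carrier (BijGroup hplane)" "h \<in> carrier (BijGroup hplane)"
      using gh Bij by (auto simp: BijGroup_def)
    have k: "k \<in> \<Gamma>" unfolding k_def using sub gh by (auto intro: subgroup.m_closed subgroup.m_inv_closed)
    have hk: "h \<otimes>\<^bsub>BijGroup hplane\<^esub> k = g" unfolding k_def using carr by (simp add: G.m_assoc[symmetric])
    have hk': "h (k w) = g w" if "w \<in> hplane" for w
      using fun_cong[OF hk, of w] that Bij gh k by (auto simp: BijGroup_def compose_def)
    have "hdist (k w) w < e" if w: "w \<in> K" for w
    proof -
      obtain x where x: "x \<in> F" "hdist x w < e / 4" using F(3)[OF w] by blast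
      have H': "w \<in> hplane" "x \<in> hplane" "code g x \<in> hplane"
        using w K F x code(1)[OF g x(1)] H B by auto
      have hp: "g w \<in> hplane" "h w \<in> hplane" "g x \<in> hplane" "h x \<in> hplane"
        using H' maps[OF gh(1)] maps[OF gh(2)] by auto
      have "hdist (k w) w = hdist (g w) (h w)"
        using isom[OF gh(2) maps[OF k H'(1)] H'(1)] hk'[OF H'(1)] by simp
      also have "\<dots> \<le> hdist (g w) (g x) + hdist (g x) (h w)"
        using hp by (intro hdist_triangle)
      also have "hdist (g x) (h w) \<le> hdist (g x) (h x) + hdist (h x) (h w)"
        using hp by (intro hdist_triangle)
      also have "hdist (g x) (h x) \<le> hdist (g x) (code g x) + hdist (code g x) (h x)"
        using hp H' by (intro hdist_triangle)
      also have "hdist (g x) (code g x) < e / 8"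
        using code(2)[OF g x(1)] by (simp add: hdist_commute)
      also have "hdist (code g x) (h x) < e / 8"
        using code(2)[OF h x(1)] eq by simp
      also have "hdist (g w) (g x) < e / 4"
        using x H' by (simp add: isom[OF gh(1)] hdist_commute)
      also have "hdist (h x) (h w) < e / 4"
        using x H' by (simp add: isom[OF gh(2)])
      finally show ?thesis using e by simp
    qed
    then have "k = \<one>\<^bsub>BijGroup hplane\<^esub>" using sep k by blast
    then show "g = h" using hk carr by simp
  qed
  moreover have "code ` ?S \<subseteq> PiE F (\<lambda>_. H)"
    using code by (auto simp: PiE_def extensional_def code_def)
  moreover have "finite (PiE F (\<lambda>_. H))" using F H by (intro finite_PiE) auto
  ultimately show ?thesis by (meson finite_imageD finite_subset)
qed

lemma surface_group_imp_deck_group: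
  assumes "surface_group \<Gamma>"
  shows "deck_group \<Gamma>"
proof -
  interpret G: group "BijGroup hplane" by (rule group_BijGroup)
  have isos: "\<Gamma> \<subseteq> hisometries" and sub: "subgroup \<Gamma> (BijGroup hplane)" and disc: "hdiscrete \<Gamma>"
    and tf: "\<And>g n. g \<in> \<Gamma> \<Longrightarrow> 0 < n \<Longrightarrow> g [^]\<^bsub>BijGroup hplane\<^esub> (n::nat) = \<one>\<^bsub>BijGroup hplane\<^esub> \<Longrightarrow> g = \<one>\<^bsub>BijGroup hplane\<^esub>"
    using assms by (auto simp: surface_group_def torsion_free_subgroup_def)
  have Bij: "g \<in> Bij hplane" if "g \<in> \<Gamma>" for g
    using isos that by (auto simp: hisometries_def)
  have carr: "g \<in> carrier (BijGroup hplane)" if "g \<in> \<Gamma>" for g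
    using Bij[OF that] by (simp add: BijGroup_def)
  have mult: "g \<otimes>\<^bsub>BijGroup hplane\<^esub> h = compose hplane g h" if "g \<in> \<Gamma>" "h \<in> \<Gamma>" for g h
    using Bij that by (simp add: BijGroup_def)
  have one: "\<one>\<^bsub>BijGroup hplane\<^esub> = (\<lambda>z\<in>hplane. z)" by (simp add: BijGroup_def)
  have maps: "g w \<in> hplane" if "g \<in> \<Gamma>" "w \<in> hplane" for g w
    using Bij that by (auto simp: Bij_def bij_betw_def)
  have fin: "finite {g \<in> \<Gamma>. hdist z (g z) \<le> R}" if "z \<in> hplane" for z R
    using that by (intro hdiscrete_finite_displacement disc isos sub)
  show ?thesis
  proof
    fix g z assume g: "g \<in> \<Gamma>" and z: "z \<in> hplane" and gz: "g z = z"
    \<comment> \<open>All powers of g fix z, so they lie in the finite set of displacement 0. Two of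
      them coincide, g is a torsion element, and torsion-freeness applies.\<close>
    have pow: "g [^]\<^bsub>BijGroup hplane\<^esub> n \<in> \<Gamma> \<and> (g [^]\<^bsub>BijGroup hplane\<^esub> n) z = z" for n :: nat
    proof (induction n)
      case 0
      then show ?case using subgroup.one_closed[OF sub] z by (simp add: one del: restrict_apply) simp
    next
      case (Suc n)
      then show ?case
        using subgroup.m_closed[OF sub _ g] mult[OF _ g] z gz by (auto simp: compose_eq)
    qed
    have "range (\<lambda>n::nat. g [^]\<^bsub>BijGroup hplane\<^esub> n) \<subseteq> {g \<in> \<Gamma>. hdist z (g z) \<le> 0}"
      using pow by auto
    then have "finite (range (\<lambda>n::nat. g [^]\<^bsub>BijGroup hplane\<^esub> n))"
      using fin[OF z] by (meson finite_subset)
    then have "\<not> inj (\<lambda>n::nat. g [^]\<^bsub>BijGroup hplane\<^esub> n)"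
      using finite_imageD by blast
    then obtain i j :: nat where "i < j" "g [^]\<^bsub>BijGroup hplane\<^esub> j = g [^]\<^bsub>BijGroup hplane\<^esub> i"
      by (metis injI linorder_neqE_nat)
    then have "0 < j - i" "g [^]\<^bsub>BijGroup hplane\<^esub> (j - i) = \<one>\<^bsub>BijGroup hplane\<^esub>"
      using G.pow_eq_div2[OF carr[OF g]] by auto
    then have "g = \<one>\<^bsub>BijGroup hplane\<^esub>" using tf[OF g] by blast
    then show "g = (\<lambda>z\<in>hplane. z)" by (simp add: one)
  next
    fix g assume g: "g \<in> \<Gamma>"
    let ?h = "inv\<^bsub>BijGroup hplane\<^esub> g"
    have h: "?h \<in> \<Gamma>" using sub g by (rule subgroup.m_inv_closed)
    have "compose hplane ?h g = (\<lambda>z\<in>hplane. z)" "compose hplane g ?h = (\<lambda>z\<in>hplane. z)"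
      using carr[OF g] by (simp_all add: mult[symmetric] g h one[symmetric])
    then have "\<forall>z\<in>hplane. ?h (g z) = z \<and> g (?h z) = z"
      by (metis compose_eq restrict_apply')
    with h show "\<exists>h\<in>\<Gamma>. \<forall>z\<in>hplane. h (g z) = z \<and> g (h z) = z" by blast
  next
    fix g assume "g \<in> \<Gamma>"
    then show "g \<in> extensional hplane" using Bij by (auto simp: Bij_def)
  next
    show "(\<lambda>z\<in>hplane. z) \<in> \<Gamma>"
      using sub subgroup.one_closed one by metis
  next
    fix g h assume "g \<in> \<Gamma>" "h \<in> \<Gamma>"
    then show "compose hplane g h \<in> \<Gamma>" using sub mult subgroup.m_closed by metis
  qed (use isos maps fin in \<open>auto simp: hisometries_def\<close>)
qed

context deck_group
begin

lemma comp_ex: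
  assumes "g \<in> \<Gamma>" "h \<in> \<Gamma>"
  obtains k where "k \<in> \<Gamma>" "\<And>z. z \<in> hplane \<Longrightarrow> k z = g (h z)"
  using comp_in[OF assms] by (metis compose_eq)

lemma cases:
  assumes "g \<in> \<Gamma>"
  obtains (mob) A where "det A = 1" "\<And>z. z \<in> hplane \<Longrightarrow> g z = mob A z"
  | (mirror) A where "det A = 1" "\<And>z. z \<in> hplane \<Longrightarrow> g z = mob A (mirror z)"
  using isometry_cases[of g] maps[OF assms] isom[OF assms] by metis

end

text \<open>A change of coordinates on the half-plane, used to make a chosen element a dilation or a
  horizontal translation. It is restricted to \<open>hplane\<close> because deck transformations are
  extensional functions.\<close>

definition conj_by :: "real^2^2 \<Rightarrow> (complex \<Rightarrow> complex) \<Rightarrow> complex \<Rightarrow> complex" where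
  "conj_by A g = (\<lambda>z\<in>hplane. mob A (g (mob (adj2 A) z)))"

lemma deck_group_conj:
  assumes "deck_group \<Gamma>" and A: "det A = 1"
  shows "deck_group (conj_by A ` \<Gamma>)"
proof -
  interpret deck_group \<Gamma> by fact
  note A' = adj2(3)[OF A]
  have adj: "mob (adj2 A) z \<in> hplane" if "z \<in> hplane" for z
    by (rule mob_in_hplane[OF A' that])
  have in_hp: "mob A z \<in> hplane" if "z \<in> hplane" for z
    by (rule mob_in_hplane[OF A that])
  have inj: "conj_by A g z = z \<longleftrightarrow> g (mob (adj2 A) z) = mob (adj2 A) z" if "g \<in> \<Gamma>" "z \<in> hplane" for g z
    using mob_adj2[OF A that(2)] mob_adj2[OF A maps[OF that(1) adj[OF that(2)]]] that
    by (auto simp: conj_by_def)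
  have one: "conj_by A (\<lambda>z\<in>hplane. z) = (\<lambda>z\<in>hplane. z)"
    by (auto simp: conj_by_def adj mob_adj2 A)
  show ?thesis
  proof
    fix g z assume "g \<in> conj_by A ` \<Gamma>" "z \<in> hplane"
    then obtain g' where *: "g = conj_by A g'" "g' \<in> \<Gamma>" "z \<in> hplane" by auto
    then show "g z \<in> hplane" by (simp add: conj_by_def in_hp[OF maps[OF *(2) adj[OF *(3)]]])
  next
    fix g z w assume "g \<in> conj_by A ` \<Gamma>" and z: "z \<in> hplane" and w: "w \<in> hplane"
    then obtain g' where *: "g = conj_by A g'" "g' \<in> \<Gamma>" by auto
    then show "hdist (g z) (g w) = hdist z w"
      using hdist_mob[OF A maps[OF *(2) adj[OF z]] maps[OF *(2) adj[OF w]]] isom[OF *(2) adj[OF z] adj[OF w]]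
        hdist_mob[OF A' z w] z w
      by (simp add: conj_by_def)
  next
    fix g assume "g \<in> conj_by A ` \<Gamma>" then show "g \<in> extensional hplane"
      by (auto simp: conj_by_def)
  next
    show "(\<lambda>z\<in>hplane. z) \<in> conj_by A ` \<Gamma>"
      using id_in one by (metis image_eqI)
  next
    fix g h assume "g \<in> conj_by A ` \<Gamma>" "h \<in> conj_by A ` \<Gamma>"
    then obtain g' h' where *: "g = conj_by A g'" "h = conj_by A h'" "g' \<in> \<Gamma>" "h' \<in> \<Gamma>" by auto
    have "compose hplane g h = conj_by A (compose hplane g' h')"
      using * maps[OF *(4)] in_hp by (auto simp: compose_def conj_by_def fun_eq_iff adj mob_adj2 A)
    then show "compose hplane g h \<in> conj_by A ` \<Gamma>" using * comp_in by blast
  next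
    fix g assume "g \<in> conj_by A ` \<Gamma>"
    then obtain g' where *: "g = conj_by A g'" "g' \<in> \<Gamma>" by auto
    obtain h' where h': "h' \<in> \<Gamma>" "\<forall>z\<in>hplane. h' (g' z) = z \<and> g' (h' z) = z"
      using inv_ex *(2) by blast
    then show "\<exists>h\<in>conj_by A ` \<Gamma>. \<forall>z\<in>hplane. h (g z) = z \<and> g (h z) = z"
      using * maps[OF *(2)] maps[OF h'(1)] by (intro bexI[of _ "conj_by A h'"])
        (auto simp: compose_def conj_by_def in_hp adj mob_adj2 A)
  next
    fix z R assume z: "z \<in> hplane"
    have "{g \<in> conj_by A ` \<Gamma>. hdist z (g z) \<le> R} \<subseteq>
        conj_by A ` {g \<in> \<Gamma>. hdist (mob (adj2 A) z) (g (mob (adj2 A) z)) \<le> R}"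
    proof clarify
      fix g assume g: "g \<in> \<Gamma>" "hdist z (conj_by A g z) \<le> R"
      have "hdist (mob (adj2 A) z) (g (mob (adj2 A) z)) = hdist z (conj_by A g z)"
        using hdist_mob[OF A adj[OF z] maps[OF g(1) adj[OF z]]] z by (simp add: conj_by_def mob_adj2 A)
      with g show "conj_by A g \<in> conj_by A ` {g \<in> \<Gamma>. hdist (mob (adj2 A) z) (g (mob (adj2 A) z)) \<le> R}" by auto
    qed
    then show "finite {g \<in> conj_by A ` \<Gamma>. hdist z (g z) \<le> R}"
      using finite_displacement[OF adj[OF z]] by (meson finite_imageI finite_subset)
  next
    fix g z assume "g \<in> conj_by A ` \<Gamma>" and z: "z \<in> hplane" and gz: "g z = z"
    then obtain g' where *: "g = conj_by A g'" "g' \<in> \<Gamma>" by auto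
    then have "g' = (\<lambda>z\<in>hplane. z)"
      using inj[OF *(2) z] gz free[OF *(2) adj[OF z]] by simp
    then show "g = (\<lambda>z\<in>hplane. z)" using * one by simp
  qed
qed

section \<open>Surfaces dominated by a circle\<close>

context deck_group
begin

lemma covering_proj_eq_iff:
  assumes z: "z \<in> hplane" and w: "w \<in> hplane"
  shows "covering_proj \<Gamma> z = covering_proj \<Gamma> w \<longleftrightarrow> (\<exists>g\<in>\<Gamma>. w = g z)"
proof
  assume "covering_proj \<Gamma> z = covering_proj \<Gamma> w"
  moreover have "w \<in> covering_proj \<Gamma> w"
    unfolding covering_proj_def using id_in w by (intro image_eqI[of _ _ "\<lambda>z\<in>hplane. z"]) auto
  ultimately show "\<exists>g\<in>\<Gamma>. w = g z" by (auto simp: covering_proj_def)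
next
  assume "\<exists>g\<in>\<Gamma>. w = g z"
  then obtain g where g: "g \<in> \<Gamma>" "w = g z" by auto
  obtain h where h: "h \<in> \<Gamma>" "\<forall>z\<in>hplane. h (g z) = z \<and> g (h z) = z" using inv_ex[OF g(1)] by auto
  show "covering_proj \<Gamma> z = covering_proj \<Gamma> w"
  proof (intro equalityI subsetI)
    fix x assume "x \<in> covering_proj \<Gamma> z"
    then obtain k where k: "k \<in> \<Gamma>" "x = k z" by (auto simp: covering_proj_def)
    obtain k' where "k' \<in> \<Gamma>" "\<And>z. z \<in> hplane \<Longrightarrow> k' z = k (h z)"
      using comp_ex[OF k(1) h(1)] by metis
    then show "x \<in> covering_proj \<Gamma> w" using h(2) z w k(2) g(2) unfolding covering_proj_def
      by (intro image_eqI[of _ _ k']) auto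
  next
    fix x assume "x \<in> covering_proj \<Gamma> w"
    then obtain k where k: "k \<in> \<Gamma>" "x = k w" by (auto simp: covering_proj_def)
    obtain k' where "k' \<in> \<Gamma>" "\<And>z. z \<in> hplane \<Longrightarrow> k' z = k (g z)"
      using comp_ex[OF k(1) g(1)] by metis
    then show "x \<in> covering_proj \<Gamma> z" using z k(2) g(2) unfolding covering_proj_def
      by (intro image_eqI[of _ _ k']) auto
  qed
qed

end

text \<open>Data upstairs for a homotopy commutative triangle downstairs: \<open>f\<close> descends
  to a map from the surface to R/Z, \<open>s\<close> to a map back, and \<open>K\<close> to a
  homotopy from their composite to the identity. The integer and the deck transformations may vary
  from point to point, since descending only compares orbits.\<close>

definition circle_dominated :: "(complex \<Rightarrow> complex) set \<Rightarrow> bool" where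
  "circle_dominated \<Gamma> \<longleftrightarrow> (\<exists>(f :: complex \<Rightarrow> real) (s :: real \<Rightarrow> complex) (K :: real \<times> complex \<Rightarrow> complex).
     continuous_on hplane f \<and> continuous_on UNIV s \<and> range s \<subseteq> hplane \<and>
     continuous_on ({0..1} \<times> hplane) K \<and> K ` ({0..1} \<times> hplane) \<subseteq> hplane \<and>
     (\<forall>z\<in>hplane. K (0, z) = s (f z) \<and> K (1, z) = z) \<and>
     (\<forall>g\<in>\<Gamma>. \<forall>z\<in>hplane. \<exists>k::int. f (g z) = f z + of_int k) \<and>
     (\<forall>t. \<exists>g\<in>\<Gamma>. s (t + 1) = g (s t)) \<and>
     (\<forall>g\<in>\<Gamma>. \<forall>z\<in>hplane. \<forall>u\<in>{0..1}. \<exists>h\<in>\<Gamma>. K (u, g z) = h (K (u, z))))"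

lemma cis_2pi_eq_iff: "cis (2 * pi * x) = cis (2 * pi * y) \<longleftrightarrow> (\<exists>n::int. x = y + of_int n)"
proof -
  have "cis (2 * pi * x) = cis (2 * pi * y) \<longleftrightarrow> (\<exists>n::int. 2 * pi * x = 2 * pi * y + 2 * pi * of_int n)"
    using sin_cos_eq_iff[of "2 * pi * x" "2 * pi * y"] by (auto simp: complex_eq_iff)
  also have "\<dots> \<longleftrightarrow> (\<exists>n::int. 2 * pi * x = 2 * pi * (y + of_int n))"
    by (simp add: distrib_left)
  finally show ?thesis by simp
qed

lemma convex_hplane: "convex hplane"
  unfolding hplane_def by (rule convex_halfspace_Im_gt)

text \<open>Each map is constant on the fibres of a quotient map, by the corresponding clause of
  \<open>circle_dominated\<close>, and so descends continuously. The circle is used as the quotient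
  of [0,1], the homotopy lives on [0,1] times the surface.\<close>

lemma (in deck_group) circle_dominated_euler_char:
  assumes "circle_dominated \<Gamma>"
  shows "0 \<le> surface_euler_char (surface_topology \<Gamma>)"
proof -
  obtain f :: "complex \<Rightarrow> real" and s :: "real \<Rightarrow> complex" and K :: "real \<times> complex \<Rightarrow> complex"
    where f: "continuous_on hplane f" and s: "continuous_on UNIV s" "range s \<subseteq> hplane"
      and K: "continuous_on ({0..1} \<times> hplane) K" "K ` ({0..1} \<times> hplane) \<subseteq> hplane"
      and K01: "\<forall>z\<in>hplane. K (0, z) = s (f z) \<and> K (1, z) = z"
      and fg: "\<forall>g\<in>\<Gamma>. \<forall>z\<in>hplane. \<exists>k::int. f (g z) = f z + of_int k"
      and sg: "\<forall>t. \<exists>g\<in>\<Gamma>. s (t + 1) = g (s t)"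
      and Kg: "\<forall>g\<in>\<Gamma>. \<forall>z\<in>hplane. \<forall>u\<in>{0..1}. \<exists>h\<in>\<Gamma>. K (u, g z) = h (K (u, z))"
    using assms unfolding circle_dominated_def by (elim exE conjE)
  let ?H = "top_of_set hplane" and ?X = "surface_topology \<Gamma>" and ?\<pi> = "covering_proj \<Gamma>"
  let ?C = "top_of_set (sphere (0::complex) 1)" and ?I = "top_of_set {0..1::real}"
  have quot: "quotient_map ?H ?X ?\<pi>" by (rule quotient_map_covering_proj)
  have cont\<pi>: "continuous_map ?H ?X ?\<pi>" using quot by (rule quotient_imp_continuous_map)
  have surj: "?\<pi> ` hplane = topspace ?X"
    by (simp add: topspace_surface_topology surface_points_def)
  have sh: "s t \<in> hplane" for t using s(2) by auto
  have Kh: "K (u, z) \<in> hplane" if "u \<in> {0..1}" "z \<in> hplane" for u z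
    using K(2) that by auto
  have "continuous_map ?H ?C (\<lambda>z. cis (2 * pi * f z))"
    using f by (auto intro!: continuous_intros)
  then obtain q where q: "continuous_map ?X ?C q" "\<And>z. z \<in> hplane \<Longrightarrow> q (?\<pi> z) = cis (2 * pi * f z)"
  proof (rule quotient_map_lift_exists[OF quot])
    fix z w assume "z \<in> topspace ?H" "w \<in> topspace ?H" and eq: "?\<pi> z = ?\<pi> w"
    then have zw: "z \<in> hplane" "w \<in> hplane" by auto
    obtain g where "g \<in> \<Gamma>" "w = g z" using covering_proj_eq_iff[OF zw] eq by auto
    then have "\<exists>n::int. f w = f z + of_int n" using fg zw by auto
    then show "cis (2 * pi * f z) = cis (2 * pi * f w)" using cis_2pi_eq_iff by metis
  qed auto
  have step: "?\<pi> (s (t + 1)) = ?\<pi> (s t)" for t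
    using sg[rule_format, of t] covering_proj_eq_iff[OF sh[of t] sh[of "t + 1"]] by auto
  have nat_step: "?\<pi> (s (t + of_nat n)) = ?\<pi> (s t)" for t n
    by (induction n) (use step in \<open>auto simp: add.assoc[symmetric] add.commute[of 1]\<close>)
  have int_step: "?\<pi> (s (t + of_int n)) = ?\<pi> (s t)" for t and n :: int
    using nat_step[of t "nat n"] nat_step[of "t + of_int n" "nat (- n)"] by (cases "n \<ge> 0") auto
  \<comment> \<open>A continuous surjection from a compact space onto a Hausdorff space is a
    quotient map.\<close>
  have exp_quot: "quotient_map ?I ?C (\<lambda>t. cis (2 * pi * t))"
  proof (rule continuous_imp_quotient_map)
    show "continuous_map ?I ?C (\<lambda>t. cis (2 * pi * t))"
      by (auto intro!: continuous_intros)
    show "(\<lambda>t. cis (2 * pi * t)) ` topspace ?I = topspace ?C"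
    proof (intro equalityI subsetI)
      fix z assume "z \<in> topspace ?C"
      then have z: "cmod z = 1" by auto
      then have "cis (Arg z) = z" by (subst cis_Arg) (auto simp: sgn_eq)
      moreover have "cis (2 * pi * frac (Arg z / (2 * pi))) = cis (2 * pi * (Arg z / (2 * pi)))"
        unfolding cis_2pi_eq_iff by (intro exI[of _ "- \<lfloor>Arg z / (2 * pi)\<rfloor>"]) (simp add: frac_def)
      ultimately have "z = cis (2 * pi * frac (Arg z / (2 * pi)))" by simp
      then show "z \<in> (\<lambda>t. cis (2 * pi * t)) ` topspace ?I"
        by (intro image_eqI) (auto simp: frac_lt_1 less_imp_le)
    qed auto
  qed (auto simp: Hausdorff_space_subtopology compact_space_subtopology)
  have conts: "continuous_map ?I ?X (\<lambda>t. ?\<pi> (s t))"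
    by (rule continuous_map_compose[OF _ cont\<pi>, unfolded o_def])
      (use s sh in \<open>auto intro: continuous_on_subset\<close>)
  obtain r where r: "continuous_map ?C ?X r" "\<And>t. t \<in> {0..1} \<Longrightarrow> r (cis (2 * pi * t)) = ?\<pi> (s t)"
  proof (rule quotient_map_lift_exists[OF exp_quot conts])
    fix t u assume "cis (2 * pi * t) = cis (2 * pi * u)"
    then obtain n :: int where "t = u + of_int n" using cis_2pi_eq_iff by auto
    then show "?\<pi> (s t) = ?\<pi> (s u)" using int_step by simp
  qed auto
  have rq: "r (q (?\<pi> z)) = ?\<pi> (s (f z))" if "z \<in> hplane" for z
  proof -
    have "cis (2 * pi * f z) = cis (2 * pi * frac (f z))"
      unfolding cis_2pi_eq_iff by (intro exI[of _ "\<lfloor>f z\<rfloor>"]) (simp add: frac_def)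
    then have "r (q (?\<pi> z)) = ?\<pi> (s (frac (f z)))"
      using r(2)[of "frac (f z)"] q(2)[OF that] by (simp add: frac_lt_1 less_imp_le)
    also have "\<dots> = ?\<pi> (s (f z))"
      using int_step[of "frac (f z)" "\<lfloor>f z\<rfloor>"] by (simp add: frac_def)
    finally show ?thesis .
  qed
  \<comment> \<open>The product of a quotient map with the identity of a locally compact Hausdorff
    space, here [0,1], is again a quotient map.\<close>
  have quotI: "quotient_map (prod_topology ?I ?H) (prod_topology ?I ?X) (\<lambda>(u, z). (u, ?\<pi> z))"
    by (intro quotient_map_prod_right quot compact_imp_locally_compact_space)
      (auto simp: Hausdorff_space_subtopology compact_space_subtopology)
  have contK: "continuous_map (prod_topology ?I ?H) ?X (\<lambda>p. ?\<pi> (K p))"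
  proof (rule continuous_map_compose[OF _ cont\<pi>, unfolded o_def])
    have "prod_topology ?I ?H = top_of_set ({0..1} \<times> hplane)"
      by (simp add: subtopology_Times[symmetric] euclidean_product_topology)
    then show "continuous_map (prod_topology ?I ?H) ?H K"
      using K by (simp add: image_subset_iff_funcset)
  qed
  obtain h where h: "continuous_map (prod_topology ?I ?X) ?X h"
    "\<And>u z. u \<in> {0..1} \<Longrightarrow> z \<in> hplane \<Longrightarrow> h (u, ?\<pi> z) = ?\<pi> (K (u, z))"
  proof (rule quotient_map_lift_exists[OF quotI contK])
    fix p p' assume p: "p \<in> topspace (prod_topology ?I ?H)" "p' \<in> topspace (prod_topology ?I ?H)"
      and eq: "(case p of (u, z) \<Rightarrow> (u, ?\<pi> z)) = (case p' of (u, z) \<Rightarrow> (u, ?\<pi> z))"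
    obtain u z w where [simp]: "p = (u, z)" "p' = (u, w)" and e: "?\<pi> z = ?\<pi> w"
      using eq by (cases p; cases p') auto
    have uzw: "u \<in> {0..1}" "z \<in> hplane" "w \<in> hplane" using p by auto
    then obtain g where "g \<in> \<Gamma>" "w = g z" using covering_proj_eq_iff e by auto
    then obtain k where "k \<in> \<Gamma>" "K (u, w) = k (K (u, z))" using Kg uzw by blast
    then have "?\<pi> (K (u, z)) = ?\<pi> (K (u, w))"
      using covering_proj_eq_iff[OF Kh[OF uzw(1,2)] Kh[OF uzw(1,3)]] by auto
    then show "?\<pi> (K p) = ?\<pi> (K p')" by simp
  next
    fix h assume "continuous_map (prod_topology ?I ?X) ?X h"
      and *: "\<And>x. x \<in> topspace (prod_topology ?I ?H) \<Longrightarrow> h (case x of (u, z) \<Rightarrow> (u, ?\<pi> z)) = ?\<pi> (K x)"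
    moreover have "h (u, ?\<pi> z) = ?\<pi> (K (u, z))" if "u \<in> {0..1}" "z \<in> hplane" for u z
      using *[of "(u, z)"] that by simp
    ultimately show thesis using that by blast
  qed
  have X: "x \<in> topspace ?X \<Longrightarrow> \<exists>z\<in>hplane. x = ?\<pi> z" for x
    using surj by auto
  have "homotopic_with (\<lambda>_. True) ?X ?X (r \<circ> q) id"
    unfolding homotopic_with[of ?X "\<lambda>_. True", simplified]
  proof (intro exI conjI ballI)
    show "continuous_map (prod_topology ?I ?X) ?X h" by fact
    fix x assume "x \<in> topspace ?X"
    then obtain z where z: "z \<in> hplane" "x = ?\<pi> z" using X by blast
    show "h (0, x) = (r \<circ> q) x" "h (1, x) = id x"
      using z h(2)[of 0 z] h(2)[of 1 z] K01 rq by auto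
  qed
  moreover have "path_connected_space ?X"
  proof -
    have "path_connectedin ?H hplane"
      using convex_imp_path_connected[OF convex_hplane]
      by (simp add: path_connectedin_subtopology path_connectedin_euclidean)
    then have "path_connectedin ?X (?\<pi> ` hplane)"
      using cont\<pi> by (rule path_connectedin_continuous_map_image[rotated])
    then show ?thesis by (simp add: surj path_connectedin_topspace)
  qed
  moreover have "topspace ?X \<noteq> {}"
    using surj i_in_hplane by blast
  ultimately show ?thesis
    using q(1) r(1) by (intro surface_euler_char_nonneg_if_dominated_by_circle)
qed

section \<open>Axes, nearest points and closed geodesics\<close>

definition haxis :: "real^2^2 \<Rightarrow> real \<Rightarrow> complex" where
  "haxis T t = mob T (\<i> * of_real (exp t))"

text \<open>The arc-length parameter of the foot of the perpendicular: semicircles about 0 meet the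
  imaginary axis orthogonally, so a point w has foot i |w|.\<close>

definition haxis_proj :: "real^2^2 \<Rightarrow> complex \<Rightarrow> real" where
  "haxis_proj T z = ln (cmod (mob (adj2 T) z))"

lemma i_exp_in_hplane [simp]: "\<i> * of_real (exp t) \<in> hplane"
  by (simp add: hplane_iff)

lemma haxis_in_hplane: "det T = 1 \<Longrightarrow> haxis T t \<in> hplane"
  unfolding haxis_def by (intro mob_in_hplane) auto

text \<open>The first factor does not depend on t, so the unique minimum is at t = ln |z|. For z on
  the axis that factor is 1, and the formula says that t is arc length.\<close>

lemma cosh_hdist_imaginary:
  assumes "z \<in> hplane"
  shows "cosh (hdist z (\<i> * of_real (exp t))) = cmod z / Im z * cosh (t - ln (cmod z))"
proof -
  have y: "0 < Im z" using assms by (simp add: hplane_iff)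
  then have z: "0 < cmod z" by auto
  have "cosh (hdist z (\<i> * of_real (exp t))) = 1 + (cmod (z - \<i> * of_real (exp t)))\<^sup>2 / (2 * Im z * exp t)"
    using assms by (simp add: cosh_hdist)
  also have "(cmod (z - \<i> * of_real (exp t)))\<^sup>2 = (cmod z)\<^sup>2 + (exp t)\<^sup>2 - 2 * Im z * exp t"
    unfolding cmod_power2 by (simp add: power2_eq_square algebra_simps)
  also have "1 + \<dots> / (2 * Im z * exp t) = ((cmod z)\<^sup>2 + (exp t)\<^sup>2) / (2 * Im z * exp t)"
    using y by (simp add: field_simps)
  also have "\<dots> = cmod z / Im z * ((exp t / cmod z + cmod z / exp t) / 2)"
    using y z by (simp add: field_simps power2_eq_square)
  also have "(exp t / cmod z + cmod z / exp t) / 2 = cosh (t - ln (cmod z))"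
    using z by (simp add: cosh_field_def exp_diff)
  finally show ?thesis .
qed

lemma hgeodesic_haxis:
  assumes "det T = 1"
  shows "hgeodesic (haxis T)"
  unfolding hgeodesic_def
proof (intro conjI allI)
  show "range (haxis T) \<subseteq> hplane" using haxis_in_hplane[OF assms] by auto
  fix s t
  have "cosh (hdist (\<i> * of_real (exp s)) (\<i> * of_real (exp t))) = cosh (t - s)"
    by (subst cosh_hdist_imaginary) (auto simp: norm_mult)
  then have "hdist (\<i> * of_real (exp s)) (\<i> * of_real (exp t)) = arcosh (cosh \<bar>s - t\<bar>)"
    by (metis abs_minus_commute arcosh_cosh_real cosh_real_abs hdist_nonneg i_exp_in_hplane)
  then show "hdist (haxis T s) (haxis T t) = \<bar>s - t\<bar>"
    unfolding haxis_def by (simp add: hdist_mob assms arcosh_cosh_real del: cosh_real_abs)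
qed

lemma haxis_proj_nearest:
  assumes T: "det T = 1" and z: "z \<in> hplane" and t: "t \<noteq> haxis_proj T z"
  shows "hdist z (haxis T (haxis_proj T z)) < hdist z (haxis T t)"
proof -
  define w where "w = mob (adj2 T) z"
  have w: "w \<in> hplane" unfolding w_def by (intro mob_in_hplane adj2 T z)
  have zw: "z = mob T w" by (simp add: w_def mob_adj2 T z)
  have y: "0 < cmod w / Im w" using w by (intro divide_pos_pos) (auto simp: hplane_iff)
  have p: "haxis_proj T z = ln (cmod w)" by (simp add: haxis_proj_def w_def)
  have dist: "hdist z (haxis T u) = hdist w (\<i> * of_real (exp u))" for u
    unfolding zw haxis_def by (intro hdist_mob T w) auto
  have "cosh 0 < cosh \<bar>t - ln (cmod w)\<bar>"
    using t p by (intro cosh_real_strict_mono) auto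
  then have "cosh (hdist w (\<i> * of_real (exp (ln (cmod w))))) < cosh (hdist w (\<i> * of_real (exp t)))"
    unfolding cosh_hdist_imaginary[OF w] using y by (intro mult_strict_left_mono) auto
  then show ?thesis
    unfolding dist p using cosh_real_nonneg_less_iff hdist_nonneg[OF w] by (metis i_exp_in_hplane)
qed

text \<open>The projection is defined by choosing a minimizer; strictness of the minimum leaves only
  one.\<close>

lemma orth_proj_haxis:
  assumes T: "det T = 1" and z: "z \<in> hplane"
  shows "orth_proj (range (haxis T)) z = haxis T (haxis_proj T z)"
  unfolding orth_proj_def arg_min_on_def arg_min_def
proof (rule some_equality)
  have *: "hdist z (haxis T (haxis_proj T z)) \<le> hdist z (haxis T t)" for t
    using haxis_proj_nearest[OF T z, of t] by (cases "t = haxis_proj T z") auto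
  then show "is_arg_min (hdist z) (\<lambda>x. x \<in> range (haxis T)) (haxis T (haxis_proj T z))"
    by (auto simp: is_arg_min_linorder)
  fix x assume "is_arg_min (hdist z) (\<lambda>x. x \<in> range (haxis T)) x"
  then obtain t where t: "x = haxis T t" "hdist z (haxis T t) \<le> hdist z (haxis T (haxis_proj T z))"
    by (auto simp: is_arg_min_linorder)
  then show "x = haxis T (haxis_proj T z)"
    using haxis_proj_nearest[OF T z, of t] by (cases "t = haxis_proj T z") auto
qed

lemma hgeodesic_inj: "hgeodesic c \<Longrightarrow> c s = c t \<longleftrightarrow> s = t"
  unfolding hgeodesic_def by (metis abs_eq_0 eq_iff_diff_eq_0 hdist_refl)

text \<open>The parametrization that \<open>SOME\<close> selects in \<open>length_on_line\<close>
  differs from c by an isometry t -> b + e t of the reals with e = 1 or e = -1, and Lebesgue measure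
  is invariant under it.\<close>

lemma length_on_line_range:
  assumes c: "hgeodesic c" and E: "E \<in> sets borel"
  shows "length_on_line (range c) (c ` E) = emeasure lborel E"
proof -
  define c' where "c' = (SOME c'. hgeodesic c' \<and> range c' = range c)"
  have c': "hgeodesic c'" "range c' = range c"
    using someI_ex[of "\<lambda>c'. hgeodesic c' \<and> range c' = range c"] c unfolding c'_def by auto
  have "\<forall>t. \<exists>u. c' t = c u" using c'(2) by (metis UNIV_I image_iff rangeI)
  then obtain \<sigma> where \<sigma>: "\<And>t. c' t = c (\<sigma> t)" by metis
  have iso: "\<bar>\<sigma> s - \<sigma> t\<bar> = \<bar>s - t\<bar>" for s t
    using c c'(1) unfolding hgeodesic_def \<sigma> by metis
  \<comment> \<open>A real number is determined by its distances to two different points, here the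
    images of 0 and 1 under \<sigma>; \<open>minus\<close> is the orientation-reversing
    case.\<close>
  have plus: "a = p + t" if "\<bar>a - p\<bar> = \<bar>t\<bar>" "\<bar>a - (p + 1)\<bar> = \<bar>t - 1\<bar>" for a p t :: real
    using that by linarith
  have minus: "a = p - t" if "\<bar>a - p\<bar> = \<bar>t\<bar>" "\<bar>a - (p - 1)\<bar> = \<bar>t - 1\<bar>" for a p t :: real
    using that by linarith
  obtain b e where be: "e \<noteq> 0" "\<bar>e\<bar> = 1" "\<And>t. \<sigma> t = b + e * t"
  proof (cases "\<sigma> 1 = \<sigma> 0 + 1")
    case True
    have eq: "\<sigma> t = \<sigma> 0 + 1 * t" for t
      using plus[of "\<sigma> t" "\<sigma> 0" t] iso[of t 0] iso[of t 1] True by simp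
    show thesis by (rule that[OF _ _ eq]) simp_all
  next
    case False
    have "\<sigma> 1 = \<sigma> 0 - 1" using iso[of 1 0] False by linarith
    then have eq: "\<sigma> t = \<sigma> 0 + (-1) * t" for t
      using minus[of "\<sigma> t" "\<sigma> 0" t] iso[of t 0] iso[of t 1] by simp
    show thesis by (rule that[OF _ _ eq]) simp_all
  qed
  have "c' -` (c ` E) = (\<lambda>t. b + e * t) -` E"
    using hgeodesic_inj[OF c] by (auto simp: \<sigma> be(3))
  then have "length_on_line (range c) (c ` E) = emeasure lborel ((\<lambda>t. b + e * t) -` E)"
    by (simp add: length_on_line_def c'_def)
  also have "\<dots> = emeasure (distr lborel borel (\<lambda>t. b + e * t)) E"
    using E by (simp add: emeasure_distr)
  also have "distr lborel borel (\<lambda>t. b + e * t) = lborel"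
    using lborel_real_affine[OF be(1), of b] be(2) by (simp add: density_1)
  finally show ?thesis .
qed

section \<open>Axes of deck transformations and closed geodesics on the surface\<close>

context deck_group
begin

text \<open>Only finitely many elements move z by at most 1, and each nontrivial one moves it by a
  positive amount. The value 1 in the minimum accounts for all the others.\<close>

lemma injectivity_radius:
  assumes z: "z \<in> hplane"
  obtains \<delta> where "0 < \<delta>" "\<And>g. g \<in> \<Gamma> \<Longrightarrow> g \<noteq> (\<lambda>z\<in>hplane. z) \<Longrightarrow> \<delta> \<le> hdist z (g z)"
proof -
  let ?S = "{g \<in> \<Gamma>. hdist z (g z) \<le> 1} - {\<lambda>z\<in>hplane. z}"
  let ?D = "insert 1 ((\<lambda>g. hdist z (g z)) ` ?S)"
  have fin: "finite ?D" using finite_displacement[OF z, of 1] by auto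
  have "0 < hdist z (g z)" if g: "g \<in> ?S" for g
  proof -
    have "g \<in> \<Gamma>" using g by auto
    have "g z \<noteq> z" using free[OF \<open>g \<in> \<Gamma>\<close> z] g by auto
    then show ?thesis
      using hdist_nonneg[OF z maps[OF \<open>g \<in> \<Gamma>\<close> z]] hdist_eq_0_iff[OF z maps[OF \<open>g \<in> \<Gamma>\<close> z]] by auto
  qed
  then have "0 < Min ?D" using fin by (subst Min_gr_iff) auto
  moreover have "Min ?D \<le> hdist z (g z)" if "g \<in> \<Gamma>" "g \<noteq> (\<lambda>z\<in>hplane. z)" for g
  proof (cases "hdist z (g z) \<le> 1")
    case True
    then show ?thesis using fin that by (intro Min_le) auto
  next
    case False
    have "Min ?D \<le> 1" using fin by (intro Min_le) auto
    with False show ?thesis by linarith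
  qed
  ultimately show thesis using that by blast
qed

lemma surface_dist_eq:
  assumes z: "z \<in> hplane" and w: "w \<in> hplane" and "\<And>g. g \<in> \<Gamma> \<Longrightarrow> hdist z w \<le> hdist z (g w)"
  shows "surface_dist \<Gamma> (covering_proj \<Gamma> z) (covering_proj \<Gamma> w) = hdist z w"
  unfolding surface_dist_def
proof (rule cInf_eq_minimum)
  have "z \<in> covering_proj \<Gamma> z" "w \<in> covering_proj \<Gamma> w"
    using id_in z w by (auto simp: covering_proj_def intro: image_eqI[of _ _ "\<lambda>z\<in>hplane. z"])
  then show "hdist z w \<in> {hdist z' w' |z' w'. z' \<in> covering_proj \<Gamma> z \<and> w' \<in> covering_proj \<Gamma> w}" by blast
  fix d assume "d \<in> {hdist z' w' |z' w'. z' \<in> covering_proj \<Gamma> z \<and> w' \<in> covering_proj \<Gamma> w}"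
  then obtain g h where gh: "g \<in> \<Gamma>" "h \<in> \<Gamma>" "d = hdist (g z) (h w)"
    by (auto simp: covering_proj_def)
  obtain g' where g': "g' \<in> \<Gamma>" "\<forall>z\<in>hplane. g' (g z) = z \<and> g (g' z) = z" using inv_ex[OF gh(1)] by auto
  obtain k where k: "k \<in> \<Gamma>" "\<And>z. z \<in> hplane \<Longrightarrow> k z = g' (h z)" using comp_ex[OF g'(1) gh(2)] by metis
  have "d = hdist (g' (g z)) (g' (h w))"
    using isom[OF g'(1) maps[OF gh(1) z] maps[OF gh(2) w]] gh(3) by simp
  also have "\<dots> = hdist z (k w)" using g'(2) z w k(2) by simp
  finally show "hdist z w \<le> d" using assms(3)[OF k(1)] by simp
qed

lemma closed_geodesic_covering_proj:
  assumes c: "hgeodesic c" and L: "0 < L" and g: "g \<in> \<Gamma>" and per: "\<And>t. g (c t) = c (t + L)"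
  shows "closed_geodesic \<Gamma> (\<lambda>t. covering_proj \<Gamma> (c t)) L"
  unfolding closed_geodesic_def
proof (intro conjI allI L)
  have ch: "c t \<in> hplane" for t using c by (auto simp: hgeodesic_def)
  have dist: "hdist (c s) (c t) = \<bar>s - t\<bar>" for s t using c by (simp add: hgeodesic_def)
  show "range (\<lambda>t. covering_proj \<Gamma> (c t)) \<subseteq> surface_points \<Gamma>"
    using ch by (auto simp: surface_points_def)
  show "covering_proj \<Gamma> (c (t + L)) = covering_proj \<Gamma> (c t)" for t
    using covering_proj_eq_iff[OF ch[of t] ch[of "t + L"]] g per by metis
  fix t
  obtain \<delta> where \<delta>: "0 < \<delta>" "\<And>g. g \<in> \<Gamma> \<Longrightarrow> g \<noteq> (\<lambda>z\<in>hplane. z) \<Longrightarrow> \<delta> \<le> hdist (c t) (g (c t))"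
    using injectivity_radius[OF ch[of t]] by metis
  show "\<exists>e>0. \<forall>s\<in>{t - e<..<t + e}. \<forall>s'\<in>{t - e<..<t + e}.
      surface_dist \<Gamma> (covering_proj \<Gamma> (c s)) (covering_proj \<Gamma> (c s')) = \<bar>s - s'\<bar>"
  \<comment> \<open>For s, s' within \<delta>/4 of t, a nontrivial k gives hdist (c s) (k (c s'))
    \<ge> \<delta> - |s - t| - |s' - t| > \<delta>/2 > |s - s'|, so the distance between the orbits
    is realised along c.\<close>
  proof (intro exI[of _ "\<delta> / 4"] conjI ballI)
    fix s s' assume s: "s \<in> {t - \<delta> / 4<..<t + \<delta> / 4}" "s' \<in> {t - \<delta> / 4<..<t + \<delta> / 4}"
    have "hdist (c s) (c s') \<le> hdist (c s) (k (c s'))" if k: "k \<in> \<Gamma>" for k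
    proof (cases "k = (\<lambda>z\<in>hplane. z)")
      case False
      have kh: "k (c u) \<in> hplane" for u using maps[OF k ch] .
      have "\<delta> \<le> hdist (c t) (k (c t))" using \<delta>(2)[OF k False] .
      also have "\<dots> \<le> hdist (c t) (c s) + hdist (c s) (k (c t))" using ch kh by (intro hdist_triangle)
      also have "hdist (c s) (k (c t)) \<le> hdist (c s) (k (c s')) + hdist (k (c s')) (k (c t))"
        using ch kh by (intro hdist_triangle)
      also have "hdist (k (c s')) (k (c t)) = \<bar>s' - t\<bar>" using isom[OF k ch ch] dist by simp
      finally show ?thesis using s dist by (auto simp: abs_if split: if_splits)
    qed (simp add: ch)
    then show "surface_dist \<Gamma> (covering_proj \<Gamma> (c s)) (covering_proj \<Gamma> (c s')) = \<bar>s - s'\<bar>"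
      using surface_dist_eq[OF ch ch] dist by simp
  qed (use \<delta> in simp)
qed

end

text \<open>The conclusion in coordinates: \<open>T n\<close> carries the imaginary axis to l_n, the
  element g translates l_n by \<open>L n\<close>, and m_n is the image of l_n under h. The set E
  consists of the arc-length parameters on l_n of the projection of m_n, so \<open>P n\<close> is
  the projection length.\<close>

definition full_projections :: "(complex \<Rightarrow> complex) set \<Rightarrow> bool" where
  "full_projections \<Gamma> \<longleftrightarrow> (\<exists>(T :: nat \<Rightarrow> real^2^2) (L :: nat \<Rightarrow> real) (P :: nat \<Rightarrow> real).
     (\<lambda>n. P n / L n) \<longlonglongrightarrow> 1 \<and>
     (\<forall>n. det (T n) = 1 \<and> 0 < L n \<and> 0 \<le> P n \<and>
       (\<exists>g\<in>\<Gamma>. \<forall>t. g (haxis (T n) t) = haxis (T n) (t + L n)) \<and>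
       (\<exists>h\<in>\<Gamma>. \<exists>E\<in>sets borel. emeasure lborel E = ennreal (P n) \<and>
          E = range (\<lambda>t. haxis_proj (T n) (h (haxis (T n) t))))))"

lemma (in deck_group) full_projections_imp:
  assumes "full_projections \<Gamma>"
  shows "\<exists>(\<gamma> :: nat \<Rightarrow> real \<Rightarrow> complex set) (L :: nat \<Rightarrow> real)
            (l :: nat \<Rightarrow> complex set) (m :: nat \<Rightarrow> complex set).
           (\<forall>n. closed_geodesic \<Gamma> (\<gamma> n) (L n) \<and>
                line_above \<Gamma> (\<gamma> n) (l n) \<and> line_above \<Gamma> (\<gamma> n) (m n)) \<and>
           (\<lambda>n. length_on_line (l n) (orth_proj (l n) ` m n) / ennreal (L n))
             \<longlonglongrightarrow> 1"
proof -
  obtain T :: "nat \<Rightarrow> real^2^2" and L P :: "nat \<Rightarrow> real" where lim: "(\<lambda>n. P n / L n) \<longlonglongrightarrow> 1"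
    and *: "\<forall>n. det (T n) = 1 \<and> 0 < L n \<and> 0 \<le> P n \<and>
       (\<exists>g\<in>\<Gamma>. \<forall>t. g (haxis (T n) t) = haxis (T n) (t + L n)) \<and>
       (\<exists>h\<in>\<Gamma>. \<exists>E\<in>sets borel. emeasure lborel E = ennreal (P n) \<and>
          E = range (\<lambda>t. haxis_proj (T n) (h (haxis (T n) t))))"
    using assms unfolding full_projections_def by blast
  from * have T: "\<And>n. det (T n) = 1" and L: "\<And>n. 0 < L n" and P: "\<And>n. 0 \<le> P n" by auto
  from * obtain g where g: "\<And>n. g n \<in> \<Gamma>" "\<And>n t. g n (haxis (T n) t) = haxis (T n) (t + L n)"
    by metis
  have "\<forall>n. \<exists>h\<in>\<Gamma>. range (\<lambda>t. haxis_proj (T n) (h (haxis (T n) t))) \<in> sets borel \<and>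
      emeasure lborel (range (\<lambda>t. haxis_proj (T n) (h (haxis (T n) t)))) = ennreal (P n)"
    using * by metis
  then obtain h where h: "\<And>n. h n \<in> \<Gamma>"
      and E: "\<And>n. range (\<lambda>t. haxis_proj (T n) (h n (haxis (T n) t))) \<in> sets borel"
      "\<And>n. emeasure lborel (range (\<lambda>t. haxis_proj (T n) (h n (haxis (T n) t)))) = ennreal (P n)"
    by metis
  let ?\<gamma> = "\<lambda>n t. covering_proj \<Gamma> (haxis (T n) t)"
  let ?l = "\<lambda>n. range (haxis (T n))" and ?m = "\<lambda>n. range (\<lambda>t. h n (haxis (T n) t))"
  have haxis: "haxis (T n) t \<in> hplane" for n t using haxis_in_hplane T by blast
  have lifted_axis: "h n (haxis (T n) t) \<in> hplane" for n t using maps[OF h haxis] .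
  have geo: "hgeodesic (haxis (T n))" for n using hgeodesic_haxis T by blast
  have geo': "hgeodesic (\<lambda>t. h n (haxis (T n) t))" for n
    using geo[of n] lifted_axis isom[OF h haxis haxis] by (auto simp: hgeodesic_def)
  have "closed_geodesic \<Gamma> (?\<gamma> n) (L n)" for n
    using closed_geodesic_covering_proj[OF geo L g(1) g(2)] .
  moreover have "line_above \<Gamma> (?\<gamma> n) (?l n)" for n
    using geo haxis by (auto simp: line_above_def hline_def)
  moreover have "line_above \<Gamma> (?\<gamma> n) (?m n)" for n
  proof -
    have "covering_proj \<Gamma> (h n (haxis (T n) t)) = covering_proj \<Gamma> (haxis (T n) t)" for t
      using covering_proj_eq_iff[OF haxis lifted_axis] h by metis
    then show ?thesis using geo' lifted_axis by (auto simp: line_above_def hline_def)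
  qed
  moreover have "(\<lambda>n. length_on_line (?l n) (orth_proj (?l n) ` ?m n) / ennreal (L n)) \<longlonglongrightarrow> 1"
  proof -
    have "length_on_line (?l n) (orth_proj (?l n) ` ?m n) / ennreal (L n) = ennreal (P n / L n)" for n
    proof -
      have "orth_proj (?l n) ` ?m n = haxis (T n) ` range (\<lambda>t. haxis_proj (T n) (h n (haxis (T n) t)))"
        by (auto simp: image_image orth_proj_haxis[OF T lifted_axis])
      then have "length_on_line (?l n) (orth_proj (?l n) ` ?m n) = ennreal (P n)"
        using length_on_line_range[OF geo E(1)] E(2) by simp
      then show ?thesis using divide_ennreal[OF P L] by simp
    qed
    then show ?thesis using tendsto_ennrealI[OF lim] by simp
  qed
  ultimately show ?thesis
    by (intro exI[of _ ?\<gamma>] exI[of _ L] exI[of _ ?l] exI[of _ ?m]) auto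
qed

section \<open>Conjugation\<close>

lemma adj2_adj2 [simp]: "adj2 (adj2 A) = A"
  by (simp add: adj2_def mat2_eq_iff)

lemma adj2_mult: "adj2 (A ** B) = adj2 B ** adj2 A"
  by (simp add: adj2_def mat2_eq_iff mat2_mult_nth)

lemma mat2_mult [simp]:
  "mat2 a b c d ** mat2 a' b' c' d' = mat2 (a * a' + b * c') (a * b' + b * d') (c * a' + d * c') (c * b' + d * d')"
  by (simp add: mat2_eq_iff mat2_mult_nth)

lemma mob_mat2: "mob (mat2 a b c d) z = (of_real a * z + of_real b) / (of_real c * z + of_real d)"
  by (simp add: mob_def)

lemma full_projections_conj:
  assumes "deck_group \<Gamma>" and A: "det A = 1" and full: "full_projections (conj_by A ` \<Gamma>)"
  shows "full_projections \<Gamma>"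
proof -
  interpret deck_group \<Gamma> by fact
  note A' = adj2(3)[OF A]
  obtain T :: "nat \<Rightarrow> real^2^2" and L P :: "nat \<Rightarrow> real" where lim: "(\<lambda>n. P n / L n) \<longlonglongrightarrow> 1"
    and *: "\<forall>n. det (T n) = 1 \<and> 0 < L n \<and> 0 \<le> P n \<and>
       (\<exists>g\<in>conj_by A ` \<Gamma>. \<forall>t. g (haxis (T n) t) = haxis (T n) (t + L n)) \<and>
       (\<exists>h\<in>conj_by A ` \<Gamma>. \<exists>E\<in>sets borel. emeasure lborel E = ennreal (P n) \<and>
          E = range (\<lambda>t. haxis_proj (T n) (h (haxis (T n) t))))"
    using full unfolding full_projections_def by blast
  from * have T: "\<And>n. det (T n) = 1" by auto
  \<comment> \<open>Pulling the axes back by the inverse isometry changes neither arc length nor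
    projection parameters, so \<open>L\<close> and \<open>P\<close> stay the same.\<close>
  let ?T = "\<lambda>n. adj2 A ** T n"
  have haxis: "haxis (?T n) t = mob (adj2 A) (haxis (T n) t)" for n t
    unfolding haxis_def by (intro mob_mult A' T) auto
  have conj: "conj_by A g (haxis (T n) t) = mob A (g (haxis (?T n) t))" for n g t
    using haxis_in_hplane[OF T] by (simp add: conj_by_def haxis)
  have haxis_mem: "haxis (?T n) t \<in> hplane" for n t
    by (rule haxis_in_hplane) (simp add: det_mul A' T)
  have proj: "haxis_proj (?T n) z = haxis_proj (T n) (mob A z)" if "z \<in> hplane" for n z
    unfolding haxis_proj_def adj2_mult adj2_adj2 using that by (simp add: mob_mult adj2 T A)
  show ?thesis
    unfolding full_projections_def
  proof (rule exI[of _ ?T], rule exI[of _ L], rule exI[of _ P], intro conjI allI)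
    fix n
    show "det (?T n) = 1" by (simp add: det_mul A' T)
    show "0 < L n" "0 \<le> P n" using * by auto
    from * obtain g where g: "g \<in> \<Gamma>" "\<And>t. conj_by A g (haxis (T n) t) = haxis (T n) (t + L n)" by blast
    have "g (haxis (?T n) t) = haxis (?T n) (t + L n)" for t
    proof -
      have "mob (adj2 A) (mob A (g (haxis (?T n) t))) = mob (adj2 A) (haxis (T n) (t + L n))"
        using g(2) conj by metis
      then show ?thesis unfolding mob_adj2(2)[OF A maps[OF g(1) haxis_mem]] by (simp add: haxis)
    qed
    then show "\<exists>g\<in>\<Gamma>. \<forall>t. g (haxis (?T n) t) = haxis (?T n) (t + L n)" using g(1) by blast
    from * obtain h where h: "h \<in> \<Gamma>" "\<exists>E\<in>sets borel. emeasure lborel E = ennreal (P n) \<and>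
          E = range (\<lambda>t. haxis_proj (T n) (conj_by A h (haxis (T n) t)))" by blast
    have "haxis_proj (T n) (conj_by A h (haxis (T n) t)) = haxis_proj (?T n) (h (haxis (?T n) t))" for t
      unfolding conj proj[OF maps[OF h(1) haxis_mem]] ..
    then show "\<exists>h\<in>\<Gamma>. \<exists>E\<in>sets borel. emeasure lborel E = ennreal (P n) \<and>
          E = range (\<lambda>t. haxis_proj (?T n) (h (haxis (?T n) t)))"
      using h by auto
  qed (rule lim)
qed

lemma circle_dominated_conj:
  assumes "deck_group \<Gamma>" and A: "det A = 1" and dom: "circle_dominated (conj_by A ` \<Gamma>)"
  shows "circle_dominated \<Gamma>"
proof -
  interpret deck_group \<Gamma> by fact
  note A' = adj2(3)[OF A]
  obtain f :: "complex \<Rightarrow> real" and s :: "real \<Rightarrow> complex" and K :: "real \<times> complex \<Rightarrow> complex"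
    where f: "continuous_on hplane f" and s: "continuous_on UNIV s" "range s \<subseteq> hplane"
      and K: "continuous_on ({0..1} \<times> hplane) K" "K ` ({0..1} \<times> hplane) \<subseteq> hplane"
      and K01: "\<forall>z\<in>hplane. K (0, z) = s (f z) \<and> K (1, z) = z"
      and fg: "\<forall>g\<in>conj_by A ` \<Gamma>. \<forall>z\<in>hplane. \<exists>k::int. f (g z) = f z + of_int k"
      and sg: "\<forall>t. \<exists>g\<in>conj_by A ` \<Gamma>. s (t + 1) = g (s t)"
      and Kg: "\<forall>g\<in>conj_by A ` \<Gamma>. \<forall>z\<in>hplane. \<forall>u\<in>{0..1}. \<exists>h\<in>conj_by A ` \<Gamma>. K (u, g z) = h (K (u, z))"
    using dom unfolding circle_dominated_def by (elim exE conjE)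
  have Ah: "mob A z \<in> hplane" if "z \<in> hplane" for z using mob_in_hplane[OF A that] .
  have A'h: "mob (adj2 A) z \<in> hplane" if "z \<in> hplane" for z using mob_in_hplane[OF A' that] .
  have sh: "s t \<in> hplane" for t using s by auto
  have Kh: "K (u, z) \<in> hplane" if "u \<in> {0..1}" "z \<in> hplane" for u z using K(2) that by auto
  have conj: "conj_by A g (mob A z) = mob A (g z)" if "z \<in> hplane" for g z
    using that by (simp add: conj_by_def Ah mob_adj2 A)
  have conj': "mob (adj2 A) (conj_by A g z) = g (mob (adj2 A) z)" if "g \<in> \<Gamma>" "z \<in> hplane" for g z
    using that by (simp add: conj_by_def mob_adj2(2)[OF A maps[OF that(1) A'h[OF that(2)]]])
  show ?thesis
    unfolding circle_dominated_def
  proof (rule exI[of _ "\<lambda>z. f (mob A z)"], rule exI[of _ "\<lambda>t. mob (adj2 A) (s t)"],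
      rule exI[of _ "\<lambda>(u, z). mob (adj2 A) (K (u, mob A z))"], intro conjI)
    show "continuous_on hplane (\<lambda>z. f (mob A z))"
      by (rule continuous_on_compose2[OF f continuous_on_mob[OF A]]) (use Ah in auto)
    show "continuous_on UNIV (\<lambda>t. mob (adj2 A) (s t))"
      by (rule continuous_on_compose2[OF continuous_on_mob[OF A'] s(1)]) (use sh in auto)
    show "range (\<lambda>t. mob (adj2 A) (s t)) \<subseteq> hplane" using sh A'h by auto
    have "continuous_on ({0..1} \<times> hplane) (\<lambda>p. (fst p, mob A (snd p)))"
      by (intro continuous_intros continuous_on_compose2[OF continuous_on_mob[OF A] continuous_on_snd]) auto
    then have "continuous_on ({0..1::real} \<times> hplane) (\<lambda>p. K (fst p, mob A (snd p)))"
      by (rule continuous_on_compose2[OF K(1)]) (use Ah in auto)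
    then have "continuous_on ({0..1::real} \<times> hplane) (\<lambda>p. mob (adj2 A) (K (fst p, mob A (snd p))))"
      by (rule continuous_on_compose2[OF continuous_on_mob[OF A']]) (use Ah Kh in auto)
    then show "continuous_on ({0..1} \<times> hplane) (\<lambda>(u, z). mob (adj2 A) (K (u, mob A z)))"
      by (simp add: case_prod_unfold)
    show "(\<lambda>(u, z). mob (adj2 A) (K (u, mob A z))) ` ({0..1} \<times> hplane) \<subseteq> hplane"
      using Ah A'h Kh by auto
    show "\<forall>z\<in>hplane. (case (0, z) of (u, z) \<Rightarrow> mob (adj2 A) (K (u, mob A z))) = mob (adj2 A) (s (f (mob A z))) \<and>
        (case (1, z) of (u, z) \<Rightarrow> mob (adj2 A) (K (u, mob A z))) = z"
      using K01 Ah by (simp add: mob_adj2 A)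
    show "\<forall>g\<in>\<Gamma>. \<forall>z\<in>hplane. \<exists>k::int. f (mob A (g z)) = f (mob A z) + of_int k"
      using fg Ah conj by (metis imageI)
    show "\<forall>t. \<exists>g\<in>\<Gamma>. mob (adj2 A) (s (t + 1)) = g (mob (adj2 A) (s t))"
      using sg conj' sh by (metis imageE)
    show "\<forall>g\<in>\<Gamma>. \<forall>z\<in>hplane. \<forall>u\<in>{0..1}. \<exists>h\<in>\<Gamma>.
        (case (u, g z) of (u, z) \<Rightarrow> mob (adj2 A) (K (u, mob A z))) =
        h (case (u, z) of (u, z) \<Rightarrow> mob (adj2 A) (K (u, mob A z)))"
    proof (intro ballI)
      fix g z u assume *: "g \<in> \<Gamma>" "z \<in> hplane" "u \<in> {0..1::real}"
      obtain h where h: "h \<in> \<Gamma>" "K (u, conj_by A g (mob A z)) = conj_by A h (K (u, mob A z))"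
        using Kg * Ah by blast
      have "mob (adj2 A) (K (u, mob A (g z))) = h (mob (adj2 A) (K (u, mob A z)))"
        using h * conj conj'[OF h(1) Kh[OF *(3) Ah[OF *(2)]]] by simp
      then show "\<exists>h\<in>\<Gamma>. (case (u, g z) of (u, z) \<Rightarrow> mob (adj2 A) (K (u, mob A z))) =
          h (case (u, z) of (u, z) \<Rightarrow> mob (adj2 A) (K (u, mob A z)))"
        using h(1) by auto
    qed
  qed
qed

section \<open>Matrix representatives of deck transformations\<close>

text \<open>The preimage in SL(2,R) of the orientation-preserving part of the group. It contains
  both signs of every matrix, which later lets the sign of a trace or of an entry be chosen.\<close>

definition lifts :: "(complex \<Rightarrow> complex) set \<Rightarrow> (real^2^2) set" where
  "lifts \<Gamma> = {A. det A = 1 \<and> (\<exists>g\<in>\<Gamma>. \<forall>z\<in>hplane. g z = mob A z)}"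

lemma lifts_uminus: "A \<in> lifts \<Gamma> \<Longrightarrow> - A \<in> lifts \<Gamma>"
  by (auto simp: lifts_def det_2)

context deck_group
begin

lemma lifts_mult:
  assumes "A \<in> lifts \<Gamma>" "B \<in> lifts \<Gamma>"
  shows "A ** B \<in> lifts \<Gamma>"
proof -
  obtain g where g: "det A = 1" "g \<in> \<Gamma>" "\<And>z. z \<in> hplane \<Longrightarrow> g z = mob A z" using assms(1) by (auto simp: lifts_def)
  obtain h where h: "det B = 1" "h \<in> \<Gamma>" "\<And>z. z \<in> hplane \<Longrightarrow> h z = mob B z" using assms(2) by (auto simp: lifts_def)
  obtain k where k: "k \<in> \<Gamma>" "\<And>z. z \<in> hplane \<Longrightarrow> k z = g (h z)" using comp_ex[OF g(2) h(2)] by metis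
  have "k z = mob (A ** B) z" if "z \<in> hplane" for z
    using that by (simp add: k(2) mob_mult g(1) h(1) h(3) g(3)[OF mob_in_hplane[OF h(1)]])
  then show ?thesis using k(1) by (auto simp: lifts_def det_mul g h)
qed

lemma lifts_adj2:
  assumes "A \<in> lifts \<Gamma>"
  shows "adj2 A \<in> lifts \<Gamma>"
proof -
  obtain g where g: "det A = 1" "g \<in> \<Gamma>" "\<And>z. z \<in> hplane \<Longrightarrow> g z = mob A z" using assms by (auto simp: lifts_def)
  obtain h where h: "h \<in> \<Gamma>" "\<forall>z\<in>hplane. h (g z) = z \<and> g (h z) = z" using inv_ex[OF g(2)] by auto
  have "h z = mob (adj2 A) z" if "z \<in> hplane" for z
    using h(2) that g(3)[OF maps[OF h(1) that]] mob_adj2(2)[OF g(1) maps[OF h(1) that]] by simp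
  then show ?thesis using h(1) adj2(3)[OF g(1)] by (auto simp: lifts_def)
qed

lemma lifts_free:
  assumes "A \<in> lifts \<Gamma>" "z \<in> hplane" "mob A z = z" "w \<in> hplane"
  shows "mob A w = w"
proof -
  obtain g where g: "det A = 1" "g \<in> \<Gamma>" "\<And>z. z \<in> hplane \<Longrightarrow> g z = mob A z" using assms(1) by (auto simp: lifts_def)
  have "g = (\<lambda>z\<in>hplane. z)" using free[OF g(2) assms(2)] g(3) assms by simp
  then show ?thesis using g(3)[OF assms(4)] assms(4) by simp
qed

text \<open>An isometry \<open>z \<mapsto> mob A (mirror z)\<close> is a glide reflection or a reflection, and its square has
  the representative \<open>A ** B\<close>, with \<open>B\<close> the conjugate of \<open>A\<close> by the reflection.\<close>

lemma mirror_square_lift: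
  assumes g: "g \<in> \<Gamma>" and A: "det (mat2 p q r s) = 1"
    and gA: "\<And>z. z \<in> hplane \<Longrightarrow> g z = mob (mat2 p q r s) (mirror z)"
  shows "mat2 p q r s ** mat2 p (- q) (- r) s \<in> lifts \<Gamma>" and "p \<noteq> s"
proof -
  let ?A = "mat2 p q r s" and ?B = "mat2 p (- q) (- r) s"
  have B: "det ?B = 1" using A by simp
  have mm: "mirror (mob ?A (mirror z)) = mob ?B z" if "z \<in> hplane" for z
  proof -
    have "mirror (mob ?A (mirror z)) = - ((- of_real p * z + of_real q) / (- of_real r * z + of_real s))"
      by (simp add: mirror_def mob_mat2)
    also have "\<dots> = mob ?B z"
      unfolding mob_mat2 minus_divide_left by simp
    finally show ?thesis .
  qed
  obtain k where k: "k \<in> \<Gamma>" "\<And>z. z \<in> hplane \<Longrightarrow> k z = g (g z)" using comp_ex[OF g g] by metis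
  have kz: "k z = mob (?A ** ?B) z" if z: "z \<in> hplane" for z
  proof -
    have "k z = mob ?A (mirror (mob ?A (mirror z)))"
      using k(2)[OF z] gA[OF maps[OF g z]] gA[OF z] by simp
    also have "\<dots> = mob (?A ** ?B) z" unfolding mm[OF z] by (rule mob_mult[OF A B z, symmetric])
    finally show ?thesis .
  qed
  then show "?A ** ?B \<in> lifts \<Gamma>" using k(1) A B by (auto simp: lifts_def det_mul simp del: mat2_mult)
  show "p \<noteq> s"
  proof
    \<comment> \<open>The map has matrix (-p, q; -r, s) of determinant -1 and trace s - p. Trace 0
      makes it a reflection; this has a fixed point, so by freeness it would be the
      identity.\<close>
    assume ps: "p = s"
    then have d: "p * p - q * r = 1" using A by simp
    have fixed: "g z = z" if z: "z \<in> hplane"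
      and eq: "of_real p * mirror z + of_real q = z * (of_real r * mirror z + of_real s)" for z
    proof -
      have "of_real r * mirror z + of_real s \<noteq> 0"
        using mob_denom_nonzero[OF A, of "mirror z"] z by simp
      then show ?thesis unfolding gA[OF z] mob_mat2 eq by simp
    qed
    have "\<exists>z\<in>hplane. g z = z"
    \<comment> \<open>The fixed points satisfy r |z|^2 - 2 p Re z + q = 0. This is the vertical line
      Re z = q/(2p) if r = 0, and otherwise the semicircle with centre p/r and radius 1/|r|, whose
      top point is taken.\<close>
    proof (cases "r = 0")
      case True
      then have "p \<noteq> 0" using d by auto
      then have "g (Complex (q / (2 * p)) 1) = Complex (q / (2 * p)) 1"
        using ps True by (intro fixed) (simp_all add: hplane_iff complex_eq_iff mirror_def)
      then show ?thesis by (intro bexI[of _ "Complex (q / (2 * p)) 1"]) (simp_all add: hplane_iff)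
    next
      case False
      have "1 / \<bar>r\<bar> * (1 / \<bar>r\<bar>) = 1 / (r * r)" by (simp add: abs_mult[symmetric])
      then have "g (Complex (p / r) (1 / \<bar>r\<bar>)) = Complex (p / r) (1 / \<bar>r\<bar>)"
        using False d ps by (intro fixed) (simp_all add: hplane_iff complex_eq_iff mirror_def field_simps)
      then show ?thesis using False by (intro bexI[of _ "Complex (p / r) (1 / \<bar>r\<bar>)"]) (simp_all add: hplane_iff)
    qed
    then have gid: "g z = z" if "z \<in> hplane" for z using free[OF g] that by fastforce
    have *: "of_real p * mirror z + of_real q = z * (of_real r * mirror z + of_real s)" if z: "z \<in> hplane" for z
    proof -
      have "of_real r * mirror z + of_real s \<noteq> 0"
        using mob_denom_nonzero[OF A, of "mirror z"] z by simp
      then show ?thesis using gid[OF z] gA[OF z] by (simp add: mob_mat2 divide_eq_eq)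
    qed
    have "p = 0 \<and> s = 0"
      using *[of "Complex 1 1"] *[of "Complex 1 2"] *[of "Complex 0 1"] *[of "Complex 0 2"] ps
      by (simp add: hplane_iff complex_eq_iff mirror_def)
    moreover have "q = r" "q = 4 * r"
      using *[of "Complex 0 1"] *[of "Complex 0 2"] by (simp_all add: hplane_iff complex_eq_iff mirror_def)
    ultimately show False using d by simp
  qed
qed

end

lemma lifts_conj:
  assumes "deck_group \<Gamma>" and A: "det A = 1" and M: "M \<in> lifts (conj_by A ` \<Gamma>)"
  shows "adj2 A ** M ** A \<in> lifts \<Gamma>"
proof -
  interpret deck_group \<Gamma> by fact
  note A' = adj2(3)[OF A]
  obtain g where g: "det M = 1" "g \<in> \<Gamma>" "\<And>z. z \<in> hplane \<Longrightarrow> conj_by A g z = mob M z"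
    using M by (auto simp: lifts_def)
  have "g z = mob (adj2 A ** M ** A) z" if z: "z \<in> hplane" for z
  proof -
    have Az: "mob A z \<in> hplane" using mob_in_hplane[OF A z] .
    have "mob A (g z) = mob M (mob A z)"
      using g(3)[OF Az] Az by (simp add: conj_by_def mob_adj2 A z)
    then have "mob (adj2 A) (mob A (g z)) = mob (adj2 A) (mob M (mob A z))" by simp
    then show ?thesis
      using z by (simp add: mob_adj2(2)[OF A maps[OF g(2) z]] mob_mult det_mul A A' g(1) Az mob_in_hplane)
  qed
  then show ?thesis using g A A' by (auto simp: lifts_def det_mul)
qed

lemma lifts_conj':
  assumes "deck_group \<Gamma>" and A: "det A = 1" and M: "M \<in> lifts \<Gamma>"
  shows "A ** M ** adj2 A \<in> lifts (conj_by A ` \<Gamma>)"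
proof -
  interpret deck_group \<Gamma> by fact
  note A' = adj2(3)[OF A]
  obtain g where g: "det M = 1" "g \<in> \<Gamma>" "\<And>z. z \<in> hplane \<Longrightarrow> g z = mob M z"
    using M by (auto simp: lifts_def)
  have "conj_by A g z = mob (A ** M ** adj2 A) z" if z: "z \<in> hplane" for z
    using z by (simp add: conj_by_def g mob_mult det_mul A A' mob_in_hplane)
  then show ?thesis using g A A' by (auto simp: lifts_def det_mul)
qed

section \<open>Normal forms\<close>

text \<open>The columns of T are eigenvectors for the eigenvalues \<kappa> and \<nu> = 1/\<kappa>.
  For an eigenvalue t they are (t - d, c) if c is nonzero and (b, t - a) if b is nonzero.\<close>

lemma hyperbolic_diagonalizable:
  assumes det: "det G = 1" and tr: "2 < trace G"
  obtains T \<kappa> where "det T = 1" "1 < \<kappa>" "G ** T = T ** mat2 \<kappa> 0 0 (1 / \<kappa>)"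
proof -
  obtain a b c d where G: "G = mat2 a b c d" by (rule mat2_cases)
  define \<tau> where "\<tau> = a + d"
  have \<tau>: "2 < \<tau>" using tr by (simp add: G trace_2 \<tau>_def)
  have "2 * 2 < \<tau> * \<tau>" using \<tau> by (intro mult_strict_mono) auto
  then have disc: "0 < \<tau> * \<tau> - 4" by simp
  define \<rho> where "\<rho> = sqrt (\<tau> * \<tau> - 4)"
  have \<rho>: "0 < \<rho>" "\<rho> * \<rho> = \<tau> * \<tau> - 4" using disc by (simp_all add: \<rho>_def)
  define \<kappa> where "\<kappa> = (\<tau> + \<rho>) / 2"
  have \<kappa>: "1 < \<kappa>" using \<tau> \<rho>(1) by (simp add: \<kappa>_def)
  have eig: "\<kappa> * \<kappa> = \<tau> * \<kappa> - 1"
    unfolding \<kappa>_def using \<rho>(2) by (simp add: field_simps)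
  define \<nu> where "\<nu> = 1 / \<kappa>"
  have \<nu>: "\<kappa> * \<nu> = 1" "\<nu> < 1" "0 < \<nu>" using \<kappa> by (auto simp: \<nu>_def)
  have "\<kappa> * (\<tau> - \<nu>) = \<kappa> * \<kappa>" using eig \<nu>(1) by (simp add: right_diff_distrib mult.commute)
  then have sum: "\<kappa> + \<nu> = a + d" using \<kappa> by (simp add: \<tau>_def)
  have ad: "a * d - b * c = 1" using det by (simp add: G)
  have \<kappa>\<kappa>: "\<kappa> * \<kappa> = (a + d) * \<kappa> - 1" using eig by (simp add: \<tau>_def)
  have \<nu>\<nu>: "\<nu> * \<nu> = (a + d) * \<nu> - 1" using sum \<nu>(1) by (simp add: sum[symmetric] algebra_simps)
  have diff: "\<kappa> - \<nu> \<noteq> 0" using \<kappa> \<nu> by simp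
  show thesis
  proof (cases "c = 0")
    case False
    \<comment> \<open>Rescaling the second eigenvector by \<open>y\<close> makes the determinant
      1.\<close>
    define y where "y = 1 / (c * (\<kappa> - \<nu>))"
    have y: "c * (\<kappa> - \<nu>) * y = 1" using False diff by (simp add: y_def)
    let ?T = "mat2 (\<kappa> - d) ((\<nu> - d) * y) c (c * y)"
    have "det ?T = c * (\<kappa> - \<nu>) * y" by (simp add: algebra_simps)
    then have 1: "det ?T = 1" using y by simp
    have *: "a * (t - d) + b * c = (t - d) * t" "c * (t - d) + d * c = c * t" if "t * t = (a + d) * t - 1" for t
      using that ad by (simp_all add: algebra_simps)
    have "a * ((\<nu> - d) * y) + b * (c * y) = (\<nu> - d) * y * \<nu>" "c * ((\<nu> - d) * y) + d * (c * y) = c * y * \<nu>"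
      using arg_cong[OF *(1)[OF \<nu>\<nu>], of "\<lambda>t. t * y"] arg_cong[OF *(2)[OF \<nu>\<nu>], of "\<lambda>t. t * y"]
      by (simp_all add: algebra_simps)
    then have 2: "G ** ?T = ?T ** mat2 \<kappa> 0 0 (1 / \<kappa>)"
      using *[OF \<kappa>\<kappa>] by (simp add: G \<nu>_def[symmetric])
    show thesis by (rule that[OF 1 \<kappa> 2])
  next
    case c: True
    show thesis
    proof (cases "b = 0")
      case False
      define y where "y = 1 / (b * (\<nu> - \<kappa>))"
      have y: "b * (\<nu> - \<kappa>) * y = 1" using False diff by (simp add: y_def)
      let ?T = "mat2 b (b * y) (\<kappa> - a) ((\<nu> - a) * y)"
      have "det ?T = b * (\<nu> - \<kappa>) * y" by (simp add: algebra_simps)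
      then have 1: "det ?T = 1" using y by simp
      have *: "a * b + b * (t - a) = b * t" "c * b + d * (t - a) = (t - a) * t" if "t * t = (a + d) * t - 1" for t
        using that ad by (simp_all add: algebra_simps)
      have "a * (b * y) + b * ((\<nu> - a) * y) = b * y * \<nu>" "c * (b * y) + d * ((\<nu> - a) * y) = (\<nu> - a) * y * \<nu>"
        using arg_cong[OF *(1)[OF \<nu>\<nu>], of "\<lambda>t. t * y"] arg_cong[OF *(2)[OF \<nu>\<nu>], of "\<lambda>t. t * y"]
        by (simp_all add: algebra_simps)
      then have 2: "G ** ?T = ?T ** mat2 \<kappa> 0 0 (1 / \<kappa>)"
        using *[OF \<kappa>\<kappa>] by (simp add: G \<nu>_def[symmetric])
      show thesis by (rule that[OF 1 \<kappa> 2])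
    next
      case b: True
      then have ad1: "a * d = 1" using ad by simp
      have "(\<kappa> - a) * (\<kappa> - d) = 0" using \<kappa>\<kappa> ad1 by (simp add: algebra_simps)
      then consider "\<kappa> = a" | "\<kappa> = d" by auto
      then show thesis
      proof cases
        case 1
        then have "\<nu> = d" using sum by simp
        then have "G = mat2 \<kappa> 0 0 (1 / \<kappa>)" using 1 b c by (simp add: G \<nu>_def)
        \<comment> \<open>The eigenvalues stand in the wrong order; a quarter turn exchanges the
          coordinate axes with determinant 1.\<close>
        then show thesis using \<kappa> by (intro that[of "mat2 1 0 0 1" \<kappa>]) simp_all
      next
        case 2
        then have "\<nu> = a" using sum by simp
        then have "G = mat2 (1 / \<kappa>) 0 0 \<kappa>" using 2 b c by (simp add: G \<nu>_def)
        then show thesis using \<kappa> by (intro that[of "mat2 0 (-1) 1 0" \<kappa>]) simp_all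
      qed
    qed
  qed
qed

lemma parabolic_normal_form:
  assumes "det G = 1" "trace G = 2"
  obtains T t where "det T = 1" "G ** T = T ** mat2 1 t 0 1"
proof -
  obtain a b c d where G: "G = mat2 a b c d" by (rule mat2_cases)
  have d: "d = 2 - a" using assms(2) by (simp add: G trace_2)
  have bc: "b * c = a * (2 - a) - 1" using assms(1) by (simp add: G d)
  show thesis
  proof (cases "c = 0")
    case True
    then have "(a - 1) * (a - 1) = 0" using bc by (simp add: algebra_simps)
    then have "a = 1" by simp
    then show thesis using True d by (intro that[of "mat2 1 0 0 1" b]) (auto simp: G)
  next
    case False
    have 1: "a * (a - 1) + b * c = a - 1" using bc by (simp add: algebra_simps)
    have 2: "c * (a - 1) + d * c = c" by (simp add: d algebra_simps)
    have 3: "- (a / c) = (a - 1) * (- 1 / c) + - 1 / c" using False by (simp add: field_simps)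
    show thesis
    \<comment> \<open>The first column is the eigenvector for eigenvalue 1, the second completes it
      to determinant 1.\<close>
    proof (rule that[of "mat2 (a - 1) (- 1 / c) c 0" "- 1 / c"])
      show "det (mat2 (a - 1) (- 1 / c) c 0) = 1" using False by simp
      show "G ** mat2 (a - 1) (- 1 / c) c 0 = mat2 (a - 1) (- 1 / c) c 0 ** mat2 1 (- 1 / c) 0 1"
        using False 1 2 3 by (simp add: G)
    qed
  qed
qed

text \<open>Fixed points are roots of c z^2 + (d - a) z - b, whose discriminant is (a + d)^2 - 4 <
  0; the root with positive imaginary part is taken, hence |c| in its imaginary part. If c were 0,
  then ad = 1 would give |a + d| \<ge> 2.\<close>

lemma elliptic_fixed_point:
  assumes det: "det G = 1" and tr: "\<bar>trace G\<bar> < 2"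
  obtains z where "z \<in> hplane" "mob G z = z"
proof -
  obtain a b c d where G: "G = mat2 a b c d" by (rule mat2_cases)
  define \<tau> where "\<tau> = a + d"
  have \<tau>: "\<bar>\<tau>\<bar> < 2" using tr by (simp add: G trace_2 \<tau>_def)
  have ad: "a * d - b * c = 1" using det by (simp add: G)
  have "\<tau> * \<tau> < 4"
    using abs_mult_less[OF \<tau> \<tau>] by (simp add: abs_mult_self_eq)
  then have disc: "0 < 4 - \<tau> * \<tau>" by simp
  define \<sigma> where "\<sigma> = sqrt (4 - \<tau> * \<tau>)"
  have \<sigma>: "\<sigma> * \<sigma> = 4 - \<tau> * \<tau>" "0 < \<sigma>" using disc by (auto simp: \<sigma>_def)
  have c: "c \<noteq> 0"
  proof
    assume "c = 0"
    then have "a * d = 1" using ad by simp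
    moreover have "0 \<le> (a - d) * (a - d)" by simp
    ultimately show False using disc by (simp add: \<tau>_def algebra_simps)
  qed
  define z where "z = Complex ((a - d) / (2 * c)) (\<sigma> / (2 * \<bar>c\<bar>))"
  have z: "z \<in> hplane" using \<sigma> c by (simp add: z_def hplane_iff)
  have Im2: "(\<sigma> / (2 * \<bar>c\<bar>)) * (\<sigma> / (2 * \<bar>c\<bar>)) = (4 - \<tau> * \<tau>) / (4 * (c * c))"
    by (simp add: \<sigma>(1) abs_mult[symmetric])
  have "of_real a * z + of_real b = z * (of_real c * z + of_real d)"
  proof (intro complex_eqI)
    have "Re (z * (of_real c * z + of_real d)) = c * (((a - d) / (2 * c)) * ((a - d) / (2 * c)) - (4 - \<tau> * \<tau>) / (4 * (c * c))) + d * ((a - d) / (2 * c))"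
      unfolding Im2[symmetric] by (simp add: z_def algebra_simps)
    also have "\<dots> = ((a - d) * (a - d) - (4 - \<tau> * \<tau>) + 2 * d * (a - d)) / (4 * c)"
      using c by (simp add: field_simps)
    also have "(a - d) * (a - d) - (4 - \<tau> * \<tau>) + 2 * d * (a - d) = 2 * (a * (a - d) + 2 * (b * c))"
      using ad unfolding \<tau>_def by (simp add: algebra_simps)
    also have "\<dots> / (4 * c) = a * ((a - d) / (2 * c)) + b"
      using c by (simp add: field_simps)
    finally show "Re (of_real a * z + of_real b) = Re (z * (of_real c * z + of_real d))"
      by (simp add: z_def)
    show "Im (of_real a * z + of_real b) = Im (z * (of_real c * z + of_real d))"
      using c by (simp add: z_def field_simps)
  qed
  moreover have "of_real c * z + of_real d \<noteq> 0"
    using mob_denom_nonzero[OF det z] by (simp add: G)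
  ultimately have "mob G z = z" by (simp add: G mob_mat2)
  with z show thesis by (rule that)
qed

section \<open>Elementary groups\<close>

lemma discrete_subgroup_real_cyclic:
  fixes S :: "real set"
  assumes diff: "\<And>x y. x \<in> S \<Longrightarrow> y \<in> S \<Longrightarrow> x - y \<in> S"
    and fin: "\<And>R. finite {x \<in> S. \<bar>x\<bar> \<le> R}" and nz: "x0 \<in> S" "x0 \<noteq> 0"
  obtains l where "0 < l" "l \<in> S" "\<And>x. x \<in> S \<Longrightarrow> \<exists>k::int. x = of_int k * l"
proof -
  have zero: "0 \<in> S" using diff[OF nz(1) nz(1)] by simp
  have neg: "- x \<in> S" if "x \<in> S" for x using diff[OF zero that] by simp
  have add: "x + y \<in> S" if "x \<in> S" "y \<in> S" for x y using diff[OF that(1) neg[OF that(2)]] by simp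
  have nat_mult: "of_nat n * x \<in> S" if "x \<in> S" for n x
    by (induction n) (use that zero add in \<open>auto simp: distrib_right\<close>)
  have int_mult: "of_int k * x \<in> S" if "x \<in> S" for k x
    using nat_mult[OF that, of "nat k"] neg[OF nat_mult[OF that, of "nat (- k)"]] by (cases "0 \<le> k") auto
  \<comment> \<open>The bound |x0| makes the set of candidates for the least positive element
    finite, and x0 or its negative shows that it is nonempty.\<close>
  let ?P = "{x \<in> S. 0 < x \<and> x \<le> \<bar>x0\<bar>}"
  have finP: "finite ?P" by (rule finite_subset[OF _ fin[of "\<bar>x0\<bar>"]]) auto
  have "\<bar>x0\<bar> \<in> ?P" using nz neg[OF nz(1)] by (auto simp: abs_if)
  then have neP: "?P \<noteq> {}" by blast
  define l where "l = Min ?P"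
  have l: "l \<in> ?P" unfolding l_def by (rule Min_in[OF finP neP])
  have "\<exists>k::int. x = of_int k * l" if x: "x \<in> S" for x
  proof -
    define y where "y = x - of_int \<lfloor>x / l\<rfloor> * l"
    have y: "y \<in> S" unfolding y_def using diff x int_mult l by auto
    have l0: "0 < l" using l by simp
    have fl: "of_int \<lfloor>x / l\<rfloor> \<le> x / l" "x / l < of_int \<lfloor>x / l\<rfloor> + 1" by linarith+
    have "of_int \<lfloor>x / l\<rfloor> * l \<le> x" "x < (of_int \<lfloor>x / l\<rfloor> + 1) * l"
      using fl(1)[unfolded pos_le_divide_eq[OF l0]] fl(2)[unfolded pos_divide_less_eq[OF l0]] by auto
    then have "0 \<le> y" "y < l" by (simp_all add: y_def distrib_right)
    moreover have False if "0 < y"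
    proof -
      have "y \<in> ?P" using that y \<open>y < l\<close> l by auto
      then have "l \<le> y" unfolding l_def by (rule Min_le[OF finP])
      with \<open>y < l\<close> show False by simp
    qed
    ultimately have "y = 0" by force
    then show ?thesis unfolding y_def by (intro exI[of _ "\<lfloor>x / l\<rfloor>"]) simp
  qed
  then show thesis using that l by blast
qed

text \<open>The translation amounts of \<phi> form a subgroup of the reals. It is discrete, since g
  moves the point c 0 along the curve c by exactly this amount and displacements are finite; it is
  nonzero by the last assumption. So it is generated by some l, and rescaling by l makes the period
  1.\<close>

lemma (in deck_group) circle_dominated_if_translations:
  fixes \<phi> :: "complex \<Rightarrow> real" and c :: "real \<Rightarrow> complex" and K :: "real \<times> complex \<Rightarrow> complex"
  assumes \<phi>: "continuous_on hplane \<phi>" and c: "continuous_on UNIV c" "range c \<subseteq> hplane"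
    and K: "continuous_on ({0..1} \<times> hplane) K" "K ` ({0..1} \<times> hplane) \<subseteq> hplane"
    and K01: "\<And>z. z \<in> hplane \<Longrightarrow> K (0, z) = c (\<phi> z)" "\<And>z. z \<in> hplane \<Longrightarrow> K (1, z) = z"
    and trans: "\<And>g. g \<in> \<Gamma> \<Longrightarrow> \<exists>x. (\<forall>z\<in>hplane. \<phi> (g z) = \<phi> z + x) \<and> (\<forall>t. g (c t) = c (t + x)) \<and>
        (\<forall>z\<in>hplane. \<forall>u\<in>{0..1}. K (u, g z) = g (K (u, z)))"
    and nz: "g0 \<in> \<Gamma>" "\<phi> (g0 \<i>) \<noteq> \<phi> \<i>"
  shows "circle_dominated \<Gamma>"
proof -
  define x where "x g = \<phi> (g \<i>) - \<phi> \<i>" for g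
  have x: "(\<forall>z\<in>hplane. \<phi> (g z) = \<phi> z + x g)" "(\<forall>t. g (c t) = c (t + x g))"
    "(\<forall>z\<in>hplane. \<forall>u\<in>{0..1}. K (u, g z) = g (K (u, z)))" if g: "g \<in> \<Gamma>" for g
  proof -
    obtain y where y: "\<forall>z\<in>hplane. \<phi> (g z) = \<phi> z + y" "\<forall>t. g (c t) = c (t + y)"
      "\<forall>z\<in>hplane. \<forall>u\<in>{0..1}. K (u, g z) = g (K (u, z))"
      using trans[OF g] by blast
    have "y = x g" using y(1) by (simp add: x_def)
    with y show "(\<forall>z\<in>hplane. \<phi> (g z) = \<phi> z + x g)" "(\<forall>t. g (c t) = c (t + x g))"
      "(\<forall>z\<in>hplane. \<forall>u\<in>{0..1}. K (u, g z) = g (K (u, z)))" by auto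
  qed
  have ch: "c t \<in> hplane" for t using c(2) by auto
  obtain l where l: "0 < l" "l \<in> x ` \<Gamma>" "\<And>y. y \<in> x ` \<Gamma> \<Longrightarrow> \<exists>k::int. y = of_int k * l"
  proof (rule discrete_subgroup_real_cyclic[of "x ` \<Gamma>" "x g0"])
    fix y y' assume "y \<in> x ` \<Gamma>" "y' \<in> x ` \<Gamma>"
    then obtain g h where gh: "g \<in> \<Gamma>" "h \<in> \<Gamma>" "y = x g" "y' = x h" by auto
    obtain h' where h': "h' \<in> \<Gamma>" "\<forall>z\<in>hplane. h' (h z) = z \<and> h (h' z) = z" using inv_ex[OF gh(2)] by auto
    obtain k where k: "k \<in> \<Gamma>" "\<And>z. z \<in> hplane \<Longrightarrow> k z = g (h' z)" using comp_ex[OF gh(1) h'(1)] by metis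
    have hi: "h' \<i> \<in> hplane" using maps[OF h'(1)] by simp
    have "\<phi> (h (h' \<i>)) = \<phi> (h' \<i>) + x h" using x(1)[OF gh(2)] hi by blast
    moreover have "\<phi> (g (h' \<i>)) = \<phi> (h' \<i>) + x g" using x(1)[OF gh(1)] hi by blast
    ultimately have "x k = x g - x h" using h'(2) by (simp add: x_def k(2))
    then show "y - y' \<in> x ` \<Gamma>" using k(1) gh by (metis image_eqI)
  next
    fix R
    have "continuous_on {-R..R} (\<lambda>t. hdist (c 0) (c t))"
      by (rule continuous_on_compose2[OF continuous_on_hdist[OF ch] continuous_on_subset[OF c(1)]]) (use ch in auto)
    then have "bounded ((\<lambda>t. hdist (c 0) (c t)) ` {-R..R})"
      by (intro compact_imp_bounded compact_continuous_image) auto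
    then obtain B where B: "\<forall>t\<in>{-R..R}. \<bar>hdist (c 0) (c t)\<bar> \<le> B"
      unfolding bounded_iff by auto
    have "{y \<in> x ` \<Gamma>. \<bar>y\<bar> \<le> R} \<subseteq> x ` {g \<in> \<Gamma>. hdist (c 0) (g (c 0)) \<le> B}"
    proof clarify
      fix g assume g: "g \<in> \<Gamma>" "\<bar>x g\<bar> \<le> R"
      have "g (c 0) = c (x g)" using x(2)[OF g(1)] by simp
      then have "hdist (c 0) (g (c 0)) \<le> B" using B g(2) by (auto simp: abs_le_iff)
      then show "x g \<in> x ` {g \<in> \<Gamma>. hdist (c 0) (g (c 0)) \<le> B}" using g(1) by auto
    qed
    then show "finite {y \<in> x ` \<Gamma>. \<bar>y\<bar> \<le> R}"
      using finite_displacement[OF ch] by (meson finite_imageI finite_subset)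
  qed (use nz in \<open>auto simp: x_def\<close>)
  show ?thesis
    unfolding circle_dominated_def
  proof (rule exI[of _ "\<lambda>z. \<phi> z / l"], rule exI[of _ "\<lambda>t. c (l * t)"], rule exI[of _ K], intro conjI)
    show "continuous_on hplane (\<lambda>z. \<phi> z / l)" using \<phi> l by (intro continuous_intros) auto
    show "continuous_on UNIV (\<lambda>t. c (l * t))"
      by (rule continuous_on_compose2[OF c(1)]) (auto intro!: continuous_intros)
    show "range (\<lambda>t. c (l * t)) \<subseteq> hplane" using ch by auto
    show "\<forall>z\<in>hplane. K (0, z) = c (l * (\<phi> z / l)) \<and> K (1, z) = z" using K01 l by simp
    show "\<forall>g\<in>\<Gamma>. \<forall>z\<in>hplane. \<exists>k::int. \<phi> (g z) / l = \<phi> z / l + of_int k"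
    proof (intro ballI)
      fix g z assume g: "g \<in> \<Gamma>" and z: "z \<in> hplane"
      obtain k :: int where "x g = of_int k * l" using l(3) g by auto
      then have "\<phi> (g z) / l = \<phi> z / l + of_int k" using x(1)[OF g] z l(1) by (simp add: field_simps)
      then show "\<exists>k::int. \<phi> (g z) / l = \<phi> z / l + of_int k" by blast
    qed
    obtain g1 where g1: "g1 \<in> \<Gamma>" "l = x g1" using l(2) by auto
    then have "c (l * (t + 1)) = g1 (c (l * t))" for t
      using x(2)[OF g1(1)] by (simp add: distrib_left)
    then show "\<forall>t. \<exists>g\<in>\<Gamma>. c (l * (t + 1)) = g (c (l * t))" using g1(1) by blast
    show "\<forall>g\<in>\<Gamma>. \<forall>z\<in>hplane. \<forall>u\<in>{0..1}. \<exists>h\<in>\<Gamma>. K (u, g z) = h (K (u, z))"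
      using x(3) by blast
  qed (use K in auto)
qed

lemma circle_dominated_trivial:
  assumes "\<And>g z. g \<in> \<Gamma> \<Longrightarrow> z \<in> hplane \<Longrightarrow> g z = z" "\<Gamma> \<noteq> {}"
  shows "circle_dominated \<Gamma>"
proof -
  have h: "of_real u * z + of_real (1 - u) * \<i> \<in> hplane" if "u \<in> {0..1}" "z \<in> hplane" for u z
  proof -
    have "0 < u * Im z + (1 - u)"
      using that by (cases "u = 0") (auto simp: hplane_iff add_pos_nonneg)
    then show ?thesis by (simp add: hplane_iff)
  qed
  show ?thesis
    unfolding circle_dominated_def
  proof (rule exI[of _ "\<lambda>_. 0"], rule exI[of _ "\<lambda>_. \<i>"],
      rule exI[of _ "\<lambda>p. of_real (fst p) * snd p + of_real (1 - fst p) * \<i>"], intro conjI)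
    show "\<forall>g\<in>\<Gamma>. \<forall>z\<in>hplane. \<forall>u\<in>{0..1}. \<exists>h\<in>\<Gamma>. of_real (fst (u, g z)) * snd (u, g z) + of_real (1 - fst (u, g z)) * \<i> =
        h (of_real (fst (u, z)) * snd (u, z) + of_real (1 - fst (u, z)) * \<i>)"
    proof (intro ballI)
      fix g z and u :: real assume *: "g \<in> \<Gamma>" "z \<in> hplane" "u \<in> {0..1}"
      show "\<exists>h\<in>\<Gamma>. of_real (fst (u, g z)) * snd (u, g z) + of_real (1 - fst (u, g z)) * \<i> =
        h (of_real (fst (u, z)) * snd (u, z) + of_real (1 - fst (u, z)) * \<i>)"
        using assms(1)[OF *(1,2)] assms(1)[OF *(1) h[OF *(3,2)]] *(1) by (intro bexI[of _ g]) auto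
    qed
    show "(\<lambda>p. of_real (fst p) * snd p + of_real (1 - fst p) * \<i>) ` ({0..1} \<times> hplane) \<subseteq> hplane"
      using h by auto
    show "\<forall>t::real. \<exists>g\<in>\<Gamma>. \<i> = g \<i>" using assms by (metis ex_in_conv i_in_hplane)
  qed (auto intro!: continuous_intros)
qed

text \<open>\<open>K\<close> is the straight-line homotopy from the projection to the imaginary axis
  to the identity. It is compatible with positive real factors and with the reflection, so annuli
  and Moebius bands are treated at once.\<close>

lemma (in deck_group) circle_dominated_dilations:
  assumes dil: "\<And>g. g \<in> \<Gamma> \<Longrightarrow> \<exists>k>0. (\<forall>z\<in>hplane. g z = of_real k * z) \<or> (\<forall>z\<in>hplane. g z = of_real k * mirror z)"
    and nz: "g0 \<in> \<Gamma>" "cmod (g0 \<i>) \<noteq> 1"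
  shows "circle_dominated \<Gamma>"
proof (rule circle_dominated_if_translations[of "\<lambda>z. ln (cmod z)" "\<lambda>t. \<i> * of_real (exp t)"
      "\<lambda>p. of_real (fst p) * snd p + of_real (1 - fst p) * (\<i> * of_real (cmod (snd p)))" g0])
  have nz': "z \<noteq> 0" if "z \<in> hplane" for z using that by (auto simp: hplane_iff)
  show "continuous_on hplane (\<lambda>z. ln (cmod z))"
    using nz' by (auto intro!: continuous_intros)
  show "continuous_on UNIV (\<lambda>t. \<i> * of_real (exp t))" "range (\<lambda>t. \<i> * of_real (exp t)) \<subseteq> hplane"
    by (auto intro!: continuous_intros)
  show "continuous_on ({0..1} \<times> hplane) (\<lambda>p. of_real (fst p) * snd p + of_real (1 - fst p) * (\<i> * of_real (cmod (snd p))))"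
    by (intro continuous_intros)
  have h: "of_real u * z + of_real (1 - u) * (\<i> * of_real (cmod z)) \<in> hplane" if "u \<in> {0..1}" "z \<in> hplane" for u z
  proof -
    have "0 < cmod z" using nz' that by simp
    then have "0 < u * Im z + (1 - u) * cmod z"
      using that by (cases "u = 0") (auto simp: hplane_iff add_pos_nonneg)
    then show ?thesis by (simp add: hplane_iff)
  qed
  then show "(\<lambda>p. of_real (fst p) * snd p + of_real (1 - fst p) * (\<i> * of_real (cmod (snd p)))) ` ({0..1} \<times> hplane) \<subseteq> hplane"
    by auto
  show "of_real (fst (0::real, z)) * snd (0::real, z) + of_real (1 - fst (0::real, z)) * (\<i> * of_real (cmod (snd (0::real, z)))) = \<i> * of_real (exp (ln (cmod z)))"
    if "z \<in> hplane" for z using nz'[OF that] by simp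
  show "of_real (fst (1::real, z)) * snd (1::real, z) + of_real (1 - fst (1::real, z)) * (\<i> * of_real (cmod (snd (1::real, z)))) = z" for z
    by simp
  show "g0 \<in> \<Gamma>" by fact
  have "cmod (g0 \<i>) \<noteq> 0" using nz'[OF maps[OF nz(1) i_in_hplane]] by simp
  then show "ln (cmod (g0 \<i>)) \<noteq> ln (cmod \<i>)" using nz by (simp add: ln_eq_zero_iff)
  fix g assume g: "g \<in> \<Gamma>"
  obtain k where k: "0 < k" "(\<forall>z\<in>hplane. g z = of_real k * z) \<or> (\<forall>z\<in>hplane. g z = of_real k * mirror z)"
    using dil[OF g] by blast
  show "\<exists>x. (\<forall>z\<in>hplane. ln (cmod (g z)) = ln (cmod z) + x) \<and>
      (\<forall>t. g (\<i> * of_real (exp t)) = \<i> * of_real (exp (t + x))) \<and>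
      (\<forall>z\<in>hplane. \<forall>u\<in>{0..1}.
        of_real (fst (u, g z)) * snd (u, g z) + of_real (1 - fst (u, g z)) * (\<i> * of_real (cmod (snd (u, g z)))) =
        g (of_real (fst (u, z)) * snd (u, z) + of_real (1 - fst (u, z)) * (\<i> * of_real (cmod (snd (u, z))))))"
  proof (intro exI[of _ "ln k"] conjI ballI allI)
    show "ln (cmod (g z)) = ln (cmod z) + ln k" if z: "z \<in> hplane" for z
    proof -
      have "cmod (g z) = k * cmod z" using k z by (auto simp: norm_mult)
      then show ?thesis using k(1) nz'[OF z] by (simp add: ln_mult)
    qed
    show "g (\<i> * of_real (exp t)) = \<i> * of_real (exp (t + ln k))" for t
      using k by (auto simp: exp_add mirror_def mult_ac)
    fix z and u :: real assume z: "z \<in> hplane" and u: "u \<in> {0..1}"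
    show "of_real (fst (u, g z)) * snd (u, g z) + of_real (1 - fst (u, g z)) * (\<i> * of_real (cmod (snd (u, g z)))) =
        g (of_real (fst (u, z)) * snd (u, z) + of_real (1 - fst (u, z)) * (\<i> * of_real (cmod (snd (u, z)))))"
      using k(2)
    proof
      assume *: "\<forall>z\<in>hplane. g z = of_real k * z"
      show ?thesis using k(1) z h[OF u z] * by (simp add: norm_mult algebra_simps)
    next
      assume *: "\<forall>z\<in>hplane. g z = of_real k * mirror z"
      show ?thesis using k(1) z h[OF u z] * by (simp add: norm_mult algebra_simps mirror_def)
    qed
  qed
qed

text \<open>The quotient is a cusp, and the core circle comes from the horocycle Im z = 1, as no
  geodesic is invariant.\<close>

lemma (in deck_group) circle_dominated_horizontal_translations:
  assumes tr: "\<And>g. g \<in> \<Gamma> \<Longrightarrow> \<exists>x. \<forall>z\<in>hplane. g z = z + of_real x"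
    and nz: "g0 \<in> \<Gamma>" "g0 \<i> \<noteq> \<i>"
  shows "circle_dominated \<Gamma>"
proof (rule circle_dominated_if_translations[of Re "\<lambda>t. of_real t + \<i>"
      "\<lambda>p. of_real (fst p) * snd p + of_real (1 - fst p) * (of_real (Re (snd p)) + \<i>)" g0])
  show "continuous_on hplane Re"
    by (auto intro!: continuous_intros)
  show "continuous_on UNIV (\<lambda>t. of_real t + \<i>)" "range (\<lambda>t. of_real t + \<i>) \<subseteq> hplane"
    by (auto intro!: continuous_intros simp: hplane_iff)
  show "continuous_on ({0..1} \<times> hplane) (\<lambda>p. of_real (fst p) * snd p + of_real (1 - fst p) * (of_real (Re (snd p)) + \<i>))"
    by (intro continuous_intros)
  have h: "of_real u * z + of_real (1 - u) * (of_real (Re z) + \<i>) \<in> hplane" if "u \<in> {0..1}" "z \<in> hplane" for u z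
  proof -
    have "0 < u * Im z + (1 - u)"
      using that by (cases "u = 0") (auto simp: hplane_iff add_pos_nonneg)
    then show ?thesis by (simp add: hplane_iff)
  qed
  then show "(\<lambda>p. of_real (fst p) * snd p + of_real (1 - fst p) * (of_real (Re (snd p)) + \<i>)) ` ({0..1} \<times> hplane) \<subseteq> hplane"
    by auto
  show "of_real (fst (0::real, z)) * snd (0::real, z) + of_real (1 - fst (0::real, z)) * (of_real (Re (snd (0::real, z))) + \<i>) = of_real (Re z) + \<i>" for z
    by simp
  show "of_real (fst (1::real, z)) * snd (1::real, z) + of_real (1 - fst (1::real, z)) * (of_real (Re (snd (1::real, z))) + \<i>) = z" for z
    by simp
  show "g0 \<in> \<Gamma>" by fact
  obtain y where "\<forall>z\<in>hplane. g0 z = z + of_real y" using tr nz(1) by blast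
  then show "Re (g0 \<i>) \<noteq> Re \<i>" using nz(2) by auto
  fix g assume g: "g \<in> \<Gamma>"
  obtain x where x: "\<forall>z\<in>hplane. g z = z + of_real x" using tr[OF g] by blast
  show "\<exists>x. (\<forall>z\<in>hplane. Re (g z) = Re z + x) \<and>
      (\<forall>t. g (of_real t + \<i>) = of_real (t + x) + \<i>) \<and>
      (\<forall>z\<in>hplane. \<forall>u\<in>{0..1}.
        of_real (fst (u, g z)) * snd (u, g z) + of_real (1 - fst (u, g z)) * (of_real (Re (snd (u, g z))) + \<i>) =
        g (of_real (fst (u, z)) * snd (u, z) + of_real (1 - fst (u, z)) * (of_real (Re (snd (u, z))) + \<i>)))"
  proof (intro exI[of _ x] conjI ballI allI)
    fix z and u :: real assume z: "z \<in> hplane" and u: "u \<in> {0..1}"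
    show "of_real (fst (u, g z)) * snd (u, g z) + of_real (1 - fst (u, g z)) * (of_real (Re (snd (u, g z))) + \<i>) =
        g (of_real (fst (u, z)) * snd (u, z) + of_real (1 - fst (u, z)) * (of_real (Re (snd (u, z))) + \<i>))"
      using z h[OF u z] x by (simp add: algebra_simps)
  qed (use x in \<open>auto simp: hplane_iff\<close>)
qed

section \<open>The length of a projection\<close>

lemma cmod_mob_imaginary:
  "(cmod (mob (mat2 A B C D) (\<i> * of_real y)))\<^sup>2 = (A\<^sup>2 * y\<^sup>2 + B\<^sup>2) / (C\<^sup>2 * y\<^sup>2 + D\<^sup>2)"
  unfolding mob_mat2 norm_divide power_divide cmod_power2 by (simp add: power_mult_distrib add.commute)

text \<open>The squared modulus (A^2 Y + B^2)/(C^2 Y + D^2) is a Moebius function of Y = (exp t)^2.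
  It sweeps out the open interval between its limits B^2/D^2 at 0 and A^2/C^2 at infinity, which
  |BC| < |AD| puts in this order.\<close>

lemma range_ln_cmod_mob_imaginary:
  assumes nz: "B * C \<noteq> 0" "D \<noteq> 0" and less: "\<bar>B * C\<bar> < \<bar>A * D\<bar>"
  shows "range (\<lambda>t. ln (cmod (mob (mat2 A B C D) (\<i> * of_real (exp t))))) = {ln \<bar>B / D\<bar><..<ln \<bar>A / C\<bar>}"
proof -
  have A: "A \<noteq> 0" "B \<noteq> 0" "C \<noteq> 0" using less nz by auto
  have sq: "B\<^sup>2 * C\<^sup>2 < A\<^sup>2 * D\<^sup>2"
    using power_strict_mono[OF less, of 2] by (simp add: power_mult_distrib)
  have pos: "0 < A\<^sup>2" "0 < B\<^sup>2" "0 < C\<^sup>2" "0 < D\<^sup>2" using A nz by auto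
  show ?thesis
  proof (intro equalityI subsetI)
    fix x assume "x \<in> range (\<lambda>t. ln (cmod (mob (mat2 A B C D) (\<i> * of_real (exp t)))))"
    then obtain t where x: "x = ln (cmod (mob (mat2 A B C D) (\<i> * of_real (exp t))))" by auto
    define m where "m = cmod (mob (mat2 A B C D) (\<i> * of_real (exp t)))"
    define Y where "Y = (exp t)\<^sup>2"
    have Y: "0 < Y" by (simp add: Y_def)
    have den: "0 < C\<^sup>2 * Y + D\<^sup>2" using pos Y by (simp add: add_pos_pos)
    have m2: "m\<^sup>2 = (A\<^sup>2 * Y + B\<^sup>2) / (C\<^sup>2 * Y + D\<^sup>2)"
      unfolding m_def Y_def by (rule cmod_mob_imaginary)
    have "0 < m\<^sup>2" unfolding m2 using den pos Y by (simp add: add_pos_pos)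
    then have m: "0 < m" by (simp add: m_def)
    have "(A\<^sup>2 * Y + B\<^sup>2) * C\<^sup>2 < A\<^sup>2 * (C\<^sup>2 * Y + D\<^sup>2)"
      using sq by (simp add: algebra_simps)
    then have "m\<^sup>2 < \<bar>A / C\<bar>\<^sup>2"
      unfolding m2 using den pos by (simp add: power_divide divide_less_eq less_divide_eq mult.commute)
    then have up: "m < \<bar>A / C\<bar>" by (rule power2_less_imp_less) simp
    have "B\<^sup>2 * (C\<^sup>2 * Y + D\<^sup>2) < (A\<^sup>2 * Y + B\<^sup>2) * D\<^sup>2"
      using mult_strict_right_mono[OF sq Y] by (simp add: algebra_simps)
    then have "\<bar>B / D\<bar>\<^sup>2 < m\<^sup>2"
      unfolding m2 using den pos by (simp add: power_divide divide_less_eq less_divide_eq mult.commute)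
    then have "\<bar>B / D\<bar> < m" using m by (intro power2_less_imp_less[of _ m]) auto
    moreover have "0 < \<bar>B / D\<bar>" using A nz by simp
    ultimately show "x \<in> {ln \<bar>B / D\<bar><..<ln \<bar>A / C\<bar>}"
      using up m unfolding x m_def[symmetric] by simp
  next
    fix x assume x: "x \<in> {ln \<bar>B / D\<bar><..<ln \<bar>A / C\<bar>}"
    have "0 < \<bar>B / D\<bar>" "0 < \<bar>A / C\<bar>" using A nz by auto
    then have "\<bar>B / D\<bar> < exp x" "exp x < \<bar>A / C\<bar>"
      using x by (metis exp_less_cancel_iff exp_ln greaterThanLessThan_iff)+
    then have "\<bar>B / D\<bar>\<^sup>2 < (exp x)\<^sup>2" "(exp x)\<^sup>2 < \<bar>A / C\<bar>\<^sup>2"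
      by (intro power_strict_mono; simp)+
    then have *: "0 < (exp x)\<^sup>2 * D\<^sup>2 - B\<^sup>2" "0 < A\<^sup>2 - (exp x)\<^sup>2 * C\<^sup>2"
      using pos by (simp_all add: power_divide divide_less_eq less_divide_eq)
    define w where "w = (exp x)\<^sup>2"
    \<comment> \<open>The solution of (A^2 Y + B^2)/(C^2 Y + D^2) = w; the two ends of the interval
      make numerator and denominator positive.\<close>
    define Y where "Y = (w * D\<^sup>2 - B\<^sup>2) / (A\<^sup>2 - w * C\<^sup>2)"
    have Y: "0 < Y" using * by (simp add: Y_def w_def)
    define t where "t = ln Y / 2"
    have "(exp t)\<^sup>2 = exp (2 * t)" by (simp add: exp_double)
    then have t: "(exp t)\<^sup>2 = Y" using Y by (simp add: t_def)
    have den: "C\<^sup>2 * Y + D\<^sup>2 \<noteq> 0" using pos Y by (metis add_pos_pos less_irrefl mult_pos_pos)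
    have "Y * (A\<^sup>2 - w * C\<^sup>2) = w * D\<^sup>2 - B\<^sup>2" using * by (simp add: Y_def w_def)
    then have "A\<^sup>2 * Y + B\<^sup>2 = w * (C\<^sup>2 * Y + D\<^sup>2)" by (simp add: algebra_simps)
    then have "(A\<^sup>2 * Y + B\<^sup>2) / (C\<^sup>2 * Y + D\<^sup>2) = w" using den by simp
    then have "(cmod (mob (mat2 A B C D) (\<i> * of_real (exp t))))\<^sup>2 = (exp x)\<^sup>2"
      unfolding cmod_mob_imaginary t by (simp add: w_def)
    then have "cmod (mob (mat2 A B C D) (\<i> * of_real (exp t))) = exp x"
      by (simp add: power2_eq_iff_nonneg)
    then have "x = ln (cmod (mob (mat2 A B C D) (\<i> * of_real (exp t))))" by simp
    then show "x \<in> range (\<lambda>t. ln (cmod (mob (mat2 A B C D) (\<i> * of_real (exp t)))))" by blast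
  qed
qed

text \<open>Both sides are \<open>2 - tr [a, g]\<close> for \<open>a = diag(\<mu>, 1/\<mu>)\<close> and \<open>g = a\<^sup>n b\<close>, by Fricke's identity;
  the commutator \<open>[a, a\<^sup>n b]\<close> is conjugate to \<open>[a, b]\<close> and does not depend on \<open>n\<close>.\<close>

lemma off_diagonal_product:
  fixes A B C D p q r s u v k k' l l' :: real
  assumes "k * k' = 1" "l * l' = 1" "u * v = 1" "p * s - q * r = 1" "A * D - B * C = 1"
    and tr: "A + D = l + l'" "k + k' = u * p + v * s" "A * k + D * k' = l * (u * p) + l' * (v * s)"
  shows "B * C * (k - k')\<^sup>2 = q * r * (l - l')\<^sup>2"
proof -
  \<comment> \<open>The trace of the matrix and that of its product with diag(k, k') determine A and
    D up to the factor k - k'. The rest is B C = A D - 1 and collecting terms.\<close>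
  have A: "A * (k - k') = (l * (u * p) + l' * (v * s)) - (l + l') * k'"
    unfolding tr[symmetric] by (simp add: algebra_simps)
  have D: "D * (k - k') = (l + l') * k - (l * (u * p) + l' * (v * s))"
    unfolding tr[symmetric] by (simp add: algebra_simps)
  have kk: "(k - k')\<^sup>2 = (u * p + v * s)\<^sup>2 - 4"
    unfolding tr[symmetric] using assms(1) by (simp add: power2_eq_square algebra_simps)
  have "B * C * (k - k')\<^sup>2 = A * D * (k - k')\<^sup>2 - (k - k')\<^sup>2"
    using assms(5) by (simp add: algebra_simps)
  also have "A * D * (k - k')\<^sup>2 = (A * (k - k')) * (D * (k - k'))"
    by (simp add: power2_eq_square)
  also have "\<dots> = (l * (u * p) + l' * (v * s)) * (l + l') * (k + k') - (l * (u * p) + l' * (v * s))\<^sup>2 - (l + l')\<^sup>2 * (k * k')"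
    unfolding A D by (simp add: power2_eq_square algebra_simps)
  also have "\<dots> - (k - k')\<^sup>2 = (l * (u * p) + l' * (v * s)) * (l + l') * (u * p + v * s)
      - (l * (u * p) + l' * (v * s))\<^sup>2 - (l + l')\<^sup>2 - (u * p + v * s)\<^sup>2 + 4"
    unfolding kk assms(1) tr(2) by simp
  also have "\<dots> = (l * l' - 1) * ((u * p)\<^sup>2 + (v * s)\<^sup>2) + (u * v) * (p * s) * ((l\<^sup>2 + l'\<^sup>2) - 2 * (l * l') + 2 * (l * l') - 2)
      - (l + l')\<^sup>2 + 4"
    by (simp add: power2_eq_square algebra_simps)
  also have "\<dots> = (p * s) * (l - l')\<^sup>2 - (l + l')\<^sup>2 + 4 * (l * l')"
    unfolding assms(2,3) by (simp add: power2_eq_square algebra_simps assms(2))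
  also have "\<dots> = (p * s - 1) * (l - l')\<^sup>2"
    by (simp add: power2_eq_square algebra_simps)
  also have "p * s - 1 = q * r" using assms(4) by simp
  finally show ?thesis .
qed

section \<open>Groups containing a dilation\<close>

text \<open>The numerator is 2 ln x + O(1). It is applied with x the larger eigenvalue of g and d =
  ln |c|.\<close>

lemma projection_ratio_limit:
  fixes c :: real
  shows "((\<lambda>x. (ln ((x - 1 / x)\<^sup>2 + c) - d) / (2 * ln x)) \<longlongrightarrow> 1) at_top"
  by real_asymp

context deck_group
begin

lemma lift_powers:
  assumes "0 < \<mu>" "mat2 \<mu> 0 0 (1 / \<mu>) \<in> lifts \<Gamma>" "mat2 p q r s \<in> lifts \<Gamma>"
  shows "mat2 (\<mu> ^ n * p) (\<mu> ^ n * q) (r / \<mu> ^ n) (s / \<mu> ^ n) \<in> lifts \<Gamma>"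
proof (induction n)
  case (Suc n)
  then show ?case using lifts_mult[OF assms(2) Suc] assms(1) by (simp add: mult.assoc)
qed (use assms in simp)

text \<open>Nonzero \<open>q\<close> and \<open>r\<close> say that b moves both fixed points 0 and
  infinity of the dilation a, which makes the constant \<open>c\<close> nonzero. Positivity of
  \<open>p\<close> sends the trace of a^n b to +\<infinity>, so these elements are eventually
  hyperbolic.\<close>

lemma full_projections_if_dilation:
  assumes \<mu>: "1 < \<mu>" and a: "mat2 \<mu> 0 0 (1 / \<mu>) \<in> lifts \<Gamma>" and b: "mat2 p q r s \<in> lifts \<Gamma>"
    and p: "0 < p" and q: "q \<noteq> 0" and r: "r \<noteq> 0"
  shows "full_projections \<Gamma>"
proof -
  let ?a = "mat2 \<mu> 0 0 (1 / \<mu>)"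
  define G where "G n = mat2 (\<mu> ^ n * p) (\<mu> ^ n * q) (r / \<mu> ^ n) (s / \<mu> ^ n)" for n
  define \<tau> where "\<tau> n = \<mu> ^ n * p + s / \<mu> ^ n" for n
  \<comment> \<open>This is 2 - tr [a, b].\<close>
  define c where "c = q * r * (\<mu> - 1 / \<mu>)\<^sup>2"
  have "1 / \<mu> < \<mu>" using \<mu> less_trans[of "1 / \<mu>" 1 \<mu>] by simp
  then have c: "c \<noteq> 0" using q r by (auto simp: c_def)
  have G: "G n \<in> lifts \<Gamma>" for n unfolding G_def using \<mu> by (intro lift_powers a b) auto
  then have detG: "det (G n) = 1" for n by (simp add: lifts_def)
  have det: "p * s - q * r = 1" using b by (simp add: lifts_def)
  have lim\<tau>: "filterlim \<tau> at_top sequentially"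
    unfolding \<tau>_def using \<mu> p by real_asymp
  \<comment> \<open>Trace above 2 makes g hyperbolic. The extra 2 |c| yields (k - 1/k)^2 > 2 |c|,
    hence |BC| < 1/2 < |1 + BC| = |AD|.\<close>
  then have "eventually (\<lambda>n. 2 + 2 * \<bar>c\<bar> < \<tau> n) sequentially"
    by (simp add: filterlim_at_top_dense)
  then obtain N where N: "\<And>n. N \<le> n \<Longrightarrow> 2 + 2 * \<bar>c\<bar> < \<tau> n"
    by (auto simp: eventually_sequentially)
  have "\<forall>n. \<exists>T \<kappa>. det T = 1 \<and> 1 < \<kappa> \<and> G (n + N) ** T = T ** mat2 \<kappa> 0 0 (1 / \<kappa>)"
  proof
    fix n
    have "2 < trace (G (n + N))" using N[of "n + N"] by (simp add: G_def trace_2 \<tau>_def)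
    then show "\<exists>T \<kappa>. det T = 1 \<and> 1 < \<kappa> \<and> G (n + N) ** T = T ** mat2 \<kappa> 0 0 (1 / \<kappa>)"
      using hyperbolic_diagonalizable[OF detG] by metis
  qed
  then obtain T \<kappa> where T: "\<And>n. det (T n) = 1" and \<kappa>: "\<And>n. 1 < \<kappa> n"
    and GT: "\<And>n. G (n + N) ** T n = T n ** mat2 (\<kappa> n) 0 0 (1 / \<kappa> n)" by metis
  have T': "det (adj2 (T n)) = 1" for n using adj2(3)[OF T] .
  have det_a: "det ?a = 1" using \<mu> by simp
  have \<kappa>\<kappa>: "det (mat2 (\<kappa> n) 0 0 (1 / \<kappa> n)) = 1" for n using \<kappa>[of n] by simp
  have conjG: "adj2 (T n) ** G (n + N) ** T n = mat2 (\<kappa> n) 0 0 (1 / \<kappa> n)" for n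
    by (metis GT T adj2(2) matrix_mul_assoc matrix_mul_lid)
  have \<kappa>\<tau>: "\<kappa> n + 1 / \<kappa> n = \<tau> (n + N)" for n
    using trace_conj[OF T, of n "G (n + N)"] unfolding conjG by (simp add: trace_2 G_def \<tau>_def)
  \<comment> \<open>The dilation a written in the coordinates in which g is diagonal.\<close>
  define S where "S n = adj2 (T n) ** ?a ** T n" for n
  define X where "X n = \<kappa> n - 1 / \<kappa> n" for n
  have detS: "det (S n) = 1" for n by (simp add: S_def det_mul T T' det_a del: det_mat2)
  have trS: "trace (S n) = \<mu> + 1 / \<mu>" for n
    unfolding S_def trace_conj[OF T] by (simp add: trace_2)
  \<comment> \<open>The product a g is a^(n+1) b, so its trace is the next value of \<tau>.\<close>
  have trSG: "trace (S n ** mat2 (\<kappa> n) 0 0 (1 / \<kappa> n)) = \<tau> (n + N + 1)" for n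
  proof -
    have "S n ** mat2 (\<kappa> n) 0 0 (1 / \<kappa> n) = adj2 (T n) ** (?a ** G (n + N)) ** T n"
      unfolding S_def by (metis GT matrix_mul_assoc)
    then have "trace (S n ** mat2 (\<kappa> n) 0 0 (1 / \<kappa> n)) = trace (?a ** G (n + N))"
      by (simp add: trace_conj[OF T] del: mat2_mult)
    then show ?thesis using \<mu> by (simp add: G_def trace_2 \<tau>_def)
  qed
  have X2: "(X n)\<^sup>2 = (\<tau> (n + N))\<^sup>2 - 4" for n
    unfolding X_def \<kappa>\<tau>[symmetric] using \<kappa>[of n] by (simp add: power2_eq_square field_simps)
  have Xc: "2 * \<bar>c\<bar> < (X n)\<^sup>2" "0 < (X n)\<^sup>2" for n
  proof -
    have t: "2 + 2 * \<bar>c\<bar> < \<tau> (n + N)" using N by simp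
    have "(2 + 2 * \<bar>c\<bar>)\<^sup>2 < (\<tau> (n + N))\<^sup>2" using t by (intro power_strict_mono) auto
    then have "4 + 8 * \<bar>c\<bar> + 4 * c\<^sup>2 < (\<tau> (n + N))\<^sup>2" by (simp add: power2_eq_square algebra_simps)
    then show "2 * \<bar>c\<bar> < (X n)\<^sup>2" unfolding X2 using zero_le_power2[of c] abs_ge_zero[of c] by linarith
    then show "0 < (X n)\<^sup>2" using abs_ge_zero[of c] by linarith
  qed
  have BC: "S n $ 1 $ 2 * S n $ 2 $ 1 * (X n)\<^sup>2 = c" for n
    unfolding X_def c_def
  proof (rule off_diagonal_product)
    show "\<kappa> n * (1 / \<kappa> n) = 1" "\<mu> * (1 / \<mu>) = 1" "\<mu> ^ (n + N) * (1 / \<mu> ^ (n + N)) = 1"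
      using \<kappa>[of n] \<mu> by auto
    show "p * s - q * r = 1" by fact
    show "S n $ 1 $ 1 * S n $ 2 $ 2 - S n $ 1 $ 2 * S n $ 2 $ 1 = 1" using detS[of n] by (simp add: det_2)
    show "S n $ 1 $ 1 + S n $ 2 $ 2 = \<mu> + 1 / \<mu>" using trS[of n] by (simp add: trace_2)
    show "\<kappa> n + 1 / \<kappa> n = \<mu> ^ (n + N) * p + 1 / \<mu> ^ (n + N) * s" using \<kappa>\<tau>[of n] by (simp add: \<tau>_def)
    show "S n $ 1 $ 1 * \<kappa> n + S n $ 2 $ 2 * (1 / \<kappa> n) = \<mu> * (\<mu> ^ (n + N) * p) + 1 / \<mu> * (1 / \<mu> ^ (n + N) * s)"
      using trSG[of n] by (simp add: trace_2 mat2_mult_nth \<tau>_def)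
  qed
  \<comment> \<open>This is ln |AD/BC| after inserting BC = c / X^2 and AD = 1 + BC.\<close>
  define P where "P n = ln ((X n)\<^sup>2 + c) - ln \<bar>c\<bar>" for n
  define L where "L n = 2 * ln (\<kappa> n)" for n
  have proj: "range (\<lambda>t. ln (cmod (mob (S n) (\<i> * of_real (exp t))))) \<in> sets borel \<and>
      emeasure lborel (range (\<lambda>t. ln (cmod (mob (S n) (\<i> * of_real (exp t)))))) = ennreal (P n) \<and> 0 \<le> P n" for n
  proof -
    obtain A B C D where S: "S n = mat2 A B C D" by (rule mat2_cases)
    have bc: "B * C = c / (X n)\<^sup>2" using BC[of n] Xc(2)[of n] by (simp add: S nonzero_eq_divide_eq)
    have ad: "A * D = 1 + c / (X n)\<^sup>2" using detS[of n] by (simp add: S bc)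
    have small: "\<bar>c / (X n)\<^sup>2\<bar> < 1 / 2" using Xc[of n] by (simp add: abs_divide divide_less_eq)
    then have less: "\<bar>B * C\<bar> < \<bar>A * D\<bar>" unfolding ad bc by linarith
    have "A * D \<noteq> 0" using less by auto
    then have nz: "B * C \<noteq> 0" "D \<noteq> 0" using c Xc(2)[of n] bc by auto
    then have nz': "B \<noteq> 0" "C \<noteq> 0" "A \<noteq> 0" using less by auto
    note range = range_ln_cmod_mob_imaginary[OF nz less]
    have "\<bar>A / C\<bar> / \<bar>B / D\<bar> = \<bar>A * D\<bar> / \<bar>B * C\<bar>" using nz nz' by (simp add: abs_mult abs_divide)
    also have "\<dots> = ((X n)\<^sup>2 + c) / \<bar>c\<bar>"
    proof -
      have "A * D = ((X n)\<^sup>2 + c) / (X n)\<^sup>2" unfolding ad using Xc(2)[of n] by (simp add: add_divide_distrib)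
      moreover have "0 < (X n)\<^sup>2 + c" using Xc(1)[of n] by linarith
      ultimately have "\<bar>A * D\<bar> = ((X n)\<^sup>2 + c) / (X n)\<^sup>2" using Xc(2)[of n] by simp
      then show ?thesis unfolding bc using Xc(2)[of n] c by (simp add: abs_divide)
    qed
    finally have "ln (\<bar>A / C\<bar> / \<bar>B / D\<bar>) = ln (((X n)\<^sup>2 + c) / \<bar>c\<bar>)" by simp
    moreover have "ln (((X n)\<^sup>2 + c) / \<bar>c\<bar>) = P n"
    proof -
      have "0 < (X n)\<^sup>2 + c" using Xc(1)[of n] by linarith
      then show ?thesis unfolding P_def by (rule ln_divide_pos) (use c in simp)
    qed
    moreover have "ln (\<bar>A / C\<bar> / \<bar>B / D\<bar>) = ln \<bar>A / C\<bar> - ln \<bar>B / D\<bar>"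
      by (rule ln_divide_pos) (use nz nz' in auto)
    ultimately have P: "ln \<bar>A / C\<bar> - ln \<bar>B / D\<bar> = P n"
      by metis
    have "\<bar>B / D\<bar> < \<bar>A / C\<bar>" using less nz nz' by (simp add: abs_divide abs_mult field_simps)
    then have le: "ln \<bar>B / D\<bar> \<le> ln \<bar>A / C\<bar>" using nz nz' by (intro ln_mono) auto
    then show ?thesis unfolding S range using P by simp
  qed
  have ratio: "(\<lambda>n. P n / L n) \<longlonglongrightarrow> 1"
  proof -
    have "filterlim (\<lambda>n. \<tau> (n + N)) at_top sequentially"
      using lim\<tau> by (rule filterlim_compose) (rule filterlim_add_const_nat_at_top)
    then have lim: "filterlim (\<lambda>n. - 1 + \<tau> (n + N)) at_top sequentially"
      by (rule filterlim_tendsto_add_at_top[OF tendsto_const])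
    \<comment> \<open>Since 1/\<kappa> < 1, the eigenvalue grows with the trace.\<close>
    have "- 1 + \<tau> (n + N) \<le> \<kappa> n" for n
      using \<kappa>[of n] unfolding \<kappa>\<tau>[symmetric] by simp
    then have "filterlim \<kappa> at_top sequentially"
      by (intro filterlim_at_top_mono[OF lim] always_eventually allI)
    then show ?thesis
      using filterlim_compose[OF projection_ratio_limit[of c "ln \<bar>c\<bar>"]] by (simp add: P_def L_def X_def)
  qed
  show ?thesis
    unfolding full_projections_def
  proof (rule exI[of _ T], rule exI[of _ L], rule exI[of _ P], intro conjI allI)
    show "(\<lambda>n. P n / L n) \<longlonglongrightarrow> 1" by (rule ratio)
    fix n
    show "det (T n) = 1" "0 < L n" "0 \<le> P n" using T \<kappa>[of n] proj by (auto simp: L_def)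
    have haxis_mem: "haxis (T n) t \<in> hplane" for t by (rule haxis_in_hplane[OF T])
    obtain g where g: "g \<in> \<Gamma>" "\<forall>z\<in>hplane. g z = mob (G (n + N)) z" using G[of "n + N"] by (auto simp: lifts_def)
    have "g (haxis (T n) t) = haxis (T n) (t + L n)" for t
    proof -
      have "g (haxis (T n) t) = mob (G (n + N) ** T n) (\<i> * of_real (exp t))"
        unfolding haxis_def using g(2) haxis_mem[of t] by (simp add: mob_mult detG T haxis_def)
      also have "\<dots> = mob (T n) (mob (mat2 (\<kappa> n) 0 0 (1 / \<kappa> n)) (\<i> * of_real (exp t)))"
        unfolding GT by (intro mob_mult T \<kappa>\<kappa>) simp
      also have "mob (mat2 (\<kappa> n) 0 0 (1 / \<kappa> n)) (\<i> * of_real (exp t)) = \<i> * of_real (exp (t + L n))"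
      proof -
        have "exp (L n) = \<kappa> n * \<kappa> n" unfolding L_def using \<kappa>[of n] by (simp add: exp_double power2_eq_square)
        then show ?thesis using \<kappa>[of n] by (simp add: mob_mat2 exp_add)
      qed
      finally show ?thesis by (simp add: haxis_def)
    qed
    then show "\<exists>g\<in>\<Gamma>. \<forall>t. g (haxis (T n) t) = haxis (T n) (t + L n)" using g(1) by blast
    obtain h where h: "h \<in> \<Gamma>" "\<forall>z\<in>hplane. h z = mob ?a z" using a by (auto simp: lifts_def)
    have "haxis_proj (T n) (h (haxis (T n) t)) = ln (cmod (mob (S n) (\<i> * of_real (exp t))))" for t
    proof -
      have "mob (S n) (\<i> * of_real (exp t)) = mob (adj2 (T n)) (mob ?a (mob (T n) (\<i> * of_real (exp t))))"
        unfolding S_def by (simp add: mob_mult det_mul T T' det_a mob_in_hplane del: det_mat2)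
      then show ?thesis using h(2) haxis_mem[of t] by (simp add: haxis_proj_def haxis_def)
    qed
    then show "\<exists>h\<in>\<Gamma>. \<exists>E\<in>sets borel. emeasure lborel E = ennreal (P n) \<and>
        E = range (\<lambda>t. haxis_proj (T n) (h (haxis (T n) t)))"
      using proj[of n] by (intro bexI[OF _ h(1)]) auto
  qed
qed

end

section \<open>The dichotomy between full projections and elementary groups\<close>

text \<open>With ad - bc = 1 the right side is half the sum of the squared entries. Bounded matrices
  are thus exactly those that move i by a bounded amount.\<close>

lemma cosh_hdist_i_mob:
  assumes "det (mat2 a b c d) = 1"
  shows "cosh (hdist \<i> (mob (mat2 a b c d) \<i>)) = 1 + ((b + c)\<^sup>2 + (a - d)\<^sup>2) / 2"
proof -
  let ?M = "mat2 a b c d"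
  define n where "n = of_real c * \<i> + of_real d"
  have n: "n \<noteq> 0" using mob_denom_nonzero[OF assms i_in_hplane] by (simp add: n_def)
  have Im: "Im (mob ?M \<i>) = 1 / (cmod n)\<^sup>2" using Im_mob[OF assms i_in_hplane] by (simp add: n_def)
  have "\<i> - mob ?M \<i> = (\<i> * n - (of_real a * \<i> + of_real b)) / n"
    using n by (simp add: mob_mat2 n_def[symmetric] diff_divide_distrib)
  then have "(cmod (\<i> - mob ?M \<i>))\<^sup>2 = (cmod (\<i> * n - (of_real a * \<i> + of_real b)))\<^sup>2 / (cmod n)\<^sup>2"
    by (simp add: norm_divide power_divide)
  also have "(cmod (\<i> * n - (of_real a * \<i> + of_real b)))\<^sup>2 = (b + c)\<^sup>2 + (a - d)\<^sup>2"
    unfolding cmod_power2 by (simp add: n_def power2_eq_square algebra_simps)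
  finally show ?thesis
    using n by (simp add: cosh_hdist mob_in_hplane[OF assms] Im)
qed

lemma mob_eq_identity:
  assumes "det (mat2 p q r s) = 1" and id: "\<And>z. z \<in> hplane \<Longrightarrow> mob (mat2 p q r s) z = z"
  shows "q = 0" "r = 0" "p = s"
proof -
  have *: "of_real p * z + of_real q = z * (of_real r * z + of_real s)" if "z \<in> hplane" for z
    using id[OF that] mob_denom_nonzero[OF assms(1) that] by (simp add: mob_mat2 divide_eq_eq)
  show "q = 0" "r = 0" "p = s"
    using *[of "\<i>"] *[of "Complex 0 2"] by (simp_all add: hplane_iff complex_eq_iff)
qed

context deck_group
begin

lemma lift_identity: "mat2 1 0 0 1 \<in> lifts \<Gamma>"
  using id_in by (auto simp: lifts_def mob_mat2 intro!: bexI[of _ "\<lambda>z\<in>hplane. z"])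

text \<open>A smaller trace would produce a fixed point, so by freeness the identity; but its
  matrices have trace 2 or -2.\<close>

lemma lifts_not_elliptic:
  assumes M: "M \<in> lifts \<Gamma>"
  shows "2 \<le> \<bar>trace M\<bar>"
proof (rule ccontr)
  obtain p q r s where pqrs: "M = mat2 p q r s" by (rule mat2_cases)
  have det: "det M = 1" using M by (simp add: lifts_def)
  assume "\<not> 2 \<le> \<bar>trace M\<bar>"
  then obtain z where "z \<in> hplane" "mob M z = z" using elliptic_fixed_point[OF det] by auto
  then have "mob M w = w" if "w \<in> hplane" for w using lifts_free[OF M] that by blast
  then have *: "q = 0" "p = s" using mob_eq_identity[of p q r s] det unfolding pqrs by blast+
  then have "s * s = 1" using det by (simp add: pqrs)
  then have "\<bar>s\<bar> = 1" by (metis abs_mult_self_eq abs_square_eq_1 power2_eq_square)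
  then show False using \<open>\<not> 2 \<le> \<bar>trace M\<bar>\<close> * by (simp add: pqrs trace_2)
qed

text \<open>The bound on the entries bounds the displacement of i, and only finitely many deck
  transformations satisfy such a bound; an infinite sequence of them repeats.\<close>

lemma bounded_lifts_repeat:
  assumes M: "\<And>n::nat. mat2 p (q n) (r n) s \<in> lifts \<Gamma>" and bound: "\<And>n. (q n + r n)\<^sup>2 + (p - s)\<^sup>2 \<le> C"
  obtains m n where "m < n" "mob (mat2 p (q m) (r m) s) \<i> = mob (mat2 p (q n) (r n) s) \<i>"
proof -
  have det: "det (mat2 p (q n) (r n) s) = 1" for n using M[of n] by (simp add: lifts_def)
  have "\<forall>n. \<exists>g\<in>\<Gamma>. \<forall>z\<in>hplane. g z = mob (mat2 p (q n) (r n) s) z"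
    using M by (auto simp: lifts_def)
  then obtain g where g: "\<And>n. g n \<in> \<Gamma>" "\<And>n z. z \<in> hplane \<Longrightarrow> g n z = mob (mat2 p (q n) (r n) s) z"
    by metis
  have "hdist \<i> (g n \<i>) \<le> arcosh (1 + C / 2)" for n
  proof -
    have gi: "g n \<i> \<in> hplane" by (rule maps[OF g(1) i_in_hplane])
    have "cosh (hdist \<i> (g n \<i>)) \<le> 1 + C / 2"
      using cosh_hdist_i_mob[OF det[of n]] bound[of n] by (simp add: g(2))
    moreover have "1 \<le> cosh (hdist \<i> (g n \<i>))" by (rule cosh_real_ge_1)
    ultimately have "cosh (hdist \<i> (g n \<i>)) \<le> cosh (arcosh (1 + C / 2))" "1 \<le> 1 + C / 2" by auto
    then show ?thesis
      using cosh_real_nonneg_le_iff[OF hdist_nonneg[OF i_in_hplane gi] arcosh_nonneg_real] by blast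
  qed
  then have "range g \<subseteq> {g \<in> \<Gamma>. hdist \<i> (g \<i>) \<le> arcosh (1 + C / 2)}" using g(1) by auto
  then have "finite (range g)" using finite_displacement[OF i_in_hplane] by (meson finite_subset)
  then have "\<not> inj g" using finite_imageD by blast
  then obtain m n where "m < n" "g m = g n" by (metis injI linorder_neqE_nat)
  then show thesis using that g(2)[OF i_in_hplane] by metis
qed

text \<open>If \<open>b\<close> shared exactly one fixed point with the dilation \<open>a\<close>, the elements
  \<open>a\<^sup>n b a\<^sup>-\<^sup>n\<close> (or their inverse conjugates) would be pairwise distinct but bounded.\<close>

lemma lift_triangular_iff_diagonal:
  assumes \<mu>: "1 < \<mu>" and a: "mat2 \<mu> 0 0 (1 / \<mu>) \<in> lifts \<Gamma>" and b: "mat2 p q r s \<in> lifts \<Gamma>"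
  shows "q = 0 \<longleftrightarrow> r = 0"
proof -
  have det: "p * s - q * r = 1" using b by (simp add: lifts_def)
  have an: "mat2 (\<mu> ^ n) 0 0 (1 / \<mu> ^ n) \<in> lifts \<Gamma>" for n
    using lift_powers[OF _ a lift_identity, of n] \<mu> by simp
  have an': "mat2 (1 / \<mu> ^ n) 0 0 (\<mu> ^ n) \<in> lifts \<Gamma>" for n
    using lifts_adj2[OF an[of n]] by (simp add: adj2_def)
  have pow: "1 \<le> \<mu> ^ n * \<mu> ^ n" for n using \<mu> by (simp add: power_add[symmetric])
  have inj: "m = n" if "x / (\<mu> ^ m * \<mu> ^ m) = x / (\<mu> ^ n * \<mu> ^ n)" "x \<noteq> 0" for m n and x :: real
  proof -
    have "\<mu> ^ (m + m) = \<mu> ^ (n + n)" using that \<mu> by (simp add: power_add)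
    then have "m + m = n + n" using power_inject_exp[OF \<mu>] by blast
    then show ?thesis by simp
  qed
  have bound: "(x / (\<mu> ^ n * \<mu> ^ n))\<^sup>2 \<le> x\<^sup>2" for n x
  proof -
    have "\<bar>x / (\<mu> ^ n * \<mu> ^ n)\<bar> = \<bar>x\<bar> / (\<mu> ^ n * \<mu> ^ n)" using \<mu> by (simp add: abs_divide)
    also have "\<dots> \<le> \<bar>x\<bar> / 1" using pow[of n] by (intro divide_left_mono) auto
    finally have "\<bar>x / (\<mu> ^ n * \<mu> ^ n)\<bar> \<le> \<bar>x\<bar>" by simp
    then show ?thesis by (simp only: abs_le_square_iff)
  qed
  show ?thesis
  proof
    assume r: "r = 0"
    then have ps: "p \<noteq> 0" "s \<noteq> 0" using det by auto
    show "q = 0"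
    proof (rule ccontr)
      assume q: "q \<noteq> 0"
      have "mat2 p (q / (\<mu> ^ n * \<mu> ^ n)) 0 s \<in> lifts \<Gamma>" for n
        using lifts_mult[OF lifts_mult[OF an'[of n] b] an[of n]] \<mu> r by (simp add: mult.assoc)
      then obtain m n where mn: "m < n"
        "mob (mat2 p (q / (\<mu> ^ m * \<mu> ^ m)) 0 s) \<i> = mob (mat2 p (q / (\<mu> ^ n * \<mu> ^ n)) 0 s) \<i>"
        by (rule bounded_lifts_repeat[where C = "q\<^sup>2 + (p - s)\<^sup>2"]) (use bound in auto)
      then have "q / (\<mu> ^ m * \<mu> ^ m) = q / (\<mu> ^ n * \<mu> ^ n)"
        using ps by (auto simp: mob_mat2 complex_eq_iff)
      then show False using inj q mn(1) by blast
    qed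
  next
    assume q: "q = 0"
    then have ps: "p \<noteq> 0" "s \<noteq> 0" using det by auto
    show "r = 0"
    proof (rule ccontr)
      assume r: "r \<noteq> 0"
      have lift: "mat2 p 0 (r / (\<mu> ^ n * \<mu> ^ n)) s \<in> lifts \<Gamma>" for n
        using lifts_mult[OF lifts_mult[OF an[of n] b] an'[of n]] \<mu> q by (simp add: mult.assoc)
      then obtain m n where mn: "m < n"
        "mob (mat2 p 0 (r / (\<mu> ^ m * \<mu> ^ m)) s) \<i> = mob (mat2 p 0 (r / (\<mu> ^ n * \<mu> ^ n)) s) \<i>"
        by (rule bounded_lifts_repeat[where C = "r\<^sup>2 + (p - s)\<^sup>2"]) (use bound in auto)
      have "of_real p * \<i> \<noteq> 0" using ps by simp
      moreover have "of_real p * \<i> / (of_real (r / (\<mu> ^ m * \<mu> ^ m)) * \<i> + of_real s) =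
          of_real p * \<i> / (of_real (r / (\<mu> ^ n * \<mu> ^ n)) * \<i> + of_real s)"
        using mn(2) by (simp add: mob_mat2)
      ultimately have "of_real (r / (\<mu> ^ m * \<mu> ^ m)) * \<i> + of_real s = of_real (r / (\<mu> ^ n * \<mu> ^ n)) * \<i> + of_real s"
        by (metis divide_cancel_left)
      then have "r / (\<mu> ^ m * \<mu> ^ m) = r / (\<mu> ^ n * \<mu> ^ n)" by (simp add: complex_eq_iff)
      then show False using inj r mn(1) by blast
    qed
  qed
qed

text \<open>Either some lift moves both fixed points of the dilation, or every lift is diagonal and
  the whole group preserves the imaginary axis.\<close>

lemma dichotomy_if_dilation:
  assumes \<mu>: "1 < \<mu>" and a: "mat2 \<mu> 0 0 (1 / \<mu>) \<in> lifts \<Gamma>"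
  shows "full_projections \<Gamma> \<or> circle_dominated \<Gamma>"
proof (cases "\<exists>M\<in>lifts \<Gamma>. M $ 2 $ 1 \<noteq> 0")
  case True
  then obtain p q r s where b: "mat2 p q r s \<in> lifts \<Gamma>" and r: "r \<noteq> 0"
    by (metis mat2_cases mat2_nth(3))
  have q: "q \<noteq> 0" using lift_triangular_iff_diagonal[OF \<mu> a b] r by blast
  have nz: "full_projections \<Gamma>" if M: "mat2 p q r s \<in> lifts \<Gamma>" and nz: "p \<noteq> 0" "q \<noteq> 0" "r \<noteq> 0" for p q r s
  proof (cases "0 < p")
    case True
    then show ?thesis using full_projections_if_dilation[OF \<mu> a M] nz by blast
  next
    case False
    have "- mat2 p q r s = mat2 (- p) (- q) (- r) (- s)" by (simp add: mat2_eq_iff)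
    then have "mat2 (- p) (- q) (- r) (- s) \<in> lifts \<Gamma>" using lifts_uminus[OF M] by simp
    then show ?thesis using full_projections_if_dilation[OF \<mu> a] False nz by (metis neg_0_less_iff_less neg_equal_0_iff_equal linorder_neqE_linordered_idom)
  qed
  \<comment> \<open>Otherwise b would be a half-turn exchanging the ends of the axis, with trace 0.
    If only p vanishes, the inverse of b has a nonzero upper left entry and serves instead.\<close>
  have "p \<noteq> 0 \<or> s \<noteq> 0"
    using lifts_not_elliptic[OF b] by (auto simp: trace_2)
  moreover have "mat2 s (- q) (- r) p \<in> lifts \<Gamma>" using lifts_adj2[OF b] by (simp add: adj2_def)
  ultimately show ?thesis using nz[OF b] nz[of s "- q" "- r" p] q r by auto
next
  case False
  then have r0: "r = 0" if "mat2 p q r s \<in> lifts \<Gamma>" for p q r s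
    using that by (metis mat2_nth(3))
  then have q0: "q = 0" if "mat2 p q r s \<in> lifts \<Gamma>" for p q r s
    using lift_triangular_iff_diagonal[OF \<mu> a that] that by blast
  obtain g0 where g0: "g0 \<in> \<Gamma>" "g0 \<i> = mob (mat2 \<mu> 0 0 (1 / \<mu>)) \<i>"
    using a by (auto simp: lifts_def)
  have "circle_dominated \<Gamma>"
  proof (rule circle_dominated_dilations[OF _ g0(1)])
    have "cmod (g0 \<i>) = \<mu> * \<mu>" using \<mu> by (simp add: g0 mob_mat2 norm_mult norm_divide)
    moreover have "1 * 1 < \<mu> * \<mu>" using \<mu> by (intro mult_strict_mono) auto
    ultimately show "cmod (g0 \<i>) \<noteq> 1" by simp
    fix g assume g: "g \<in> \<Gamma>"
    show "\<exists>k>0. (\<forall>z\<in>hplane. g z = of_real k * z) \<or> (\<forall>z\<in>hplane. g z = of_real k * mirror z)"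
      using g
    proof (cases rule: cases)
      case (mob A)
      obtain p q r s where A: "A = mat2 p q r s" by (rule mat2_cases)
      have "mat2 p q r s \<in> lifts \<Gamma>" using mob g by (auto simp: lifts_def A)
      then have qr: "q = 0" "r = 0" using q0 r0 by blast+
      then have "p * s = 1" using mob(1) by (simp add: A)
      then have "p \<noteq> 0" by auto
      with \<open>p * s = 1\<close> have s: "p \<noteq> 0" "s = 1 / p"
        by (simp_all add: nonzero_eq_divide_eq mult.commute)
      have "g z = of_real (p * p) * z" if "z \<in> hplane" for z
        using mob(2)[OF that] s by (simp add: A qr mob_mat2)
      then show ?thesis using s(1) by (intro exI[of _ "p * p"]) (auto simp: zero_less_mult_iff)
    next
      case (mirror A)
      obtain p q r s where A: "A = mat2 p q r s" by (rule mat2_cases)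
      have det: "det (mat2 p q r s) = 1" using mirror(1) by (simp add: A)
      note sq = mirror_square_lift[OF g det mirror(2)[unfolded A]]
      \<comment> \<open>The square has off-diagonal entries q (s - p) and r (p - s). They vanish
        because the square is a diagonal lift, and p differs from s.\<close>
      have "q = 0" "r = 0" using q0[OF sq(1)[simplified]] r0[OF sq(1)[simplified]] sq(2) by (auto simp: algebra_simps)
      note qr = this
      then have "p * s = 1" using det by simp
      then have "p \<noteq> 0" by auto
      with \<open>p * s = 1\<close> have s: "p \<noteq> 0" "s = 1 / p"
        by (simp_all add: nonzero_eq_divide_eq mult.commute)
      have "g z = of_real (p * p) * mirror z" if "z \<in> hplane" for z
        using mirror(2)[OF that] s by (simp add: A qr mob_mat2)
      then show ?thesis using s(1) by (intro exI[of _ "p * p"]) (auto simp: zero_less_mult_iff)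
    qed
  qed
  then show ?thesis ..
qed

text \<open>An orientation-reversing element has a square of trace (p - s)^2 + 2 > 2, so without
  hyperbolic lifts the whole group preserves orientation.\<close>

lemma lift_ex_if_no_hyperbolic:
  assumes no_hyp: "\<And>M. M \<in> lifts \<Gamma> \<Longrightarrow> \<bar>trace M\<bar> \<le> 2" and g: "g \<in> \<Gamma>"
  obtains A where "A \<in> lifts \<Gamma>" "\<And>z. z \<in> hplane \<Longrightarrow> g z = mob A z"
  using g
proof (cases rule: cases)
  case (mob A)
  then show ?thesis using g by (intro that[of A]) (auto simp: lifts_def)
next
  case (mirror A)
  obtain p q r s where A: "A = mat2 p q r s" by (rule mat2_cases)
  have det: "det (mat2 p q r s) = 1" using mirror(1) by (simp add: A)
  note sq = mirror_square_lift[OF g det mirror(2)[unfolded A]]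
  have "trace (mat2 p q r s ** mat2 p (- q) (- r) s) = (p - s)\<^sup>2 + 2"
    using det by (simp add: trace_2 power2_eq_square algebra_simps)
  moreover have "0 < (p - s)\<^sup>2" using sq(2) by simp
  ultimately show ?thesis using no_hyp[OF sq(1)] by linarith
qed

text \<open>The trace of the n-th power of the translation times A is p + s + n t r. Boundedness in
  n forces r = 0; then ps = 1 and |p + s| \<le> 2 force p = s, so A is itself a horizontal
  translation.\<close>

lemma circle_dominated_if_parabolic:
  assumes no_hyp: "\<And>M. M \<in> lifts \<Gamma> \<Longrightarrow> \<bar>trace M\<bar> \<le> 2"
    and t: "t \<noteq> 0" and a: "mat2 1 t 0 1 \<in> lifts \<Gamma>"
  shows "circle_dominated \<Gamma>"
proof -
  have an: "mat2 1 (of_nat n * t) 0 1 \<in> lifts \<Gamma>" for n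
  proof (induction n)
    case (Suc n)
    then show ?case using lifts_mult[OF a Suc] by (simp add: algebra_simps)
  qed (use lift_identity in simp)
  obtain g0 where g0: "g0 \<in> \<Gamma>" "g0 \<i> = mob (mat2 1 t 0 1) \<i>"
    using a by (auto simp: lifts_def)
  show ?thesis
  proof (rule circle_dominated_horizontal_translations[OF _ g0(1)])
    show "g0 \<i> \<noteq> \<i>" using t by (simp add: g0 mob_mat2)
    fix g assume g: "g \<in> \<Gamma>"
    obtain A where A: "A \<in> lifts \<Gamma>" "\<And>z. z \<in> hplane \<Longrightarrow> g z = mob A z"
      using lift_ex_if_no_hyperbolic[OF no_hyp g] by metis
    obtain p q r s where pqrs: "A = mat2 p q r s" by (rule mat2_cases)
    have det: "p * s - q * r = 1" using A(1) by (simp add: lifts_def pqrs)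
    have tr: "\<bar>p + of_nat n * t * r + s\<bar> \<le> 2" for n
      using no_hyp[OF lifts_mult[OF an[of n] A(1)]] by (simp add: pqrs trace_2)
    have "r = 0"
    proof (rule ccontr)
      assume "r \<noteq> 0"
      then have "0 < \<bar>t * r\<bar>" using t by simp
      then obtain n where "4 < of_nat n * \<bar>t * r\<bar>" using ex_less_of_nat_mult by blast
      then have "4 < \<bar>of_nat n * t * r\<bar>" by (simp add: abs_mult mult.assoc)
      then show False using tr[of n] tr[of 0] by simp
    qed
    then have ps: "p * s = 1" using det by simp
    have "(p + s)\<^sup>2 \<le> 2\<^sup>2" using tr[of 0] by (intro power2_le_iff_abs_le[THEN iffD2]) auto
    then have "(p - s)\<^sup>2 \<le> 0" using ps by (simp add: power2_eq_square algebra_simps)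
    then have "s = p" by simp
    then have "p \<noteq> 0" using ps by auto
    have "g z = z + of_real (q / p)" if "z \<in> hplane" for z
      using A(2)[OF that] \<open>r = 0\<close> \<open>s = p\<close> \<open>p \<noteq> 0\<close> by (simp add: pqrs mob_mat2 add_divide_distrib)
    then show "\<exists>x. \<forall>z\<in>hplane. g z = z + of_real x" by blast
  qed
qed

text \<open>A nontrivial element has trace 2 after a choice of sign, as elliptic elements are
  excluded. Moving its fixed point to infinity reduces to a group containing a horizontal
  translation.\<close>

lemma circle_dominated_if_no_hyperbolic:
  assumes no_hyp: "\<And>M. M \<in> lifts \<Gamma> \<Longrightarrow> \<bar>trace M\<bar> \<le> 2"
  shows "circle_dominated \<Gamma>"
proof (cases "\<forall>g\<in>\<Gamma>. \<forall>z\<in>hplane. g z = z")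
  case True
  then show ?thesis using id_in by (intro circle_dominated_trivial) auto
next
  case False
  then obtain g z0 where g: "g \<in> \<Gamma>" "z0 \<in> hplane" "g z0 \<noteq> z0" by blast
  obtain A0 where A0: "A0 \<in> lifts \<Gamma>" "\<And>z. z \<in> hplane \<Longrightarrow> g z = mob A0 z"
    using lift_ex_if_no_hyperbolic[OF no_hyp g(1)] by metis
  have "\<bar>trace A0\<bar> = 2" using no_hyp[OF A0(1)] lifts_not_elliptic[OF A0(1)] by simp
  define A where "A = (if trace A0 = 2 then A0 else - A0)"
  have A: "A \<in> lifts \<Gamma>" "\<And>z. z \<in> hplane \<Longrightarrow> g z = mob A z" "trace A = 2"
    using A0 lifts_uminus[OF A0(1)] \<open>\<bar>trace A0\<bar> = 2\<close> by (auto simp: A_def trace_2)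
  have "det A = 1" using A(1) by (simp add: lifts_def)
  then obtain T t where T: "det T = 1" "A ** T = T ** mat2 1 t 0 1"
    using A(3) by (rule parabolic_normal_form)
  have conjA: "adj2 T ** A ** T = mat2 1 t 0 1"
    by (metis T adj2(2) matrix_mul_assoc matrix_mul_lid)
  note T' = adj2(3)[OF T(1)]
  have "t \<noteq> 0"
  proof
    assume "t = 0"
    then have "mat2 1 t 0 1 = mat 1" by (simp add: mat2_eq_iff mat_def)
    then have "A ** T = T" using T(2) by simp
    then have "A = mat 1" by (metis T(1) adj2(1) matrix_mul_assoc matrix_mul_rid)
    then show False using A(2) g by simp
  qed
  let ?\<Gamma> = "conj_by (adj2 T) ` \<Gamma>"
  have deck: "deck_group \<Gamma>" by (rule deck_group_axioms)
  have "circle_dominated ?\<Gamma>"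
  proof (rule deck_group.circle_dominated_if_parabolic[OF deck_group_conj[OF deck T'] _ \<open>t \<noteq> 0\<close>])
    show "mat2 1 t 0 1 \<in> lifts ?\<Gamma>"
      using lifts_conj'[OF deck T' A(1)] conjA by simp
    show "\<bar>trace M\<bar> \<le> 2" if "M \<in> lifts ?\<Gamma>" for M
      using no_hyp[OF lifts_conj[OF deck T' that]] trace_conj[OF T'] by simp
  qed
  then show ?thesis by (rule circle_dominated_conj[OF deck T'])
qed

text \<open>A hyperbolic lift, with the sign of positive trace, becomes a dilation after
  conjugation, and both alternatives are invariant under conjugation.\<close>

lemma dichotomy: "full_projections \<Gamma> \<or> circle_dominated \<Gamma>"
proof (cases "\<exists>M\<in>lifts \<Gamma>. 2 < \<bar>trace M\<bar>")
  case True
  then obtain M0 where M0: "M0 \<in> lifts \<Gamma>" "2 < \<bar>trace M0\<bar>" by blast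
  define M where "M = (if 2 < trace M0 then M0 else - M0)"
  have M: "M \<in> lifts \<Gamma>" "2 < trace M"
    using M0 lifts_uminus[OF M0(1)] by (auto simp: M_def trace_2)
  have "det M = 1" using M(1) by (simp add: lifts_def)
  then obtain T \<kappa> where T: "det T = 1" "1 < \<kappa>" "M ** T = T ** mat2 \<kappa> 0 0 (1 / \<kappa>)"
    using M(2) by (rule hyperbolic_diagonalizable)
  have conjM: "adj2 T ** M ** T = mat2 \<kappa> 0 0 (1 / \<kappa>)"
    by (metis T(1,3) adj2(2) matrix_mul_assoc matrix_mul_lid)
  note T' = adj2(3)[OF T(1)]
  let ?\<Gamma> = "conj_by (adj2 T) ` \<Gamma>"
  have deck: "deck_group \<Gamma>" by (rule deck_group_axioms)
  have "mat2 \<kappa> 0 0 (1 / \<kappa>) \<in> lifts ?\<Gamma>"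
    using lifts_conj'[OF deck T' M(1)] conjM by simp
  then have "full_projections ?\<Gamma> \<or> circle_dominated ?\<Gamma>"
    by (rule deck_group.dichotomy_if_dilation[OF deck_group_conj[OF deck T'] T(2)])
  then show ?thesis
    using full_projections_conj[OF deck T'] circle_dominated_conj[OF deck T'] by blast
next
  case False
  then have "circle_dominated \<Gamma>" by (intro circle_dominated_if_no_hyperbolic) (meson not_le)
  then show ?thesis ..
qed

end

theorem claim5p8:
  fixes \<Gamma> :: "(complex \<Rightarrow> complex) set"
  assumes "surface_group \<Gamma>"
    and "surface_euler_char (surface_topology \<Gamma>) < 0"
  shows "\<exists>(\<gamma> :: nat \<Rightarrow> real \<Rightarrow> complex set) (L :: nat \<Rightarrow> real)
            (l :: nat \<Rightarrow> complex set) (m :: nat \<Rightarrow> complex set).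
           (\<forall>n. closed_geodesic \<Gamma> (\<gamma> n) (L n) \<and>
                line_above \<Gamma> (\<gamma> n) (l n) \<and> line_above \<Gamma> (\<gamma> n) (m n)) \<and>
           (\<lambda>n. length_on_line (l n) (orth_proj (l n) ` m n) / ennreal (L n))
             \<longlonglongrightarrow> 1"
proof -
  interpret deck_group \<Gamma> using assms(1) by (rule surface_group_imp_deck_group)
  have "\<not> circle_dominated \<Gamma>"
    using circle_dominated_euler_char assms(2) by (meson not_le)
  then show ?thesis
    using dichotomy full_projections_imp by blast
qed

end
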